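(* Let $M$ be an $n$-dimensional smooth, connected, complete Riemannian manifold. If $X$ is a locally Lipschitz continuous vector field on $M$, then $X$ is almost everywhere differentiable on $M$; that is, the set $M\setminus\mathcal{D}_X$ has measure zero in $M$, where $\mathcal{D}_X:=\{p\in M:\ X \text{ is differentiable at } p\}$.
   Context: $d$ is the Riemannian distance on $M$, $\ell(\gamma)$ is the length of a curve $\gamma$, $B_\delta(p)=\{q\in M: d(p,q)<\delta\}$. A vector field is a mapping $X:M\to TM$ with $X(p)\in T_pM$ for all $p$ (no regularity assumed a priori). For a curve $\gamma$ joining $p$ to $q$, $P_{\gamma,p,q}:T_pM\to T_qM$ is parallel transport along $\gamma$ (Levi-Civita connection). A geodesic segment is the restriction of a geodesic to a closed bounded interval. $X$ is Lipschitz continuous on $\Omega\subset M$ if there is $L>0$ such that $\|P_{\gamma,p,q}X(p)-X(q)\|\le L\,\ell(\gamma)$ for all $p,q\in\Omega$ and every geodesic segment $\gamma$ in $M$ joining $p$ to $q$. $X$ is locally Lipschitz continuous on $M$ if for every $p\in M$ there is $\delta>0$ such that $X$ is Lipschitz continuous on $B_\delta(p)$. Differentiability of $X$ at $p$ is differentiability of the map $X:M\to TM$ at $p$ in smooth charts of $M$ and $TM$. A subset $E\subseteq M$ has measure zero in $M$ if for every smooth chart $(U,\varphi)$ of $M$ the set $\varphi(E\cap U)\subseteq\mathbb{R}^n$ has $n$-dimensional Lebesgue measure zero. *)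

theory Defs
  imports "HOL-Analysis.Analysis"
begin

section \<open>Smooth maps between normed spaces\<close>

text \<open>Both notions are only used on open sets \<open>S\<close>.\<close>

fun Ck_on :: "nat \<Rightarrow> 'a::real_normed_vector set \<Rightarrow> ('a \<Rightarrow> 'b::real_normed_vector) \<Rightarrow> bool" where
  "Ck_on 0 S f \<longleftrightarrow> continuous_on S f"
| "Ck_on (Suc k) S f \<longleftrightarrow> (\<forall>x\<in>S. f differentiable (at x)) \<and>
     (\<forall>v. Ck_on k S (\<lambda>x. frechet_derivative f (at x) v))"

definition smooth_on :: "'a::real_normed_vector set \<Rightarrow> ('a \<Rightarrow> 'b::real_normed_vector) \<Rightarrow> bool" where
  "smooth_on S f \<longleftrightarrow> (\<forall>k. Ck_on k S f)"


section \<open>Charts and smooth manifolds\<close>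

text \<open>A chart \<open>(U, \<phi>)\<close> is a domain together with a total function whose values outside \<open>U\<close>
  are irrelevant.\<close>

type_synonym ('p, 'e) chart = "'p set \<times> ('p \<Rightarrow> 'e)"

definition chart_inv :: "('p, 'e) chart \<Rightarrow> 'e \<Rightarrow> 'p" where
  "chart_inv c = inv_into (fst c) (snd c)"

definition chart_image :: "('p, 'e) chart \<Rightarrow> 'e set" where
  "chart_image c = snd c ` fst c"

definition transition :: "('p, 'e) chart \<Rightarrow> ('p, 'e) chart \<Rightarrow> 'e \<Rightarrow> 'e" where
  "transition c d = snd d \<circ> chart_inv c"

definition compatible ::
  "('p, 'e::real_normed_vector) chart \<Rightarrow> ('p, 'e) chart \<Rightarrow> bool" where
  "compatible c d \<longleftrightarrow>
     open (snd c ` (fst c \<inter> fst d)) \<and> open (snd d ` (fst c \<inter> fst d)) \<and>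
     smooth_on (snd c ` (fst c \<inter> fst d)) (transition c d) \<and>
     smooth_on (snd d ` (fst c \<inter> fst d)) (transition d c)"

text \<open>All smooth charts of the manifold with atlas \<open>A\<close>, i.e. the maximal atlas generated by \<open>A\<close>.
  No topology on the points is mentioned: the topology is the one making the charts in \<open>A\<close>
  homeomorphisms, and a chart that is compatible with all of \<open>A\<close> is then automatically a
  homeomorphism between open sets. This form is also usable for the tangent bundle.\<close>

definition smooth_charts ::
  "('p, 'e::real_normed_vector) chart set \<Rightarrow> ('p, 'e) chart set" where
  "smooth_charts A = {c. fst c \<subseteq> \<Union> (fst ` A) \<and> inj_on (snd c) (fst c) \<and> open (chart_image c) \<and>
     (\<forall>d\<in>A. compatible c d)}"

text \<open>A smooth structure (maximal smooth atlas) on a topological space, all of whose points belong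
  to the manifold. The dimension is \<open>CARD('n)\<close>.\<close>

definition smooth_structure :: "('m::topological_space, real^'n::finite) chart set \<Rightarrow> bool" where
  "smooth_structure A \<longleftrightarrow>
     (\<forall>c\<in>A. open (fst c) \<and> open (chart_image c) \<and>
        homeomorphism (fst c) (chart_image c) (snd c) (chart_inv c)) \<and>
     \<Union> (fst ` A) = UNIV \<and>
     (\<forall>c\<in>A. \<forall>d\<in>A. compatible c d) \<and>
     smooth_charts A \<subseteq> A"

text \<open>Differentiability at a point of a map between two manifolds given by atlases.\<close>

definition differentiable_map_at ::
  "('p, 'e::real_normed_vector) chart set \<Rightarrow> ('q, 'f::real_normed_vector) chart set \<Rightarrow>
   ('p \<Rightarrow> 'q) \<Rightarrow> 'p \<Rightarrow> bool" where
  "differentiable_map_at A B F p \<longleftrightarrow>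
     (\<exists>c\<in>smooth_charts A. \<exists>d\<in>smooth_charts B. p \<in> fst c \<and> F p \<in> fst d \<and>
        (\<exists>W. open W \<and> snd c p \<in> W \<and> W \<subseteq> chart_image c \<and> F ` chart_inv c ` W \<subseteq> fst d) \<and>
        (snd d \<circ> F \<circ> chart_inv c) differentiable (at (snd c p)))"

definition measure_zero :: "('m, real^'n::finite) chart set \<Rightarrow> 'm set \<Rightarrow> bool" where
  "measure_zero A E \<longleftrightarrow> (\<forall>c\<in>smooth_charts A. snd c ` (E \<inter> fst c) \<in> null_sets lebesgue)"


section \<open>Tangent vectors and the tangent bundle\<close>

text \<open>A tangent vector at \<open>p\<close> is the family of its coordinate vectors in all charts around \<open>p\<close>,
  related by the derivatives of the transition maps. Charts not containing \<open>p\<close> are assigned \<open>0\<close>,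
  so that equality of functions is equality of tangent vectors and the vector space operations of
  \<open>T\<^sub>p M\<close> are the pointwise ones.\<close>

type_synonym ('m, 'n) tangent = "('m, real^'n) chart \<Rightarrow> real^'n"

definition tangent_space ::
  "('m, real^'n::finite) chart set \<Rightarrow> 'm \<Rightarrow> ('m, 'n) tangent set" where
  "tangent_space A p = {v.
     (\<forall>c. c \<notin> A \<or> p \<notin> fst c \<longrightarrow> v c = 0) \<and>
     (\<forall>c\<in>A. \<forall>d\<in>A. p \<in> fst c \<and> p \<in> fst d \<longrightarrow>
        v d = frechet_derivative (transition c d) (at (snd c p)) (v c))}"

text \<open>The tangent vector at \<open>p\<close> with coordinates \<open>u\<close> in the chart \<open>c\<close>.\<close>

definition tangent_of ::
  "('m, real^'n::finite) chart set \<Rightarrow> ('m, real^'n) chart \<Rightarrow> 'm \<Rightarrow> real^'n \<Rightarrow> ('m, 'n) tangent" where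
  "tangent_of A c p u = (\<lambda>d. if d \<in> A \<and> p \<in> fst d
     then frechet_derivative (transition c d) (at (snd c p)) u else 0)"

definition tangent_bundle_atlas ::
  "('m, real^'n::finite) chart set \<Rightarrow>
   ('m \<times> ('m, 'n) tangent, (real^'n) \<times> (real^'n)) chart set" where
  "tangent_bundle_atlas A =
     (\<lambda>c. ({(p, v). p \<in> fst c \<and> v \<in> tangent_space A p}, \<lambda>(p, v). (snd c p, v c))) ` A"

definition vector_field ::
  "('m, real^'n::finite) chart set \<Rightarrow> ('m \<Rightarrow> ('m, 'n) tangent) \<Rightarrow> bool" where
  "vector_field A X \<longleftrightarrow> (\<forall>p. X p \<in> tangent_space A p)"

definition vector_field_differentiable_at ::
  "('m, real^'n::finite) chart set \<Rightarrow> ('m \<Rightarrow> ('m, 'n) tangent) \<Rightarrow> 'm \<Rightarrow> bool" where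
  "vector_field_differentiable_at A X p \<longleftrightarrow>
     differentiable_map_at A (tangent_bundle_atlas A) (\<lambda>q. (q, X q)) p"


section \<open>Riemannian metrics\<close>

type_synonym ('m, 'n) metric = "'m \<Rightarrow> ('m, 'n) tangent \<Rightarrow> ('m, 'n) tangent \<Rightarrow> real"

text \<open>The Gram matrix of the coordinate frame of the chart \<open>c\<close>, as a function on the image of \<open>c\<close>.\<close>

definition metric_matrix ::
  "('m, real^'n::finite) chart set \<Rightarrow> ('m, 'n) metric \<Rightarrow> ('m, real^'n) chart \<Rightarrow>
   real^'n \<Rightarrow> real^'n^'n" where
  "metric_matrix A g c x = (\<chi> i j. g (chart_inv c x)
     (tangent_of A c (chart_inv c x) (axis i 1)) (tangent_of A c (chart_inv c x) (axis j 1)))"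

definition riemannian_metric ::
  "('m, real^'n::finite) chart set \<Rightarrow> ('m, 'n) metric \<Rightarrow> bool" where
  "riemannian_metric A g \<longleftrightarrow>
     (\<forall>p. \<forall>u\<in>tangent_space A p. \<forall>v\<in>tangent_space A p. \<forall>w\<in>tangent_space A p. \<forall>r::real.
        g p v w = g p w v \<and>
        g p (\<lambda>c. u c + v c) w = g p u w + g p v w \<and>
        g p (\<lambda>c. r *\<^sub>R v c) w = r * g p v w \<and>
        (v \<noteq> (\<lambda>c. 0) \<longrightarrow> g p v v > 0)) \<and>
     (\<forall>c\<in>A. smooth_on (chart_image c) (metric_matrix A g c))"

definition tnorm :: "('m, 'n::finite) metric \<Rightarrow> 'm \<Rightarrow> ('m, 'n) tangent \<Rightarrow> real" where
  "tnorm g p v = sqrt (g p v v)"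


section \<open>Curves, length and distance\<close>

definition smooth_curve ::
  "('m::topological_space, real^'n::finite) chart set \<Rightarrow> real set \<Rightarrow> (real \<Rightarrow> 'm) \<Rightarrow> bool" where
  "smooth_curve A S \<gamma> \<longleftrightarrow> (\<exists>J \<sigma>. open J \<and> S \<subseteq> J \<and> continuous_on J \<sigma> \<and> (\<forall>t\<in>S. \<sigma> t = \<gamma> t) \<and>
     (\<forall>c\<in>A. smooth_on {t\<in>J. \<sigma> t \<in> fst c} (snd c \<circ> \<sigma>)))"

definition piecewise_smooth_curve ::
  "('m::topological_space, real^'n::finite) chart set \<Rightarrow> real \<Rightarrow> real \<Rightarrow> (real \<Rightarrow> 'm) \<Rightarrow> bool" where
  "piecewise_smooth_curve A a b \<gamma> \<longleftrightarrow> a < b \<and> continuous_on {a..b} \<gamma> \<and>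
     (\<exists>T. finite T \<and> (\<forall>u v. a \<le> u \<and> u < v \<and> v \<le> b \<and> {u<..<v} \<inter> T = {} \<longrightarrow>
        smooth_curve A {u..v} \<gamma>))"

text \<open>The velocity of a curve with parameter set \<open>S\<close> (one-sided at end points contained in \<open>S\<close>).\<close>

definition velocity ::
  "('m, real^'n::finite) chart set \<Rightarrow> real set \<Rightarrow> (real \<Rightarrow> 'm) \<Rightarrow> real \<Rightarrow> ('m, 'n) tangent" where
  "velocity A S \<gamma> t = (\<lambda>c. if c \<in> A \<and> \<gamma> t \<in> fst c
     then vector_derivative (snd c \<circ> \<gamma>) (at t within S) else 0)"

text \<open>At the finitely many break points of a piecewise smooth curve the integrand is unspecified,
  which does not affect the integral.\<close>

definition curve_length ::
  "('m, real^'n::finite) chart set \<Rightarrow> ('m, 'n) metric \<Rightarrow> real \<Rightarrow> real \<Rightarrow> (real \<Rightarrow> 'm) \<Rightarrow> real" where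
  "curve_length A g a b \<gamma> = integral {a..b} (\<lambda>t. tnorm g (\<gamma> t) (velocity A {a..b} \<gamma> t))"

definition riem_dist ::
  "('m::topological_space, real^'n::finite) chart set \<Rightarrow> ('m, 'n) metric \<Rightarrow> 'm \<Rightarrow> 'm \<Rightarrow> real" where
  "riem_dist A g p q = Inf {curve_length A g a b \<gamma> | a b \<gamma>.
     piecewise_smooth_curve A a b \<gamma> \<and> \<gamma> a = p \<and> \<gamma> b = q}"

definition riem_ball ::
  "('m::topological_space, real^'n::finite) chart set \<Rightarrow> ('m, 'n) metric \<Rightarrow> 'm \<Rightarrow> real \<Rightarrow> 'm set" where
  "riem_ball A g p \<delta> = {q. riem_dist A g p q < \<delta>}"

definition riem_complete ::
  "('m::topological_space, real^'n::finite) chart set \<Rightarrow> ('m, 'n) metric \<Rightarrow> bool" where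
  "riem_complete A g \<longleftrightarrow> Metric_space.mcomplete UNIV (riem_dist A g)"


section \<open>Levi-Civita connection, parallel transport and geodesics\<close>

definition metric_partial ::
  "('m, real^'n::finite) chart set \<Rightarrow> ('m, 'n) metric \<Rightarrow> ('m, real^'n) chart \<Rightarrow> real^'n \<Rightarrow>
   'n \<Rightarrow> 'n \<Rightarrow> 'n \<Rightarrow> real" where
  "metric_partial A g c x i j l =
     frechet_derivative (\<lambda>y. metric_matrix A g c y $ j $ l) (at x) (axis i 1)"

text \<open>The Levi-Civita connection in the chart \<open>c\<close>:
  \<open>\<nabla>\<^bsub>\<partial>i\<^esub> \<partial>j = (\<Sum>k. christoffel A g c x k i j \<partial>k)\<close>. That these are the coefficients of the unique
  torsion-free connection compatible with the metric is lemma \<open>levi_civita\<close> below.\<close>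

definition christoffel ::
  "('m, real^'n::finite) chart set \<Rightarrow> ('m, 'n) metric \<Rightarrow> ('m, real^'n) chart \<Rightarrow> real^'n \<Rightarrow>
   'n \<Rightarrow> 'n \<Rightarrow> 'n \<Rightarrow> real" where
  "christoffel A g c x k i j = (1/2) * (\<Sum>l\<in>UNIV. matrix_inv (metric_matrix A g c x) $ k $ l *
     (metric_partial A g c x i j l + metric_partial A g c x j i l - metric_partial A g c x l i j))"

text \<open>The covariant derivative \<open>DV/dt\<close> of a vector field \<open>V\<close> along a curve.\<close>

definition covariant_derivative ::
  "('m, real^'n::finite) chart set \<Rightarrow> ('m, 'n) metric \<Rightarrow> real set \<Rightarrow> (real \<Rightarrow> 'm) \<Rightarrow>
   (real \<Rightarrow> ('m, 'n) tangent) \<Rightarrow> real \<Rightarrow> ('m, 'n) tangent" where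
  "covariant_derivative A g S \<gamma> V t = (\<lambda>c. if c \<in> A \<and> \<gamma> t \<in> fst c
     then vector_derivative (\<lambda>s. V s c) (at t within S) +
       (\<chi> k. \<Sum>i\<in>UNIV. \<Sum>j\<in>UNIV.
          christoffel A g c (snd c (\<gamma> t)) k i j * velocity A S \<gamma> t c $ i * V t c $ j)
     else 0)"

definition parallel_along ::
  "('m, real^'n::finite) chart set \<Rightarrow> ('m, 'n) metric \<Rightarrow> real set \<Rightarrow> (real \<Rightarrow> 'm) \<Rightarrow>
   (real \<Rightarrow> ('m, 'n) tangent) \<Rightarrow> bool" where
  "parallel_along A g S \<gamma> V \<longleftrightarrow> (\<forall>t\<in>S. V t \<in> tangent_space A (\<gamma> t) \<and>
     (\<forall>c\<in>A. \<gamma> t \<in> fst c \<longrightarrow> (\<lambda>s. V s c) differentiable (at t within S)) \<and>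
     covariant_derivative A g S \<gamma> V t = (\<lambda>c. 0))"

definition parallel_transport ::
  "('m, real^'n::finite) chart set \<Rightarrow> ('m, 'n) metric \<Rightarrow> real \<Rightarrow> real \<Rightarrow> (real \<Rightarrow> 'm) \<Rightarrow>
   ('m, 'n) tangent \<Rightarrow> ('m, 'n) tangent" where
  "parallel_transport A g a b \<gamma> v =
     (THE w. \<exists>V. parallel_along A g {a..b} \<gamma> V \<and> V a = v \<and> V b = w)"

definition geodesic_on ::
  "('m::topological_space, real^'n::finite) chart set \<Rightarrow> ('m, 'n) metric \<Rightarrow> real set \<Rightarrow>
   (real \<Rightarrow> 'm) \<Rightarrow> bool" where
  "geodesic_on A g J \<gamma> \<longleftrightarrow> smooth_curve A J \<gamma> \<and> parallel_along A g J \<gamma> (velocity A J \<gamma>)"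

definition geodesic_segment ::
  "('m::topological_space, real^'n::finite) chart set \<Rightarrow> ('m, 'n) metric \<Rightarrow> real \<Rightarrow> real \<Rightarrow>
   (real \<Rightarrow> 'm) \<Rightarrow> bool" where
  "geodesic_segment A g a b \<gamma> \<longleftrightarrow> a < b \<and>
     (\<exists>J \<sigma>. open J \<and> is_interval J \<and> {a..b} \<subseteq> J \<and> geodesic_on A g J \<sigma> \<and> (\<forall>t\<in>{a..b}. \<gamma> t = \<sigma> t))"


section \<open>Lipschitz continuous vector fields\<close>

definition lipschitz_vector_field_on ::
  "('m::topological_space, real^'n::finite) chart set \<Rightarrow> ('m, 'n) metric \<Rightarrow> 'm set \<Rightarrow>
   ('m \<Rightarrow> ('m, 'n) tangent) \<Rightarrow> bool" where
  "lipschitz_vector_field_on A g \<Omega> X \<longleftrightarrow> (\<exists>L>0. \<forall>p\<in>\<Omega>. \<forall>q\<in>\<Omega>. \<forall>a b \<gamma>.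
     geodesic_segment A g a b \<gamma> \<and> \<gamma> a = p \<and> \<gamma> b = q \<longrightarrow>
     tnorm g q (\<lambda>c. parallel_transport A g a b \<gamma> (X p) c - X q c) \<le> L * curve_length A g a b \<gamma>)"

definition locally_lipschitz_vector_field ::
  "('m::topological_space, real^'n::finite) chart set \<Rightarrow> ('m, 'n) metric \<Rightarrow>
   ('m \<Rightarrow> ('m, 'n) tangent) \<Rightarrow> bool" where
  "locally_lipschitz_vector_field A g X \<longleftrightarrow>
     (\<forall>p. \<exists>\<delta>>0. lipschitz_vector_field_on A g (riem_ball A g p \<delta>) X)"


section \<open>The Christoffel symbols define the Levi-Civita connection\<close>

lemma smooth_on_differentiable: "smooth_on S f \<Longrightarrow> x \<in> S \<Longrightarrow> f differentiable (at x)"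
  unfolding smooth_on_def by (metis Ck_on.simps(2))

context
  fixes A :: "('m::topological_space, real^'n::finite) chart set"
  assumes A: "smooth_structure A"
begin

lemma chart_inv_left: "c \<in> A \<Longrightarrow> p \<in> fst c \<Longrightarrow> chart_inv c (snd c p) = p"
  using A unfolding smooth_structure_def homeomorphism_def by blast

lemma transition_differentiable:
  assumes "c \<in> A" "d \<in> A" "p \<in> fst c" "p \<in> fst d"
  shows "transition c d differentiable (at (snd c p))"
  using A assms unfolding smooth_structure_def compatible_def
  by (intro smooth_on_differentiable[where S = "snd c ` (fst c \<inter> fst d)"]) auto

lemma frechet_transition_comp:
  assumes "c \<in> A" "d \<in> A" "e \<in> A" "p \<in> fst c" "p \<in> fst d" "p \<in> fst e"
  shows "frechet_derivative (transition c e) (at (snd c p)) u =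
    frechet_derivative (transition d e) (at (snd d p))
      (frechet_derivative (transition c d) (at (snd c p)) u)"
proof -
  let ?S = "snd c ` (fst c \<inter> fst d)"
  have cd: "transition c d (snd c p) = snd d p"
    using assms chart_inv_left by (simp add: transition_def)
  have 1: "(transition c d has_derivative frechet_derivative (transition c d) (at (snd c p)))
      (at (snd c p))"
    using transition_differentiable assms frechet_derivative_works by blast
  have 2: "(transition d e has_derivative frechet_derivative (transition d e) (at (snd d p)))
      (at (transition c d (snd c p)))"
    unfolding cd using transition_differentiable assms frechet_derivative_works by blast
  have 3: "((transition d e \<circ> transition c d) has_derivative
      (frechet_derivative (transition d e) (at (snd d p)) \<circ>
       frechet_derivative (transition c d) (at (snd c p)))) (at (snd c p))"
    by (rule diff_chain_at[OF 1 2])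
  have S: "open ?S" "snd c p \<in> ?S"
    using A assms unfolding smooth_structure_def compatible_def by auto
  have "(transition c e has_derivative
      (frechet_derivative (transition d e) (at (snd d p)) \<circ>
       frechet_derivative (transition c d) (at (snd c p)))) (at (snd c p))"
  proof (rule has_derivative_transform_within_open[OF 3 S])
    fix x assume "x \<in> ?S"
    then obtain q where q: "q \<in> fst c" "q \<in> fst d" "x = snd c q" by auto
    then show "(transition d e \<circ> transition c d) x = transition c e x"
      using assms chart_inv_left by (simp add: transition_def)
  qed
  then have "frechet_derivative (transition c e) (at (snd c p)) =
      frechet_derivative (transition d e) (at (snd d p)) \<circ>
       frechet_derivative (transition c d) (at (snd c p))"
    using frechet_derivative_at by metis
  then show ?thesis by simp
qed

lemma tangent_of_in_tangent_space:
  assumes "c \<in> A" "p \<in> fst c"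
  shows "tangent_of A c p u \<in> tangent_space A p"
proof -
  have "tangent_of A c p u e = frechet_derivative (transition d e) (at (snd d p)) (tangent_of A c p u d)"
    if "d \<in> A" "e \<in> A" "p \<in> fst d" "p \<in> fst e" for d e
    using that frechet_transition_comp[OF assms(1) that(1,2) assms(2) that(3,4), of u]
    by (simp only: tangent_of_def simp_thms if_True)
  moreover have "tangent_of A c p u d = 0" if "d \<notin> A \<or> p \<notin> fst d" for d
    using that by (auto simp: tangent_of_def)
  ultimately show ?thesis unfolding tangent_space_def by blast
qed

lemma tangent_of_same:
  assumes "c \<in> A" "p \<in> fst c"
  shows "tangent_of A c p u c = u"
proof -
  have S: "open (chart_image c)" "snd c p \<in> chart_image c"
    using A assms unfolding smooth_structure_def chart_image_def by auto
  have "(transition c c has_derivative (\<lambda>h. h)) (at (snd c p))"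
    using chart_inv_left[OF assms(1)]
    by (intro has_derivative_transform_within_open[OF has_derivative_ident S])
      (auto simp: transition_def chart_image_def)
  then have "frechet_derivative (transition c c) (at (snd c p)) = (\<lambda>h. h)"
    using frechet_derivative_at by metis
  then show ?thesis using assms by (simp add: tangent_of_def)
qed

lemma tangent_of_add:
  assumes "c \<in> A" "p \<in> fst c"
  shows "tangent_of A c p (u + v) = (\<lambda>d. tangent_of A c p u d + tangent_of A c p v d)"
  using transition_differentiable[OF assms(1)] assms(2)
  by (auto simp: tangent_of_def fun_eq_iff linear_add linear_frechet_derivative)

lemma tangent_of_scale:
  assumes "c \<in> A" "p \<in> fst c"
  shows "tangent_of A c p (r *\<^sub>R u) = (\<lambda>d. r *\<^sub>R tangent_of A c p u d)"
  using transition_differentiable[OF assms(1)] assms(2)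
  by (auto simp: tangent_of_def fun_eq_iff linear_cmul linear_frechet_derivative)

context
  fixes g :: "('m, 'n) metric" and c :: "('m, real^'n) chart" and x :: "real^'n"
  assumes g: "riemannian_metric A g" and c: "c \<in> A" and x: "x \<in> chart_image c"
begin

lemma chart_inv_mem: "y \<in> chart_image c \<Longrightarrow> chart_inv c y \<in> fst c"
  by (simp add: chart_image_def chart_inv_def inv_into_into)

lemma metric_matrix_sym:
  "y \<in> chart_image c \<Longrightarrow> metric_matrix A g c y $ i $ j = metric_matrix A g c y $ j $ i"
proof -
  assume "y \<in> chart_image c"
  then have "tangent_of A c (chart_inv c y) u \<in> tangent_space A (chart_inv c y)" for u
    by (rule tangent_of_in_tangent_space[OF c chart_inv_mem])
  then have "g (chart_inv c y) (tangent_of A c (chart_inv c y) u) (tangent_of A c (chart_inv c y) v) =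
      g (chart_inv c y) (tangent_of A c (chart_inv c y) v) (tangent_of A c (chart_inv c y) u)" for u v
    using g unfolding riemannian_metric_def by blast
  then show ?thesis by (simp add: metric_matrix_def)
qed

lemma metric_partial_sym: "metric_partial A g c x l i j = metric_partial A g c x l j i"
proof -
  have o: "open (chart_image c)" using A c unfolding smooth_structure_def by blast
  have "metric_matrix A g c differentiable (at x)"
    using g c x smooth_on_differentiable unfolding riemannian_metric_def by blast
  then obtain D where D: "(metric_matrix A g c has_derivative D) (at x)"
    unfolding differentiable_def by blast
  have 1: "((\<lambda>y. metric_matrix A g c y $ i $ j) has_derivative (\<lambda>h. D h $ i $ j)) (at x)" for i j
    by (intro bounded_linear.has_derivative[OF bounded_linear_vec_nth] D)
  have "((\<lambda>y. metric_matrix A g c y $ j $ i) has_derivative (\<lambda>h. D h $ i $ j)) (at x)"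
    by (rule has_derivative_transform_within_open[OF 1 o x]) (rule metric_matrix_sym)
  then show ?thesis
    unfolding metric_partial_def using frechet_derivative_at 1 by metis
qed

lemma metric_matrix_pos:
  assumes "u \<noteq> 0"
  shows "u \<bullet> (metric_matrix A g c x *v u) > 0"
proof -
  define p where "p = chart_inv c x"
  have p: "p \<in> fst c" unfolding p_def by (rule chart_inv_mem[OF x])
  let ?t = "tangent_of A c p"
  have t: "?t w \<in> tangent_space A p" for w by (rule tangent_of_in_tangent_space[OF c p])
  have add: "g p (?t (v + w)) (?t z) = g p (?t v) (?t z) + g p (?t w) (?t z)" for v w z
    unfolding tangent_of_add[OF c p] using g t unfolding riemannian_metric_def by blast
  have sc: "g p (?t (r *\<^sub>R w)) (?t z) = r * g p (?t w) (?t z)" for r w z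
    unfolding tangent_of_scale[OF c p] using g t unfolding riemannian_metric_def by blast
  have sy: "g p (?t w) (?t z) = g p (?t z) (?t w)" for w z
    using g t unfolding riemannian_metric_def by blast
  have pd: "?t w \<noteq> (\<lambda>c. 0) \<Longrightarrow> g p (?t w) (?t w) > 0" for w
    using g t unfolding riemannian_metric_def by blast
  have lin: "linear (\<lambda>w. g p (?t w) (?t z))" for z
    by (rule linearI) (simp_all add: add sc)
  have ex: "g p (?t u) (?t z) = (\<Sum>i\<in>UNIV. u $ i * g p (?t (axis i 1)) (?t z))" for z
  proof -
    have "g p (?t u) (?t z) = g p (?t (\<Sum>i\<in>UNIV. u $ i *\<^sub>R axis i 1)) (?t z)"
      using basis_expansion[of u] by (simp add: scalar_mult_eq_scaleR)
    also have "\<dots> = (\<Sum>i\<in>UNIV. u $ i * g p (?t (axis i 1)) (?t z))"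
      by (simp add: linear_sum[OF lin] sc)
    finally show ?thesis .
  qed
  have "g p (?t u) (?t u) = (\<Sum>i\<in>UNIV. u $ i * (\<Sum>j\<in>UNIV. u $ j * g p (?t (axis j 1)) (?t (axis i 1))))"
    by (subst ex, subst sy, subst ex) simp
  also have "\<dots> = u \<bullet> (metric_matrix A g c x *v u)"
    unfolding inner_vec_def matrix_vector_mult_def metric_matrix_def p_def[symmetric]
    by (simp add: sy mult.commute)
  finally have "g p (?t u) (?t u) = u \<bullet> (metric_matrix A g c x *v u)" .
  moreover have "?t u \<noteq> (\<lambda>c. 0)"
    using tangent_of_same[OF c p, of u] assms by metis
  ultimately show ?thesis
    using pd[of u] by linarith
qed

lemma metric_matrix_invertible: "invertible (metric_matrix A g c x)"
proof -
  have "u = 0" if "metric_matrix A g c x *v u = 0" for u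
    using metric_matrix_pos[of u] that by force
  then show ?thesis
    using invertible_left_inverse matrix_left_invertible_ker by blast
qed

lemma metric_matrix_inv:
  "metric_matrix A g c x ** matrix_inv (metric_matrix A g c x) = mat 1"
  "matrix_inv (metric_matrix A g c x) ** metric_matrix A g c x = mat 1"
proof -
  obtain B where "metric_matrix A g c x ** B = mat 1 \<and> B ** metric_matrix A g c x = mat 1"
    using metric_matrix_invertible unfolding invertible_def by blast
  from someI[where P = "\<lambda>B. metric_matrix A g c x ** B = mat 1 \<and> B ** metric_matrix A g c x = mat 1", OF this]
  show "metric_matrix A g c x ** matrix_inv (metric_matrix A g c x) = mat 1"
    "matrix_inv (metric_matrix A g c x) ** metric_matrix A g c x = mat 1"
    unfolding matrix_inv_def by blast+
qed

lemma christoffel_lower: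
  "(\<Sum>k\<in>UNIV. metric_matrix A g c x $ l $ k * christoffel A g c x k i j) =
   (1/2) * (metric_partial A g c x i j l + metric_partial A g c x j i l - metric_partial A g c x l i j)"
proof -
  let ?G = "metric_matrix A g c x"
  define w :: "real^'n" where "w = (\<chi> l. (1/2) * (metric_partial A g c x i j l +
    metric_partial A g c x j i l - metric_partial A g c x l i j))"
  have "(\<chi> k. christoffel A g c x k i j) = matrix_inv ?G *v w"
    by (simp add: vec_eq_iff christoffel_def matrix_vector_mult_def w_def sum_distrib_left algebra_simps)
  then have "?G *v (\<chi> k. christoffel A g c x k i j) = w"
    by (simp add: matrix_vector_mul_assoc metric_matrix_inv)
  then have "(?G *v (\<chi> k. christoffel A g c x k i j)) $ l = w $ l" by simp
  then show ?thesis by (simp add: matrix_vector_mult_def w_def)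
qed

lemma levi_civita:
  fixes \<Gamma> :: "'n \<Rightarrow> 'n \<Rightarrow> 'n \<Rightarrow> real"
  shows "(\<forall>k i j. \<Gamma> k i j = \<Gamma> k j i) \<and>
    (\<forall>l i j. metric_partial A g c x l i j =
       (\<Sum>k\<in>UNIV. \<Gamma> k l i * metric_matrix A g c x $ k $ j) +
       (\<Sum>k\<in>UNIV. \<Gamma> k l j * metric_matrix A g c x $ i $ k))
    \<longleftrightarrow> \<Gamma> = christoffel A g c x"
    (is "?sym \<and> ?met \<longleftrightarrow> _")
proof -
  let ?G = "metric_matrix A g c x"
  let ?low = "\<lambda>\<Gamma> l i j. \<Sum>k\<in>UNIV. ?G $ l $ k * \<Gamma> k i j"
  have met: "?met \<longleftrightarrow> (\<forall>l i j. metric_partial A g c x l i j = ?low \<Gamma> j l i + ?low \<Gamma> i l j)"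
  proof -
    have e1: "(\<Sum>k\<in>UNIV. \<Gamma> k l i * ?G $ k $ j) = ?low \<Gamma> j l i" for l i j
      by (rule sum.cong[OF refl], subst metric_matrix_sym[OF x], rule mult.commute)
    have e2: "(\<Sum>k\<in>UNIV. \<Gamma> k l j * ?G $ i $ k) = ?low \<Gamma> i l j" for l i j
      by (rule sum.cong[OF refl], rule mult.commute)
    show ?thesis unfolding e1 e2 by (rule refl)
  qed
  show ?thesis
  proof
    assume L: "?sym \<and> ?met"
    then have m: "metric_partial A g c x l i j = ?low \<Gamma> j l i + ?low \<Gamma> i l j" for l i j
      using met by blast
    have s: "\<Gamma> k i j = \<Gamma> k j i" for k i j using L by blast
    have "?low \<Gamma> l i j = ?low (christoffel A g c x) l i j" for l i j
    proof -
      have "?low \<Gamma> l j i = ?low \<Gamma> l i j" "?low \<Gamma> j l i = ?low \<Gamma> j i l"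
        "?low \<Gamma> i l j = ?low \<Gamma> i j l"
        by (rule sum.cong[OF refl], rule arg_cong[OF s])+
      then show ?thesis unfolding christoffel_lower m by simp
    qed
    then have "?G *v (\<chi> k. \<Gamma> k i j) = ?G *v (\<chi> k. christoffel A g c x k i j)" for i j
      by (simp add: vec_eq_iff matrix_vector_mult_def)
    then have "matrix_inv ?G *v (?G *v (\<chi> k. \<Gamma> k i j)) =
        matrix_inv ?G *v (?G *v (\<chi> k. christoffel A g c x k i j))" for i j
      by simp
    then have "(\<chi> k. \<Gamma> k i j) = (\<chi> k. christoffel A g c x k i j)" for i j
      by (simp add: matrix_vector_mul_assoc metric_matrix_inv)
    then show "\<Gamma> = christoffel A g c x" by (simp add: vec_eq_iff fun_eq_iff)
  next
    assume R: "\<Gamma> = christoffel A g c x"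
    have "christoffel A g c x k i j = christoffel A g c x k j i" for k i j
      unfolding christoffel_def metric_partial_sym[of _ i j]
      by (simp add: add.commute)
    then have "?sym" unfolding R by blast
    moreover have "metric_partial A g c x l i j = ?low \<Gamma> j l i + ?low \<Gamma> i l j" for l i j
    proof -
      have "?low \<Gamma> j l i = (1/2) * (metric_partial A g c x l i j + metric_partial A g c x i l j - metric_partial A g c x j l i)"
        unfolding R by (rule christoffel_lower)
      moreover have "?low \<Gamma> i l j = (1/2) * (metric_partial A g c x l j i + metric_partial A g c x j l i - metric_partial A g c x i l j)"
        unfolding R by (rule christoffel_lower)
      ultimately show ?thesis
        using metric_partial_sym[of l j i] by (simp add: field_simps)
    qed
    then have "?met" using met by blast
    ultimately show "?sym \<and> ?met" by blast
  qed
qed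

end

end

end

theory Submission
  imports Defs
begin

text \<open>In a chart, two nearby points with coordinates \<open>p\<close>, \<open>q\<close> are joined by a geodesic of length
  \<open>O(norm (q - p))\<close>, obtained by solving the boundary value problem for the geodesic equation by a
  contraction, and parallel transport along it differs from the identity in coordinates by
  \<open>O(norm (q - p))\<close>. The Lipschitz condition with respect to parallel transport therefore makes
  the coordinate representation of \<open>X\<close> locally bounded and then locally Lipschitz, and
  Rademacher's theorem applies to it.

  Rademacher's theorem is proved without integration by parts. One-dimensional Lipschitz functions
  are integrals of a Radon-Nikodym density, hence differentiable almost everywhere; by Tonelli,
  partial derivatives exist almost everywhere. At a density point of a set on which the
  partial difference quotients are uniformly close to a fixed vector, every small increment can be
  telescoped along the axes through points close to that set.\<close>

section \<open>Rademacher's theorem\<close>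

text \<open>The Lipschitz hypothesis speaks about \<open>X\<close> only along geodesics and through
  the definite description \<open>parallel_transport\<close>, so it yields an inequality in
  coordinates only once a geodesic between two given points and the uniqueness of parallel fields
  along it are available. Any geodesic will do: it need be neither minimizing nor contained in the
  ball, since only its end points are tested. \<open>geodesic_segment\<close> asks for an extension
  to an open interval, so the boundary value problem with data at 0 and 1 is solved on {-1..2}.
  \<open>parallel_along\<close> asks for the equation in every chart, so a solution found in one
  chart is carried to the others by the transformation law of the Christoffel symbols, which comes
  from the Koszul formula. Finally, transport distorts a coordinate vector by an error proportional
  to its own length, and nothing is known beforehand about the size of \<open>X\<close>; this is why
  comparison with the centre of a ball has to supply a bound before two arbitrary points can be
  compared.\<close>

lemma strict_mono_lipschitz_density:
  fixes h :: "real \<Rightarrow> real"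
  assumes lip: "C-lipschitz_on UNIV h" and exp: "\<And>x y. x \<le> y \<Longrightarrow> y - x \<le> h y - h x"
  obtains g :: "real \<Rightarrow> real" where "\<And>a b. a \<le> b \<Longrightarrow> (g has_integral (h b - h a)) {a..b}"
proof -
  have cont: "continuous_on UNIV h" using lip lipschitz_on_continuous_on by blast
  have mono: "h x < h y \<longleftrightarrow> x < y" for x y
    by (smt (verit) exp)
  have mono': "h x \<le> h y \<longleftrightarrow> x \<le> y" for x y
    by (meson mono not_le)
  have inj: "inj h" by (metis injI linorder_less_linear mono order_less_irrefl)
  have surj: "surj h"
    unfolding surj_def
  proof
    fix y
    let ?b = "\<bar>y - h 0\<bar>"
    have "h (- ?b) \<le> y" "y \<le> h ?b"
      using exp[of "- ?b" 0] exp[of 0 ?b] by auto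
    then have "\<exists>x. h x = y"
      using IVT'[of h "- ?b" y ?b] cont continuous_on_subset by force
    then show "\<exists>x. y = h x" by metis
  qed
  define k where "k = inv h"
  have hk: "h (k y) = y" for y by (simp add: k_def surj surj_f_inv_f)
  have kh: "k (h x) = x" for x by (simp add: k_def inj)
  have "1-lipschitz_on UNIV k"
  proof (rule lipschitz_onI)
    fix x y :: real
    show "dist (k x) (k y) \<le> 1 * dist x y"
      using exp[of "k x" "k y"] exp[of "k y" "k x"] by (auto simp: hk dist_real_def abs_if)
  qed simp
  then have kmeas: "k \<in> borel_measurable borel"
    using lipschitz_on_continuous_on borel_measurable_continuous_onI by blast
  define M where "M = distr lborel borel k"
  have emM: "emeasure M B = emeasure lborel (h ` B)" if "B \<in> sets borel" for B
  proof -
    have "k -` B = h ` B" using hk kh by (auto simp: image_iff) metis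
    then show ?thesis unfolding M_def using kmeas that by (simp add: emeasure_distr)
  qed
  have sM: "sets M = sets lborel" by (simp add: M_def)
  have Ioc: "emeasure M {a<..b} = ennreal (h b - h a)" if "a \<le> b" for a b
  proof -
    have "h ` {a<..b} = {h a<..h b}"
    proof (intro equalityI subsetI)
      fix y assume "y \<in> {h a<..h b}"
      then have "k y \<in> {a<..b}" by (metis greaterThanAtMost_iff hk mono mono')
      then show "y \<in> h ` {a<..b}" by (metis hk imageI)
    qed (auto simp: mono mono')
    then show ?thesis using that by (simp add: emM mono')
  qed
  have "absolutely_continuous lborel M"
    unfolding absolutely_continuous_def
  proof
    fix B :: "real set" assume B: "B \<in> null_sets lborel"
    then have "negligible B" using negligible_iff_null_sets null_sets_completionI by blast
    moreover have "\<forall>x\<in>B. \<exists>T K. open T \<and> x \<in> T \<and> (\<forall>y\<in>B \<inter> T. norm (h y - h x) \<le> K * norm (y - x))"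
      using lipschitz_onD[OF lip] by (metis UNIV_I dist_norm open_UNIV)
    ultimately have "negligible (h ` B)"
      using negligible_locally_Lipschitz_image[of B h] by force
    moreover have Bb: "B \<in> sets borel" using B by auto
    moreover have "h ` B \<in> sets borel"
    proof -
      have "k -` B = h ` B" using hk kh by (auto simp: image_iff) metis
      then show ?thesis using measurable_sets[OF kmeas Bb] by simp
    qed
    ultimately have "h ` B \<in> null_sets lborel"
      by (simp add: negligible_iff_null_sets null_sets_completion_iff)
    then show "B \<in> null_sets M"
      using Bb emM[OF Bb] sM by (simp add: null_sets_def)
  qed
  then obtain G where G: "G \<in> borel_measurable lborel" "density lborel G = M"
    using sigma_finite_measure.Radon_Nikodym[OF sigma_finite_lborel _ sM] by blast
  have nn: "(\<integral>\<^sup>+x\<in>{a<..b}. G x \<partial>lborel) = ennreal (h b - h a)" if "a \<le> b" for a b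
    using Ioc[OF that] emeasure_density[OF G(1), of "{a<..b}"] G(2) by simp
  define g where "g = enn2real \<circ> G"
  have "(g has_integral (h b - h a)) {a..b}" if ab: "a \<le> b" for a b
  proof -
    have "AE x in lborel. G x * indicator {a<..b} x \<noteq> \<infinity>"
      by (rule nn_integral_PInf_AE) (use G nn[OF ab] in auto)
    then have "(\<integral>\<^sup>+x. ennreal (g x * indicator {a<..b} x) \<partial>lborel) = (\<integral>\<^sup>+x\<in>{a<..b}. G x \<partial>lborel)"
      by (intro nn_integral_cong_AE, eventually_elim) (auto simp: g_def indicator_def less_top)
    then have "((\<lambda>x. g x * indicator {a<..b} x) has_integral (h b - h a)) UNIV"
      using nn[OF ab] G(1) mono'[of a b] ab
      by (intro nn_integral_has_integral) (auto simp: g_def)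
    then have "(g has_integral (h b - h a)) {a<..b}"
      by (subst has_integral_restrict_UNIV[symmetric])
        (auto simp: indicator_def if_distrib mult.commute cong: if_cong elim!: back_subst[where P="\<lambda>f. (f has_integral _) _"])
    moreover have "negligible {x \<in> {a<..b} - {a..b}. g x \<noteq> 0}" "negligible {x \<in> {a..b} - {a<..b}. g x \<noteq> 0}"
      by (auto intro: negligible_subset[of "{a}"])
    ultimately show ?thesis
      using has_integral_spike_set_eq by blast
  qed
  then show thesis using that by blast
qed

lemma negligible_linear_isometry_image:
  fixes f :: "'a::euclidean_space \<Rightarrow> 'a"
  assumes "linear f" "\<And>x. norm (f x) = norm x" "negligible N"
  shows "negligible (f ` N)"
proof (rule negligible_differentiable_image_negligible[OF order_refl assms(3)])
  show "f differentiable_on N"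
    using assms(1) linear_imp_differentiable_on by blast
qed

text \<open>After adding a linear term, \<open>f\<close> has a density \<open>g\<close>, and almost
  everywhere the averages of \<open>g\<close> over short intervals tend to its value. The averages
  available are those to the right of a point; the left derivative comes from the same fact for the
  reflected density.\<close>

theorem lipschitz_ae_differentiable_real:
  fixes f :: "real \<Rightarrow> real"
  assumes lip: "L-lipschitz_on UNIV f"
  shows "negligible {x. \<not> f differentiable (at x)}"
proof -
  have L0: "0 \<le> L" using lip lipschitz_on_nonneg by blast
  \<comment> \<open>A slope of \<open>L\<close> compensates the steepest possible descent of
    \<open>f\<close>; the extra 1 makes \<open>h\<close> expand distances.\<close>
  define h where "h x = f x + (L + 1) * x" for x
  have "(L + (L + 1) * 1)-lipschitz_on UNIV h"
    unfolding h_def using lip L0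
    by (intro lipschitz_on_add lipschitz_on_cmult_real_nonneg lipschitz_on_id) auto
  moreover have "y - x \<le> h y - h x" if "x \<le> y" for x y
    using lipschitz_onD[OF lip, of x y] that by (simp add: h_def dist_real_def algebra_simps abs_le_iff)
  ultimately obtain g where g: "\<And>a b. a \<le> b \<Longrightarrow> (g has_integral (h b - h a)) {a..b}"
    using strict_mono_lipschitz_density by blast
  have g': "((\<lambda>x. g (- x)) has_integral (h (- a) - h (- b))) {a..b}" if "a \<le> b" for a b
    using g[of "-b" "-a"] that has_integral_reflect_real[of "\<lambda>x. g (- x)" "h (- a) - h (- b)" b a]
    by simp
  have "g integrable_on cbox a b" for a b
    using g[of a b] by (cases "a \<le> b") auto
  then obtain N where N: "negligible N"
    "\<And>x e. \<lbrakk>x \<notin> N; 0 < e\<rbrakk> \<Longrightarrow> \<exists>d>0. \<forall>t. 0 < t \<and> t < d \<longrightarrow>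
        norm (integral (cbox x (x + t *\<^sub>R One)) g /\<^sub>R t ^ DIM(real) - g x) < e"
    using integrable_ccontinuous_explicit[of g] by blast
  have "(\<lambda>x. g (- x)) integrable_on cbox a b" for a b
    using g'[of a b] by (cases "a \<le> b") auto
  then obtain N' where N': "negligible N'"
    "\<And>x e. \<lbrakk>x \<notin> N'; 0 < e\<rbrakk> \<Longrightarrow> \<exists>d>0. \<forall>t. 0 < t \<and> t < d \<longrightarrow>
        norm (integral (cbox x (x + t *\<^sub>R One)) (\<lambda>x. g (- x)) /\<^sub>R t ^ DIM(real) - g (- x)) < e"
    using integrable_ccontinuous_explicit[of "\<lambda>x. g (- x)"] by blast
  have "f differentiable (at x)" if x: "x \<notin> N" "- x \<notin> N'" for x
  proof -
    have "(h has_field_derivative g x) (at x)"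
      unfolding DERIV_def LIM_def
    proof (intro allI impI)
      fix e :: real assume "0 < e"
      obtain d where d: "d > 0" "\<And>t. 0 < t \<Longrightarrow> t < d \<Longrightarrow> \<bar>integral {x..x + t} g / t - g x\<bar> < e"
        using N(2)[OF x(1) \<open>0 < e\<close>] by (auto simp: divide_inverse mult.commute)
      obtain d' where d': "d' > 0" "\<And>t. 0 < t \<Longrightarrow> t < d' \<Longrightarrow> \<bar>integral {-x..-x + t} (\<lambda>x. g (- x)) / t - g x\<bar> < e"
        using N'(2)[OF x(2) \<open>0 < e\<close>] by (auto simp: divide_inverse mult.commute)
      have "dist ((h (x + t) - h x) / t) (g x) < e" if t: "t \<noteq> 0" "\<bar>t\<bar> < min d d'" for t
      proof (cases "t > 0")
        case True
        then show ?thesis using d(2)[of t] t g[of x "x + t"]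
          by (simp add: dist_real_def integral_unique)
      next
        case False
        have "integral {-x..-x + -t} (\<lambda>x. g (- x)) = h x - h (x + t)"
          using g'[of "-x" "-x + -t"] False by (intro integral_unique) (simp add: add.commute)
        then show ?thesis using d'(2)[of "-t"] t False
          by (simp add: dist_real_def minus_divide_left[symmetric] del: minus_divide_left) (simp add: diff_divide_distrib)
      qed
      then show "\<exists>s>0. \<forall>xa. xa \<noteq> 0 \<and> dist xa 0 < s \<longrightarrow> dist ((h (x + xa) - h x) / xa) (g x) < e"
        using d(1) d'(1) by (intro exI[of _ "min d d'"]) auto
    qed
    then have "((\<lambda>x. h x - (L + 1) * x) has_field_derivative g x - (L + 1)) (at x)"
      by (auto intro!: derivative_eq_intros)
    then have "(f has_field_derivative g x - (L + 1)) (at x)"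
      by (simp add: h_def)
    then show ?thesis
      using has_field_derivative_imp_has_derivative differentiable_def by blast
  qed
  then have "{x. \<not> f differentiable (at x)} \<subseteq> N \<union> uminus ` N'"
    by (force simp: image_iff)
  moreover have "negligible (uminus ` N')"
    by (rule negligible_linear_isometry_image[OF _ _ N'(1)]) (auto intro: linearI)
  ultimately show ?thesis
    using N(1) negligible_subset negligible_Un by blast
qed


section \<open>Negligibility along parallel lines and existence of directional derivatives\<close>

text \<open>Tonelli for the pairs of \<open>x\<close> and \<open>t\<close> with
  \<open>x + t *\<^sub>R v\<close> in \<open>S\<close>: integrating over \<open>t\<close> first
  gives 0 by hypothesis, integrating over \<open>x\<close> first gives the measure of
  \<open>S\<close> for every \<open>t\<close> by translation invariance. This avoids rotating
  \<open>v\<close> into a coordinate axis.\<close>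

lemma negligible_if_lines_negligible:
  fixes S :: "'a::euclidean_space set"
  assumes S: "S \<in> sets borel" and lines: "\<And>x. negligible {t. x + t *\<^sub>R v \<in> S}"
  shows "negligible S"
proof -
  \<comment> \<open>Times are cut down to {0..1}, a set of mass 1, so that the second order of
    integration returns exactly the measure of \<open>S\<close>.\<close>
  let ?f = "\<lambda>x t. indicator ({0..1} \<times> S) (t, x + t *\<^sub>R v) :: ennreal"
  have shift: "(\<lambda>(x, t). (t, x + t *\<^sub>R v)) \<in> borel_measurable (borel :: ('a \<times> real) measure)"
    by (intro borel_measurable_continuous_onI continuous_intros continuous_on_Pair | simp add: case_prod_unfold)+
  have "{0..1} \<times> S \<in> sets (borel :: (real \<times> 'a) measure)"
    using S by (metis borel_prod pair_measureI borel_closed closed_atLeastAtMost)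
  then have meas: "case_prod ?f \<in> borel_measurable (lborel \<Otimes>\<^sub>M lborel)"
    using measurable_compose[OF shift borel_measurable_indicator]
    by (simp add: lborel_prod case_prod_unfold)
  have "(\<integral>\<^sup>+t. ?f x t \<partial>lborel) = 0" for x
  proof -
    let ?B = "{t \<in> {0..1}. x + t *\<^sub>R v \<in> S}"
    have "(\<lambda>t. x + t *\<^sub>R v) \<in> borel_measurable borel"
      by (intro borel_measurable_continuous_onI continuous_intros)
    from measurable_sets[OF this S] have "{0..1} \<inter> (\<lambda>t. x + t *\<^sub>R v) -` S \<in> sets borel"
      by auto
    then have B: "?B \<in> sets borel"
      by (rule back_subst[where P="\<lambda>X. X \<in> sets borel"]) auto
    have "negligible ?B" by (rule negligible_subset[OF lines[of x]]) auto
    then have "emeasure lborel ?B = 0"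
      using B by (auto simp: negligible_iff_null_sets null_sets_completion_iff)
    moreover have "?f x t = indicator ?B t" for t by (auto simp: indicator_def)
    ultimately show ?thesis using B by simp
  qed
  then have "0 = (\<integral>\<^sup>+x. \<integral>\<^sup>+t. ?f x t \<partial>lborel \<partial>lborel)" by simp
  also have "\<dots> = (\<integral>\<^sup>+t. \<integral>\<^sup>+x. ?f x t \<partial>lborel \<partial>lborel)"
    using lborel_pair.Fubini'[OF meas] by simp
  also have "\<dots> = (\<integral>\<^sup>+t. emeasure lborel S * indicator {0..1::real} t \<partial>lborel)"
  proof (rule nn_integral_cong)
    fix t :: real
    have "(\<integral>\<^sup>+x. ?f x t \<partial>lborel) = (\<integral>\<^sup>+x. indicator S (t *\<^sub>R v + x) * indicator {0..1} t \<partial>lborel)"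
      by (intro nn_integral_cong) (auto simp: indicator_def add.commute)
    also have "\<dots> = (\<integral>\<^sup>+x. indicator S (t *\<^sub>R v + x) \<partial>lborel) * indicator {0..1} t"
      by (intro nn_integral_multc measurable_compose[OF _ borel_measurable_indicator[OF S]]) simp
    also have "(\<integral>\<^sup>+x. indicator S (t *\<^sub>R v + x) \<partial>lborel) = (\<integral>\<^sup>+x. indicator S x \<partial>distr lborel borel ((+) (t *\<^sub>R v)))"
      using S by (subst nn_integral_distr) auto
    also have "\<dots> = emeasure lborel S"
      using S by (simp add: lborel_distr_plus)
    finally show "(\<integral>\<^sup>+x. ?f x t \<partial>lborel) = emeasure lborel S * indicator {0..1} t" .
  qed
  also have "\<dots> = emeasure lborel S"
    by (simp add: nn_integral_cmult_indicator)
  finally show ?thesis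
    using S by (auto simp: negligible_iff_null_sets null_sets_completion_iff null_sets_def)
qed

text \<open>A Cauchy criterion does not mention the value of the derivative. The set of points
  satisfying it can therefore be written with countable operations on closed sets, which is how
  measurability is obtained below.\<close>

lemma Cauchy_slopes_imp_differentiable:
  fixes F :: "real \<Rightarrow> real"
  assumes "\<And>e. e > 0 \<Longrightarrow> \<exists>d>0. \<forall>s t. s \<noteq> 0 \<and> t \<noteq> 0 \<and> \<bar>s\<bar> < d \<and> \<bar>t\<bar> < d \<longrightarrow>
    \<bar>(F s - F 0) / s - (F t - F 0) / t\<bar> \<le> e"
  shows "F differentiable (at 0)"
proof -
  let ?q = "\<lambda>t. (F t - F 0) / t"
  have "\<exists>D. filtermap ?q (at 0) \<le> nhds D"
  proof (rule cauchy_filter_complete_converges[OF _ complete_UNIV])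
    show "cauchy_filter (filtermap ?q (at 0))"
      unfolding cauchy_filter_metric_filtermap
    proof (intro allI impI)
      fix e :: real assume "e > 0"
      then obtain d where d: "d > 0" "\<And>s t. s \<noteq> 0 \<Longrightarrow> t \<noteq> 0 \<Longrightarrow> \<bar>s\<bar> < d \<Longrightarrow> \<bar>t\<bar> < d \<Longrightarrow>
          \<bar>?q s - ?q t\<bar> \<le> e / 2"
        using assms[of "e/2"] by auto
      have "\<forall>\<^sub>F t in at 0. t \<noteq> 0 \<and> \<bar>t\<bar> < d"
        using d(1) by (auto simp: eventually_at dist_real_def)
      moreover have "dist (?q s) (?q t) < e" if "s \<noteq> 0 \<and> \<bar>s\<bar> < d" "t \<noteq> 0 \<and> \<bar>t\<bar> < d" for s t
        using d(2)[of s t] that \<open>e > 0\<close> by (simp add: dist_real_def)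
      ultimately show "\<exists>P. eventually P (at 0) \<and> (\<forall>x y. P x \<and> P y \<longrightarrow> dist (?q x) (?q y) < e)"
        by blast
    qed
  qed (auto simp: filtermap_bot_iff)
  then obtain D where "(?q \<longlongrightarrow> D) (at 0)" by (auto simp: filterlim_def)
  then have "(F has_field_derivative D) (at 0)"
    by (simp add: DERIV_def)
  then show ?thesis
    using has_field_derivative_imp_has_derivative differentiable_def by blast
qed


section \<open>Density points of closed sets\<close>

text \<open>\<open>integrable_ccontinuous_explicit\<close> only controls cubes having the point as their lower corner;
  flipping the coordinates in \<open>B\<close> reaches the other orthants.\<close>

definition flip :: "'a::euclidean_space set \<Rightarrow> 'a \<Rightarrow> 'a" where
  "flip B x = (\<Sum>b\<in>Basis. (if b \<in> B then - (x \<bullet> b) else x \<bullet> b) *\<^sub>R b)"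

lemma flip_inner: "b \<in> Basis \<Longrightarrow> flip B x \<bullet> b = (if b \<in> B then - (x \<bullet> b) else x \<bullet> b)"
  unfolding flip_def by (rule inner_sum_left_Basis)

lemma flip_flip [simp]: "flip B (flip B x) = x"
  by (rule euclidean_eqI) (simp add: flip_inner)

lemma linear_flip: "linear (flip B)"
  by (rule linearI; rule euclidean_eqI) (auto simp: flip_inner inner_add_left)

lemma norm_flip [simp]: "norm (flip B x) = norm x"
proof -
  have "(if b \<in> B then - (x \<bullet> b) else x \<bullet> b)\<^sup>2 = (x \<bullet> b)\<^sup>2" for b by simp
  then have "flip B x \<bullet> flip B x = x \<bullet> x"
    by (subst (1 2) euclidean_inner) (simp add: flip_inner power2_eq_square cong: sum.cong)
  then show ?thesis by (simp add: norm_eq_sqrt_inner)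
qed

lemma content_cube: "0 \<le> h \<Longrightarrow> measure lborel (cbox x (x + h *\<^sub>R (One::'a::euclidean_space))) = h ^ DIM('a)"
  by (subst content_cbox) (auto simp: inner_add_left)

text \<open>Let \<open>y\<close> lie in the positive orthant at \<open>x\<close>, at distance
  \<rho>. A cube of side \<eta> * \<rho> at \<open>y\<close> fills a fixed fraction of the cube of
  side (1 + \<eta>) * \<rho> at \<open>x\<close>. If \<open>P\<close> missed it, the density of
  \<open>P\<close> in the larger cube would stay away from 1, which fails for almost every
  \<open>x\<close> in \<open>P\<close> at small scales.\<close>

lemma density_upper_corner:
  fixes P :: "'a::euclidean_space set"
  assumes P: "closed P"
  obtains N where "negligible N"
    "\<And>x e. x \<in> P \<Longrightarrow> x \<notin> N \<Longrightarrow> e > 0 \<Longrightarrow> \<exists>d>0. \<forall>y. norm (y - x) < d \<and> (\<forall>b\<in>Basis. x \<bullet> b \<le> y \<bullet> b) \<longrightarrow>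
       (\<exists>z\<in>P. norm (z - y) \<le> e * norm (y - x))"
proof -
  let ?f = "indicator P :: 'a \<Rightarrow> real"
  have Pi: "P \<inter> cbox a b \<in> lmeasurable" for a b
    by (rule lmeasurable_compact) (simp add: P closed_Int_compact)
  have int: "integral (cbox a b) ?f = measure lebesgue (P \<inter> cbox a b)"
    and int': "?f integrable_on cbox a b" for a b
    using Pi[of a b] integral_indicator[OF Pi] by (simp_all add: integrable_on_indicator)
  from integrable_ccontinuous_explicit[of ?f, OF int'] obtain N where N: "negligible N"
    "\<And>x e. \<lbrakk>x \<notin> N; 0 < e\<rbrakk> \<Longrightarrow> \<exists>d>0. \<forall>h. 0 < h \<and> h < d \<longrightarrow>
        norm (integral (cbox x (x + h *\<^sub>R One)) ?f /\<^sub>R h ^ DIM('a) - ?f x) < e"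
    by blast
  have "\<exists>d>0. \<forall>y. norm (y - x) < d \<and> (\<forall>b\<in>Basis. x \<bullet> b \<le> y \<bullet> b) \<longrightarrow>
       (\<exists>z\<in>P. norm (z - y) \<le> e * norm (y - x))" if x: "x \<in> P" "x \<notin> N" and e: "e > 0" for x e
  proof -
    \<comment> \<open>A point of the small cube differs from \<open>y\<close> by at most \<eta> *
      \<rho> in each coordinate, hence by at most e * \<rho> in the sum norm.\<close>
    define \<eta> where "\<eta> = e / real DIM('a)"
    have \<eta>: "\<eta> > 0" using e by (simp add: \<eta>_def)
    \<comment> \<open>The fraction of the volume of the large cube that the small one
      occupies.\<close>
    define \<kappa> where "\<kappa> = (\<eta> / (1 + \<eta>)) ^ DIM('a)"
    have \<kappa>: "\<kappa> > 0" using \<eta> by (simp add: \<kappa>_def)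
    obtain d where d: "d > 0" "\<And>h. 0 < h \<Longrightarrow> h < d \<Longrightarrow>
        \<bar>measure lebesgue (P \<inter> cbox x (x + h *\<^sub>R One)) / h ^ DIM('a) - 1\<bar> < \<kappa>"
      using N(2)[OF x(2) \<kappa>] x(1) by (auto simp: int divide_inverse mult.commute)
    \<comment> \<open>The factor 1 + \<eta> in the radius keeps the side of the large cube below
      \<open>d\<close>.\<close>
    have "\<exists>z\<in>P. norm (z - y) \<le> e * norm (y - x)"
      if y: "norm (y - x) < d / (1 + \<eta>)" "\<forall>b\<in>Basis. x \<bullet> b \<le> y \<bullet> b" for y
    proof (cases "y = x")
      case False
      define \<rho> where "\<rho> = norm (y - x)"
      have \<rho>: "\<rho> > 0" using False by (simp add: \<rho>_def)
      let ?h = "\<rho> + \<eta> * \<rho>"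
      let ?big = "cbox x (x + ?h *\<^sub>R One)" and ?small = "cbox y (y + (\<eta> * \<rho>) *\<^sub>R One)"
      have h: "0 < ?h" "?h < d"
        using \<rho> \<eta> y(1) by (auto simp: \<rho>_def field_simps add_pos_pos)
      have "P \<inter> ?small \<noteq> {}"
      proof
        assume emp: "P \<inter> ?small = {}"
        have sub: "?small \<subseteq> ?big"
        proof -
          have "y \<bullet> b \<le> x \<bullet> b + \<rho>" if "b \<in> Basis" for b
            using Basis_le_norm[OF that, of "y - x"] by (simp add: \<rho>_def inner_diff_left)
          then show ?thesis using y(2)
            by (intro subset_box_imp) (auto simp: inner_add_left)
        qed
        have "measure lebesgue (P \<inter> ?big) \<le> measure lebesgue (?big - ?small)"
          using emp Pi by (intro measure_mono_fmeasurable) (auto intro: fmeasurable.Diff)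
        also have "\<dots> = ?h ^ DIM('a) - (\<eta> * \<rho>) ^ DIM('a)"
          using sub h \<eta> \<rho> by (subst measurable_measure_Diff) (auto simp: content_cube)
        finally have "measure lebesgue (P \<inter> ?big) / ?h ^ DIM('a) \<le> (?h ^ DIM('a) - (\<eta> * \<rho>) ^ DIM('a)) / ?h ^ DIM('a)"
          using h by (intro divide_right_mono) auto
        also have "\<dots> = 1 - (\<eta> * \<rho> / ?h) ^ DIM('a)"
          using h by (simp add: diff_divide_distrib power_divide)
        also have "\<eta> * \<rho> / ?h = \<eta> / (1 + \<eta>)"
        proof -
          have "?h = \<rho> * (1 + \<eta>)" by (simp add: algebra_simps)
          then show ?thesis using \<rho> by simp
        qed
        finally show False using d(2)[OF h] by (simp add: \<kappa>_def)
      qed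
      then obtain z where z: "z \<in> P" "z \<in> ?small" by blast
      have "norm (z - y) \<le> (\<Sum>b\<in>Basis. \<bar>(z - y) \<bullet> b\<bar>)" by (rule norm_le_l1)
      also have "\<dots> \<le> (\<Sum>b\<in>(Basis::'a set). \<eta> * \<rho>)"
        using z(2) by (intro sum_mono) (auto simp: mem_box inner_diff_left inner_add_left)
      also have "\<dots> = e * \<rho>" by (simp add: \<eta>_def)
      finally show ?thesis using z(1) by (auto simp: \<rho>_def)
    qed (use x in auto)
    then show ?thesis using d(1) \<eta> by (intro exI[of _ "d / (1 + \<eta>)"]) auto
  qed
  then show thesis using N(1) that by blast
qed

text \<open>Flipping the coordinates in which \<open>y\<close> lies below \<open>x\<close> brings
  the pair into the situation of \<open>density_upper_corner\<close>. There are finitely many flips,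
  so the exceptional sets can be united and the minimum of the radii is positive.\<close>

lemma closed_set_ae_no_holes:
  fixes P :: "'a::euclidean_space set"
  assumes P: "closed P"
  obtains N where "negligible N"
    "\<And>x e. x \<in> P \<Longrightarrow> x \<notin> N \<Longrightarrow> e > 0 \<Longrightarrow> \<exists>d>0. \<forall>y. norm (y - x) < d \<longrightarrow>
       (\<exists>z\<in>P. norm (z - y) \<le> e * norm (y - x))"
proof -
  have "closed (flip B ` P)" for B :: "'a set"
  proof -
    have "flip B ` P = flip B -` P" by (auto simp: image_iff) (metis flip_flip)
    then show ?thesis
      using closed_vimage[OF P linear_continuous_on[OF linear_linear[THEN iffD2, OF linear_flip]]] by simp
  qed
  then have "\<forall>B. \<exists>N. negligible N \<and> (\<forall>x e. x \<in> flip B ` P \<longrightarrow> x \<notin> N \<longrightarrow> e > 0 \<longrightarrow>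
      (\<exists>d>0. \<forall>y. norm (y - x) < d \<and> (\<forall>b\<in>Basis. x \<bullet> b \<le> y \<bullet> b) \<longrightarrow>
       (\<exists>z\<in>flip B ` P. norm (z - y) \<le> e * norm (y - x))))"
    using density_upper_corner by metis
  then obtain N where N: "\<And>B. negligible (N B)"
    "\<And>B x e. x \<in> flip B ` P \<Longrightarrow> x \<notin> N B \<Longrightarrow> e > 0 \<Longrightarrow>
      (\<exists>d>0. \<forall>y. norm (y - x) < d \<and> (\<forall>b\<in>Basis. x \<bullet> b \<le> y \<bullet> b) \<longrightarrow>
       (\<exists>z\<in>flip B ` P. norm (z - y) \<le> e * norm (y - x)))"
    by metis
  let ?N = "\<Union>B\<in>Pow Basis. flip B ` N B"
  have "negligible ?N"
    by (intro negligible_Union)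
      (auto intro!: negligible_linear_isometry_image linear_flip N(1) finite_imageI)
  moreover have "\<exists>d>0. \<forall>y. norm (y - x) < d \<longrightarrow> (\<exists>z\<in>P. norm (z - y) \<le> e * norm (y - x))"
    if x: "x \<in> P" "x \<notin> ?N" and e: "e > 0" for x e
  proof -
    have "\<exists>d>0. \<forall>y. norm (y - flip B x) < d \<and> (\<forall>b\<in>Basis. flip B x \<bullet> b \<le> y \<bullet> b) \<longrightarrow>
       (\<exists>z\<in>flip B ` P. norm (z - y) \<le> e * norm (y - flip B x))" if "B \<in> Pow Basis" for B
    proof (rule N(2)[OF _ _ e])
      show "flip B x \<notin> N B" using x(2) that by (metis UN_iff flip_flip imageI)
    qed (use x in auto)
    then obtain d where d: "\<And>B. B \<in> Pow Basis \<Longrightarrow> d B > 0"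
      "\<And>B y. B \<in> Pow Basis \<Longrightarrow> norm (y - flip B x) < d B \<Longrightarrow> (\<forall>b\<in>Basis. flip B x \<bullet> b \<le> y \<bullet> b) \<Longrightarrow>
       (\<exists>z\<in>flip B ` P. norm (z - y) \<le> e * norm (y - flip B x))"
      by metis
    define d0 where "d0 = Min (d ` Pow Basis)"
    have d0: "d0 > 0" unfolding d0_def using d(1) by (subst Min_gr_iff) auto
    have "\<exists>z\<in>P. norm (z - y) \<le> e * norm (y - x)" if y: "norm (y - x) < d0" for y
    proof -
      define B where "B = {b\<in>Basis. y \<bullet> b < x \<bullet> b}"
      have B: "B \<in> Pow Basis" by (auto simp: B_def)
      have diff: "norm (flip B u - flip B v) = norm (u - v)" for u v
        by (metis linear_diff linear_flip norm_flip)
      have "d0 \<le> d B" using B by (simp add: d0_def)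
      then have "norm (flip B y - flip B x) < d B" using y by (simp add: diff)
      moreover have "\<forall>b\<in>Basis. flip B x \<bullet> b \<le> flip B y \<bullet> b"
        by (auto simp: flip_inner B_def)
      ultimately obtain z where "z \<in> P" "norm (flip B z - flip B y) \<le> e * norm (flip B y - flip B x)"
        using d(2)[OF B] by blast
      then show ?thesis by (auto simp: diff)
    qed
    then show ?thesis using d0 by blast
  qed
  ultimately show thesis using that by blast
qed


lemma closed_Collect_imp_const: "(Q \<Longrightarrow> closed {x. R x}) \<Longrightarrow> closed {x. Q \<longrightarrow> R x}"
  by (cases Q) auto

text \<open>For fixed \<open>s\<close> and \<open>t\<close> the Cauchy condition on slopes is closed
  in \<open>x\<close>, so \<open>C m k\<close> is closed and the set \<open>D\<close> of good points
  is Borel. On each line parallel to \<open>v\<close> the function is Lipschitz in one variable, so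
  \<open>negligible_if_lines_negligible\<close> applies to the complement of
  \<open>D\<close>.\<close>

lemma lipschitz_ae_partial_derivative:
  fixes f :: "'a::euclidean_space \<Rightarrow> real"
  assumes lip: "L-lipschitz_on UNIV f"
  shows "negligible {x. \<not> (\<lambda>t. f (x + t *\<^sub>R v)) differentiable (at 0)}"
proof -
  have cont: "continuous_on UNIV f" using lip lipschitz_on_continuous_on by blast
  let ?q = "\<lambda>x t. (f (x + t *\<^sub>R v) - f x) / t"
  define C where "C m k = {x. \<forall>s t. s \<noteq> 0 \<and> t \<noteq> 0 \<and> \<bar>s\<bar> < inverse (Suc k) \<and> \<bar>t\<bar> < inverse (Suc k) \<longrightarrow>
      \<bar>?q x s - ?q x t\<bar> \<le> inverse (Suc m)}" for m k :: nat
  have "closed (C m k)" for m k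
    unfolding C_def
    by (intro closed_Collect_all closed_Collect_imp_const closed_Collect_le continuous_on_compose2[OF cont]
        continuous_intros) auto
  then have Cb: "C m k \<in> sets borel" for m k by (rule borel_closed)
  define D where "D = (\<Inter>m. \<Union>k. C m k)"
  have Db: "- D \<in> sets borel" unfolding D_def using Cb by (intro borel_comp sets.countable_INT sets.countable_UN) auto
  have D_iff: "x \<in> D \<longleftrightarrow> (\<lambda>t. f (x + t *\<^sub>R v)) differentiable (at 0)" for x
  proof
    assume "x \<in> D"
    show "(\<lambda>t. f (x + t *\<^sub>R v)) differentiable (at 0)"
    proof (rule Cauchy_slopes_imp_differentiable)
      fix e :: real assume "e > 0"
      then obtain m :: nat where m: "inverse (Suc m) < e" using reals_Archimedean by blast
      obtain k where "x \<in> C m k" using \<open>x \<in> D\<close> by (auto simp: D_def)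
      then show "\<exists>d>0. \<forall>s t. s \<noteq> 0 \<and> t \<noteq> 0 \<and> \<bar>s\<bar> < d \<and> \<bar>t\<bar> < d \<longrightarrow>
          \<bar>(f (x + s *\<^sub>R v) - f (x + 0 *\<^sub>R v)) / s - (f (x + t *\<^sub>R v) - f (x + 0 *\<^sub>R v)) / t\<bar> \<le> e"
        using m by (intro exI[of _ "inverse (Suc k)"]) (fastforce simp: C_def)
    qed
  next
    assume "(\<lambda>t. f (x + t *\<^sub>R v)) differentiable (at 0)"
    then obtain d where "((\<lambda>t. f (x + t *\<^sub>R v)) has_field_derivative d) (at 0)"
      using real_differentiable_def by blast
    then have lim: "?q x \<midarrow>0\<rightarrow> d" by (simp add: DERIV_def)
    have "\<exists>k. x \<in> C m k" for m
    proof -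
      have "inverse (Suc m) / 2 > (0::real)" by simp
      from LIM_D[OF lim this] obtain e where e: "e > 0"
        "\<And>t. t \<noteq> 0 \<Longrightarrow> \<bar>t\<bar> < e \<Longrightarrow> \<bar>?q x t - d\<bar> < inverse (Suc m) / 2"
        by auto
      obtain k :: nat where k: "inverse (Suc k) < e" using reals_Archimedean[OF e(1)] by blast
      have "\<bar>?q x s - ?q x t\<bar> \<le> inverse (Suc m)"
        if "s \<noteq> 0" "t \<noteq> 0" "\<bar>s\<bar> < inverse (Suc k)" "\<bar>t\<bar> < inverse (Suc k)" for s t
        using e(2)[of s] e(2)[of t] that k by linarith
      then have "x \<in> C m k" unfolding C_def by blast
      then show ?thesis ..
    qed
    then show "x \<in> D" by (auto simp: D_def)
  qed
  have "negligible (- D)"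
  proof (rule negligible_if_lines_negligible[OF Db, where v = v])
    fix x
    let ?F = "\<lambda>t. f (x + t *\<^sub>R v)"
    have "(L * norm v)-lipschitz_on UNIV ?F"
    proof (rule lipschitz_onI)
      fix s t
      have "dist (?F s) (?F t) \<le> L * dist (x + s *\<^sub>R v) (x + t *\<^sub>R v)"
        using lipschitz_onD[OF lip] by blast
      also have "dist (x + s *\<^sub>R v) (x + t *\<^sub>R v) = norm v * dist s t"
        by (simp add: dist_norm scaleR_diff_left[symmetric] mult.commute)
      finally show "dist (?F s) (?F t) \<le> L * norm v * dist s t" by (simp add: mult.assoc)
    qed (use lipschitz_on_nonneg[OF lip] in simp)
    then have "negligible {t. \<not> ?F differentiable (at t)}"
      by (rule lipschitz_ae_differentiable_real)
    moreover have "?F differentiable (at t) \<Longrightarrow> x + t *\<^sub>R v \<in> D" for t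
    proof -
      assume "?F differentiable (at t)"
      then have "?F \<circ> (\<lambda>s. t + s) differentiable (at 0)"
        by (intro differentiable_chain_at) auto
      then show ?thesis by (simp add: D_iff o_def algebra_simps)
    qed
    ultimately show "negligible {t. x + t *\<^sub>R v \<in> - D}"
      by (auto intro: negligible_subset)
  qed
  then show ?thesis
    by (rule negligible_subset) (auto simp: D_iff)
qed

text \<open>The increments along the coordinate axes start at points that need not lie in \<open>P a m k\<close>, but
  are so close to points of \<open>P a m k\<close>, where the partial difference quotients are uniformly
  controlled, that the Lipschitz condition absorbs the error.\<close>

theorem Rademacher:
  fixes f :: "'a::euclidean_space \<Rightarrow> real"
  assumes lip: "L-lipschitz_on UNIV f"
  shows "negligible {x. \<not> f differentiable (at x)}"
proof -
  have L0: "0 \<le> L" using lip lipschitz_on_nonneg by blast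
  have cont: "continuous_on UNIV f" using lip lipschitz_on_continuous_on by blast
  have lipD: "\<bar>f x - f y\<bar> \<le> L * norm (x - y)" for x y
    using lipschitz_onD[OF lip, of x y] by (simp add: dist_norm)
  \<comment> \<open>The gradient at a point is approximated by members of a countable dense set, so
    that only countably many exceptional sets \<open>N a m k\<close> have to be discarded.\<close>
  obtain Q :: "'a set" where Q: "countable Q" "\<And>X. open X \<Longrightarrow> X \<noteq> {} \<Longrightarrow> \<exists>d\<in>Q. d \<in> X"
    using countable_dense_exists by metis
  define P where "P a m k = {x. \<forall>i\<in>Basis. \<forall>t. \<bar>t\<bar> \<le> inverse (Suc k) \<longrightarrow>
      \<bar>f (x + t *\<^sub>R i) - f x - t * (a \<bullet> i)\<bar> \<le> \<bar>t\<bar> * inverse (Suc m)}" for a :: 'a and m k :: nat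
  have "closed (P a m k)" for a m k
    unfolding P_def Ball_def
    by (intro closed_Collect_all closed_Collect_imp_const closed_Collect_le continuous_on_compose2[OF cont]
        continuous_intros) auto
  then have "\<exists>N. negligible N \<and> (\<forall>x e. x \<in> P a m k \<longrightarrow> x \<notin> N \<longrightarrow> e > 0 \<longrightarrow> (\<exists>d>0. \<forall>y. norm (y - x) < d \<longrightarrow>
       (\<exists>z\<in>P a m k. norm (z - y) \<le> e * norm (y - x))))" for a m k
    using closed_set_ae_no_holes by metis
  then obtain N where N: "\<And>a m k. negligible (N a m k)"
    "\<And>a m k x e. x \<in> P a m k \<Longrightarrow> x \<notin> N a m k \<Longrightarrow> e > 0 \<Longrightarrow> \<exists>d>0. \<forall>y. norm (y - x) < d \<longrightarrow>
       (\<exists>z\<in>P a m k. norm (z - y) \<le> e * norm (y - x))"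
    by metis
  define E where "E = (\<Union>i\<in>Basis. {x. \<not> (\<lambda>t. f (x + t *\<^sub>R i)) differentiable (at 0)}) \<union> (\<Union>a\<in>Q. \<Union>m k. N a m k)"
  have "negligible (\<Union>i\<in>Basis. {x. \<not> (\<lambda>t. f (x + t *\<^sub>R i)) differentiable (at 0)})"
    by (intro negligible_Union) (auto intro: lipschitz_ae_partial_derivative[OF lip])
  moreover have "negligible (\<Union>a\<in>Q. \<Union>m k. N a m k)"
    by (intro negligible_countable_Union countable_image Q(1)) (auto intro!: negligible_countable_Union simp: N(1))
  ultimately have negE: "negligible E" unfolding E_def by (rule negligible_Un)
  have "f differentiable (at x)" if x: "x \<notin> E" for x
  proof -
    have "\<exists>D. ((\<lambda>t. f (x + t *\<^sub>R i)) has_field_derivative D) (at 0)" if "i \<in> Basis" for i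
      using x that by (auto simp: E_def real_differentiable_def)
    then obtain D where D: "\<And>i. i \<in> Basis \<Longrightarrow> ((\<lambda>t. f (x + t *\<^sub>R i)) has_field_derivative D i) (at 0)"
      by metis
    define A where "A = (\<Sum>i\<in>Basis. D i *\<^sub>R i)"
    have A: "A \<bullet> i = D i" if "i \<in> Basis" for i using that by (simp add: A_def)
    let ?n = "real DIM('a)"
    have n: "?n \<ge> 1" using DIM_positive[where 'a='a] by linarith
    \<comment> \<open>Each axis contributes an error of twice the tolerance, and replacing
      \<open>a\<close> by the gradient \<open>A\<close> costs the tolerance once more; this gives
      the factor 3 times the dimension.\<close>
    have approx: "\<exists>d>0. \<forall>h. norm h < d \<longrightarrow> \<bar>f (x + h) - f x - A \<bullet> h\<bar> \<le> (3 * ?n) * inverse (Suc m) * norm h" for m :: nat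
    proof -
      let ?\<epsilon> = "inverse (real (Suc m))"
      have "\<exists>a\<in>Q. a \<in> ball A (?\<epsilon> / 2)" by (intro Q(2)) auto
      then obtain a where a: "a \<in> Q" "norm (A - a) < ?\<epsilon> / 2" by (auto simp: dist_norm)
      have "\<exists>d>0. \<forall>t. \<bar>t\<bar> < d \<longrightarrow> \<bar>f (x + t *\<^sub>R i) - f x - t * (a \<bullet> i)\<bar> \<le> \<bar>t\<bar> * ?\<epsilon>" if i: "i \<in> Basis" for i
      proof -
        have "(\<lambda>t. (f (x + t *\<^sub>R i) - f x) / t) \<midarrow>0\<rightarrow> D i" using D[OF i] by (simp add: DERIV_def)
        from LIM_D[OF this, of "?\<epsilon> / 2"] obtain d where d: "d > 0"
          "\<And>t. t \<noteq> 0 \<Longrightarrow> \<bar>t\<bar> < d \<Longrightarrow> \<bar>(f (x + t *\<^sub>R i) - f x) / t - D i\<bar> < ?\<epsilon> / 2" by auto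
        have "\<bar>f (x + t *\<^sub>R i) - f x - t * (a \<bullet> i)\<bar> \<le> \<bar>t\<bar> * ?\<epsilon>" if t: "\<bar>t\<bar> < d" for t
        proof (cases "t = 0")
          case False
          have "\<bar>D i - a \<bullet> i\<bar> \<le> ?\<epsilon> / 2"
            using Basis_le_norm[OF i, of "A - a"] a(2) A[OF i] by (simp add: inner_diff_left)
          then have "\<bar>(f (x + t *\<^sub>R i) - f x) / t - a \<bullet> i\<bar> \<le> ?\<epsilon>"
            using d(2)[OF False t] by linarith
          then have "\<bar>t\<bar> * \<bar>(f (x + t *\<^sub>R i) - f x) / t - a \<bullet> i\<bar> \<le> \<bar>t\<bar> * ?\<epsilon>"
            by (rule mult_left_mono) simp
          moreover have "f (x + t *\<^sub>R i) - f x - t * (a \<bullet> i) = t * ((f (x + t *\<^sub>R i) - f x) / t - a \<bullet> i)"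
            using False by (simp add: field_simps)
          ultimately show ?thesis by (simp only: abs_mult)
        qed simp
        then show ?thesis using d(1) by blast
      qed
      then obtain d where d: "\<And>i. i \<in> Basis \<Longrightarrow> d i > 0"
        "\<And>i t. i \<in> Basis \<Longrightarrow> \<bar>t\<bar> < d i \<Longrightarrow> \<bar>f (x + t *\<^sub>R i) - f x - t * (a \<bullet> i)\<bar> \<le> \<bar>t\<bar> * ?\<epsilon>"
        by metis
      have "Min (d ` Basis) > 0" using d(1) by (subst Min_gr_iff) auto
      then obtain k :: nat where k: "inverse (Suc k) < Min (d ` Basis)" using reals_Archimedean by blast
      have "inverse (Suc k) < d i" if "i \<in> Basis" for i
        using k that by (subst (asm) Min_gr_iff) auto
      then have xP: "x \<in> P a m k"
        unfolding P_def using d(2) by (auto intro: le_less_trans)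
      have xN: "x \<notin> N a m k" using x a(1) by (auto simp: E_def)
      \<comment> \<open>Chosen so that the Lipschitz error of moving to a nearby point of
        \<open>P a m k\<close> and back, at most 2 * L * e * n * norm h with n the dimension, is
        below the tolerance times norm h. Using L + 1 keeps the denominator positive when L =
        0.\<close>
      define e where "e = ?\<epsilon> / (2 * (L + 1) * ?n)"
      have e: "e > 0" using L0 n by (simp add: e_def)
      obtain r where r: "r > 0" "\<And>y. norm (y - x) < r \<Longrightarrow> \<exists>z\<in>P a m k. norm (z - y) \<le> e * norm (y - x)"
        using N(2)[OF xP xN e] by blast
      \<comment> \<open>The first bound keeps every coordinate step of \<open>h\<close> within the
        scale controlled by \<open>P a m k\<close>; the second keeps all partial sums, of norm at
        most the dimension times norm h, within \<open>r\<close>.\<close>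
      let ?r = "min (inverse (Suc k)) (r / ?n)"
      have "?r > 0" using r(1) n by simp
      moreover have "\<bar>f (x + h) - f x - A \<bullet> h\<bar> \<le> (3 * ?n) * ?\<epsilon> * norm h" if h: "norm h < ?r" for h
      proof -
        let ?p = "\<lambda>B. \<Sum>b\<in>B. (h \<bullet> b) *\<^sub>R b"
        \<comment> \<open>Per axis, one tolerance comes from the difference quotient at the nearby
          point \<open>z\<close>, the other from replacing both end points of the step by their
          translates at \<open>z\<close>.\<close>
        have tele: "\<bar>f (x + ?p B) - f x - a \<bullet> ?p B\<bar> \<le> real (card B) * (2 * ?\<epsilon> * norm h)"
          if "finite B" "B \<subseteq> Basis" for B
          using that
        proof (induction B rule: finite_induct)
          case (insert b B)
          then have b: "b \<in> Basis" and B: "B \<subseteq> Basis" by auto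
          let ?y = "x + ?p B"
          have "norm (?p B) \<le> real (card B) * norm h"
            using B by (intro sum_norm_bound) (auto simp: Basis_le_norm subset_iff)
          then have "norm (?y - x) \<le> real (card B) * norm h" by simp
          also have "\<dots> \<le> ?n * norm h"
            using card_mono[OF finite_Basis B] by (simp add: mult_right_mono)
          finally have y: "norm (?y - x) \<le> ?n * norm h" .
          also have "\<dots> < r" using h n by (simp add: field_simps)
          finally obtain z where z: "z \<in> P a m k" "norm (z - ?y) \<le> e * norm (?y - x)"
            using r(2) by blast
          have "2 * L * norm (z - ?y) \<le> 2 * L * (e * (?n * norm h))"
            using z(2) y e L0 by (intro mult_left_mono) (auto intro: order_trans mult_left_mono)
          also have "\<dots> = 2 * L * (?\<epsilon> / (2 * (L + 1)) * norm h)"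
            using n by (simp add: e_def)
          also have "\<dots> = L / (L + 1) * (?\<epsilon> * norm h)"
          proof -
            have "2 * L + 2 \<noteq> 0" "L + 1 \<noteq> 0" using L0 by auto
            then have "2 * L * (E / (2 * (L + 1)) * w) = L / (L + 1) * (E * w)" for E w
              by (simp add: field_simps)
            then show ?thesis .
          qed
          also have "\<dots> \<le> 1 * (?\<epsilon> * norm h)"
            using L0 by (intro mult_right_mono) auto
          finally have zy: "2 * L * norm (z - ?y) \<le> ?\<epsilon> * norm h" by simp
          have hb: "\<bar>h \<bullet> b\<bar> \<le> norm h" using Basis_le_norm[OF b] .
          have "\<bar>f (z + (h \<bullet> b) *\<^sub>R b) - f z - (h \<bullet> b) * (a \<bullet> b)\<bar> \<le> \<bar>h \<bullet> b\<bar> * ?\<epsilon>"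
            using z(1) b hb h unfolding P_def by auto
          also have "\<dots> \<le> ?\<epsilon> * norm h" using hb by (simp add: mult.commute)
          finally have s1: "\<bar>f (z + (h \<bullet> b) *\<^sub>R b) - f z - (h \<bullet> b) * (a \<bullet> b)\<bar> \<le> ?\<epsilon> * norm h" .
          have s2: "\<bar>f (?y + (h \<bullet> b) *\<^sub>R b) - f (z + (h \<bullet> b) *\<^sub>R b)\<bar> \<le> L * norm (z - ?y)"
            using lipD[of "?y + (h \<bullet> b) *\<^sub>R b" "z + (h \<bullet> b) *\<^sub>R b"] by (simp add: norm_minus_commute)
          have s3: "\<bar>f z - f ?y\<bar> \<le> L * norm (z - ?y)" by (rule lipD)
          have eq: "x + ?p (insert b B) = ?y + (h \<bullet> b) *\<^sub>R b"
            "a \<bullet> ?p (insert b B) = a \<bullet> ?p B + (h \<bullet> b) * (a \<bullet> b)"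
            using insert.hyps by (simp_all add: inner_add_right algebra_simps)
          have "real (card (insert b B)) * (2 * ?\<epsilon> * norm h) = real (card B) * (2 * ?\<epsilon> * norm h) + 2 * ?\<epsilon> * norm h"
            using insert.hyps by (simp add: algebra_simps)
          then show ?case
            using insert.IH[OF B] s1 s2 s3 zy unfolding eq by linarith
        qed simp
        have ph: "?p Basis = h" by (rule euclidean_representation)
        have "\<bar>f (x + h) - f x - a \<bullet> h\<bar> \<le> ?n * (2 * ?\<epsilon> * norm h)"
          using tele[of Basis] unfolding ph by simp
        moreover have "\<bar>(a - A) \<bullet> h\<bar> \<le> ?\<epsilon> * norm h"
        proof -
          have "norm (a - A) \<le> ?\<epsilon>"
            using a(2) norm_ge_zero[of "A - a"] unfolding norm_minus_commute[of a A] by linarith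
          then have "norm (a - A) * norm h \<le> ?\<epsilon> * norm h" by (rule mult_right_mono) simp
          then show ?thesis using Cauchy_Schwarz_ineq2[of "a - A" h] by linarith
        qed
        moreover have "?\<epsilon> * norm h \<le> ?n * (?\<epsilon> * norm h)"
          using n mult_right_mono[of 1 ?n "?\<epsilon> * norm h"] by simp
        moreover have "?n * (2 * ?\<epsilon> * norm h) = 2 * (?n * (?\<epsilon> * norm h))"
          "3 * ?n * ?\<epsilon> * norm h = 3 * (?n * (?\<epsilon> * norm h))"
          by simp_all
        ultimately show ?thesis
          unfolding inner_diff_left by linarith
      qed
      ultimately show ?thesis by blast
    qed
    have "(f has_derivative (\<lambda>h. A \<bullet> h)) (at x)"
      unfolding has_derivative_at_alt
    proof (intro conjI allI impI bounded_linear_inner_right)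
      fix e :: real assume "e > 0"
      then have "e / (3 * ?n) > 0" using n by simp
      then obtain m :: nat where m: "inverse (Suc m) < e / (3 * ?n)" using reals_Archimedean by blast
      then have m': "(3 * ?n) * inverse (Suc m) \<le> e" using n by (simp add: field_simps)
      obtain d where d: "d > 0" "\<And>h. norm h < d \<Longrightarrow>
          \<bar>f (x + h) - f x - A \<bullet> h\<bar> \<le> (3 * ?n) * inverse (Suc m) * norm h"
        using approx by blast
      show "\<exists>d>0. \<forall>y. norm (y - x) < d \<longrightarrow> norm (f y - f x - A \<bullet> (y - x)) \<le> e * norm (y - x)"
      proof (intro exI[of _ d] conjI allI impI d(1))
        fix y assume "norm (y - x) < d"
        from d(2)[OF this] have "norm (f y - f x - A \<bullet> (y - x)) \<le> (3 * ?n) * inverse (Suc m) * norm (y - x)"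
          by simp
        also have "\<dots> \<le> e * norm (y - x)" by (rule mult_right_mono[OF m']) simp
        finally show "norm (f y - f x - A \<bullet> (y - x)) \<le> e * norm (y - x)" .
      qed
    qed
    then show ?thesis unfolding differentiable_def by blast
  qed
  then have "{x. \<not> f differentiable (at x)} \<subseteq> E" by blast
  then show ?thesis by (rule negligible_subset[OF negE])
qed

text \<open>Negligibility is local, and the projection to a closed ball is 1-Lipschitz by convexity.
  Composing \<open>f\<close> with it gives a globally Lipschitz map that agrees with
  \<open>f\<close> inside the ball, to whose components \<open>Rademacher\<close> applies.\<close>

corollary Rademacher_locally_lipschitz:
  fixes f :: "'a::euclidean_space \<Rightarrow> 'b::euclidean_space"
  assumes S: "open S"
    and loc: "\<And>x. x \<in> S \<Longrightarrow> \<exists>r>0. \<exists>L. ball x r \<subseteq> S \<and> L-lipschitz_on (ball x r) f"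
  shows "negligible {x \<in> S. \<not> f differentiable (at x)}"
proof (subst locally_negligible_alt, rule ballI)
  let ?N = "{x \<in> S. \<not> f differentiable (at x)}"
  fix x assume "x \<in> ?N"
  then obtain r L where r: "r > 0" "ball x r \<subseteq> S" "L-lipschitz_on (ball x r) f"
    using loc[of x] by auto
  let ?K = "cball x (r/2)"
  have K: "closed ?K" "convex ?K" "?K \<noteq> {}" "?K \<subseteq> ball x r" using r(1) by auto
  define F where "F = f \<circ> closest_point ?K"
  have "L-lipschitz_on UNIV (\<lambda>y. F y \<bullet> b)" if b: "b \<in> Basis" for b
  proof (rule lipschitz_onI)
    fix y z
    have "\<bar>F y \<bullet> b - F z \<bullet> b\<bar> \<le> norm (F y - F z)"
      using Basis_le_norm[OF b, of "F y - F z"] by (simp add: inner_diff_left)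
    also have "\<dots> \<le> L * dist (closest_point ?K y) (closest_point ?K z)"
    proof -
      have "closest_point ?K u \<in> ball x r" for u
        using closest_point_in_set[OF K(1,3)] K(4) by blast
      then show ?thesis
        using lipschitz_onD[OF r(3)] unfolding F_def o_def by (simp add: dist_norm)
    qed
    also have "\<dots> \<le> L * dist y z"
      using closest_point_lipschitz[OF K(2,1,3)] lipschitz_on_nonneg[OF r(3)] by (intro mult_left_mono)
    finally show "dist (F y \<bullet> b) (F z \<bullet> b) \<le> L * dist y z" by (simp add: dist_real_def)
  qed (use r(3) lipschitz_on_nonneg in blast)
  then have neg: "negligible (\<Union>b\<in>Basis. {y. \<not> (\<lambda>y. F y \<bullet> b) differentiable (at y)})"
    by (intro negligible_Union) (auto intro: Rademacher)
  have "negligible (?N \<inter> ball x (r/2))"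
  proof (rule negligible_subset[OF neg], rule subsetI, rule ccontr)
    fix y assume y: "y \<in> ?N \<inter> ball x (r/2)"
      and "y \<notin> (\<Union>b\<in>Basis. {y. \<not> (\<lambda>y. F y \<bullet> b) differentiable (at y)})"
    then have "F differentiable (at y)"
      by (subst differentiable_componentwise_within) auto
    then obtain F' where "(F has_derivative F') (at y)" unfolding differentiable_def by blast
    then have "(f has_derivative F') (at y)"
    proof (rule has_derivative_transform_within_open)
      show "open (ball x (r/2))" "y \<in> ball x (r/2)" using y by auto
      show "F z = f z" if "z \<in> ball x (r/2)" for z
        using that closest_point_self[of z ?K] by (auto simp: F_def)
    qed
    then show False using y unfolding differentiable_def by blast
  qed
  then show "\<exists>U. openin (top_of_set ?N) U \<and> x \<in> U \<and> negligible U"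
    using \<open>x \<in> ?N\<close> r(1) by (intro exI[of _ "?N \<inter> ball x (r/2)"]) (auto simp: openin_open)
qed

section \<open>Calculus of \<open>Ck_on\<close>\<close>

text \<open>Openness of \<open>S\<close> lets agreement on \<open>S\<close> determine the
  derivatives at its points, and so the induction proceeds.\<close>

lemma Ck_on_cong:
  assumes "open S" "\<And>x. x \<in> S \<Longrightarrow> f x = g x" "Ck_on k S f"
  shows "Ck_on k S g"
  using assms(2,3)
proof (induction k arbitrary: f g)
  case 0
  then show ?case by (metis Ck_on.simps(1) continuous_on_cong)
next
  case (Suc k)
  have d: "(g has_derivative frechet_derivative f (at x)) (at x)" if "x \<in> S" for x
  proof (rule has_derivative_transform_within_open[OF _ \<open>open S\<close> that])
    show "(f has_derivative frechet_derivative f (at x)) (at x)"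
      using Suc.prems(2) that frechet_derivative_works[of f "at x"] by simp
  qed (rule Suc.prems(1))
  then have e: "frechet_derivative g (at x) = frechet_derivative f (at x)" if "x \<in> S" for x
    using that frechet_derivative_at by metis
  have "Ck_on k S (\<lambda>x. frechet_derivative g (at x) v)" for v
    by (rule Suc.IH[of "\<lambda>x. frechet_derivative f (at x) v"]) (use Suc.prems e in auto)
  then show ?case using d unfolding Ck_on.simps differentiable_def by blast
qed

text \<open>Lets an explicitly known derivative replace \<open>frechet_derivative\<close>; most
  closure rules below are inductions on \<open>k\<close> built on this rule.\<close>

lemma Ck_on_SucI:
  assumes "open S" "\<And>x. x \<in> S \<Longrightarrow> (f has_derivative f' x) (at x)" "\<And>v. Ck_on k S (\<lambda>x. f' x v)"
  shows "Ck_on (Suc k) S f"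
proof -
  have "frechet_derivative f (at x) = f' x" if "x \<in> S" for x
    using assms(2)[OF that] frechet_derivative_at by metis
  then have "Ck_on k S (\<lambda>x. frechet_derivative f (at x) v)" for v
    by (intro Ck_on_cong[OF assms(1) _ assms(3)[of v]]) auto
  then show ?thesis using assms(2) unfolding Ck_on.simps differentiable_def by blast
qed

lemma Ck_on_has_derivative:
  "Ck_on (Suc k) S f \<Longrightarrow> x \<in> S \<Longrightarrow> (f has_derivative frechet_derivative f (at x)) (at x)"
  by (simp add: frechet_derivative_works[symmetric])

lemma Ck_on_derivative: "Ck_on (Suc k) S f \<Longrightarrow> Ck_on k S (\<lambda>x. frechet_derivative f (at x) v)"
  by simp

lemma Ck_on_Suc_imp: "Ck_on (Suc k) S f \<Longrightarrow> Ck_on k S f"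
proof (induction k arbitrary: f)
  case 0
  then show ?case
    by (auto simp: continuous_at_imp_continuous_on differentiable_imp_continuous_within)
next
  case (Suc k)
  then show ?case using Ck_on.simps(2) by blast
qed

lemma Ck_on_subset: "Ck_on k S f \<Longrightarrow> T \<subseteq> S \<Longrightarrow> Ck_on k T f"
  by (induction k arbitrary: f) (auto intro: continuous_on_subset)

lemma Ck_on_continuous: "Ck_on k S f \<Longrightarrow> continuous_on S f"
  by (induction k) (use Ck_on_Suc_imp in auto)

lemma Ck_on_const: "open S \<Longrightarrow> Ck_on k S (\<lambda>x. c)"
proof (induction k arbitrary: c)
  case (Suc k)
  then show ?case by (intro Ck_on_SucI[where f' = "\<lambda>x v. 0"]) auto
qed auto

lemma Ck_on_bounded_linear: "open S \<Longrightarrow> bounded_linear f \<Longrightarrow> Ck_on k S f"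
proof (cases k)
  case (Suc k)
  assume "open S" "bounded_linear f"
  then show ?thesis unfolding Suc
    by (intro Ck_on_SucI[where f' = "\<lambda>x. f"] Ck_on_const bounded_linear_imp_has_derivative)
qed (simp add: linear_continuous_on)

lemma Ck_on_add: "open S \<Longrightarrow> Ck_on k S f \<Longrightarrow> Ck_on k S g \<Longrightarrow> Ck_on k S (\<lambda>x. f x + g x)"
proof (induction k arbitrary: f g)
  case (Suc k)
  note f = Suc.prems(2) and g = Suc.prems(3)
  show ?case
    by (rule Ck_on_SucI[OF Suc.prems(1) has_derivative_add[OF Ck_on_has_derivative[OF f] Ck_on_has_derivative[OF g]]])
      (assumption | rule Suc.IH Suc.prems(1) Ck_on_derivative[OF f] Ck_on_derivative[OF g])+
qed (auto intro: continuous_intros)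

lemma Ck_on_sum: "open S \<Longrightarrow> (\<And>i. i \<in> I \<Longrightarrow> Ck_on k S (f i)) \<Longrightarrow> Ck_on k S (\<lambda>x. \<Sum>i\<in>I. f i x)"
  by (induction I rule: infinite_finite_induct) (auto intro: Ck_on_add Ck_on_const)

lemma Ck_on_bilinear:
  assumes "open S" "bounded_bilinear p"
  shows "Ck_on k S f \<Longrightarrow> Ck_on k S g \<Longrightarrow> Ck_on k S (\<lambda>x. p (f x) (g x))"
proof (induction k arbitrary: f g)
  case 0
  then show ?case using bounded_bilinear.continuous_on[OF assms(2)] by auto
next
  case (Suc k)
  note f = Suc.prems(1) and g = Suc.prems(2)
  show ?case
    by (rule Ck_on_SucI[OF assms(1) bounded_bilinear.FDERIV[OF assms(2) Ck_on_has_derivative[OF f] Ck_on_has_derivative[OF g]]])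
      (assumption | rule Ck_on_add Suc.IH assms(1) Ck_on_Suc_imp[OF f] Ck_on_Suc_imp[OF g] Ck_on_derivative[OF f] Ck_on_derivative[OF g])+
qed

lemma Ck_on_linear_comp:
  assumes "open S" "bounded_linear h"
  shows "Ck_on k S f \<Longrightarrow> Ck_on k S (\<lambda>x. h (f x))"
proof (induction k arbitrary: f)
  case 0
  then show ?case using bounded_linear.continuous_on[OF assms(2)] by auto
next
  case (Suc k)
  show ?case
    by (rule Ck_on_SucI[OF assms(1) bounded_linear.has_derivative[OF assms(2) Ck_on_has_derivative[OF Suc.prems]]])
      (assumption, intro Suc.IH Ck_on_derivative[OF Suc.prems])
qed

lemma Ck_on_diff: "open S \<Longrightarrow> Ck_on k S f \<Longrightarrow> Ck_on k S g \<Longrightarrow> Ck_on k S (\<lambda>x. f x - g x)"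
  using Ck_on_add[of S k f "\<lambda>x. - g x"] Ck_on_linear_comp[of S uminus k g]
  by (simp add: bounded_linear_minus bounded_linear_ident)

lemmas Ck_on_mult = Ck_on_bilinear[OF _ bounded_bilinear_mult]
  and Ck_on_scaleR = Ck_on_bilinear[OF _ bounded_bilinear_scaleR]

lemma Ck_on_prod:
  fixes f :: "'i \<Rightarrow> 'a::real_normed_vector \<Rightarrow> real"
  shows "open S \<Longrightarrow> (\<And>i. i \<in> I \<Longrightarrow> Ck_on k S (f i)) \<Longrightarrow> Ck_on k S (\<lambda>x. \<Prod>i\<in>I. f i x)"
  by (induction I rule: infinite_finite_induct) (auto intro: Ck_on_mult Ck_on_const)

lemma Ck_on_Pair:
  assumes "open S" "Ck_on k S f" "Ck_on k S g"
  shows "Ck_on k S (\<lambda>x. (f x, g x))"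
proof -
  have "Ck_on k S (\<lambda>x. (f x, 0))" "Ck_on k S (\<lambda>x. (0, g x))"
    by (rule Ck_on_linear_comp[OF assms(1) _ assms(2)] Ck_on_linear_comp[OF assms(1) _ assms(3)],
        intro bounded_linear_Pair bounded_linear_ident bounded_linear_zero)+
  from Ck_on_add[OF assms(1) this] show ?thesis by simp
qed

text \<open>\<open>Ck_on\<close> controls derivatives in fixed directions only, while the chain rule
  applies the derivative of \<open>f\<close> to a direction that varies with \<open>x\<close>.
  Expanding this direction in the basis leaves sums of products of functions known to be of class
  k.\<close>

lemma Ck_on_compose:
  fixes f :: "'b::euclidean_space \<Rightarrow> 'c::real_normed_vector"
  assumes "open S" "open T"
  shows "Ck_on k T f \<Longrightarrow> Ck_on k S g \<Longrightarrow> g ` S \<subseteq> T \<Longrightarrow> Ck_on k S (\<lambda>x. f (g x))"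
proof (induction k arbitrary: f)
  case 0
  then show ?case using continuous_on_compose2 by auto
next
  case (Suc k)
  have fT: "(f has_derivative frechet_derivative f (at (g x))) (at (g x))" if "x \<in> S" for x
    using Ck_on_has_derivative[OF Suc.prems(1)] Suc.prems(3) that by blast
  show ?case
  proof (rule Ck_on_SucI[OF assms(1)])
    fix x assume x: "x \<in> S"
    show "((\<lambda>x. f (g x)) has_derivative (\<lambda>v. \<Sum>b\<in>Basis. (frechet_derivative g (at x) v \<bullet> b) *\<^sub>R frechet_derivative f (at (g x)) b)) (at x)"
    proof -
      have "(\<lambda>v. frechet_derivative f (at (g x)) (frechet_derivative g (at x) v)) =
        (\<lambda>v. \<Sum>b\<in>Basis. (frechet_derivative g (at x) v \<bullet> b) *\<^sub>R frechet_derivative f (at (g x)) b)"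
      proof
        fix v
        have l: "linear (frechet_derivative f (at (g x)))"
          using fT[OF x] has_derivative_linear by blast
        have "frechet_derivative f (at (g x)) w = (\<Sum>b\<in>Basis. (w \<bullet> b) *\<^sub>R frechet_derivative f (at (g x)) b)" for w
          by (subst euclidean_representation[of w, symmetric])
            (simp only: linear_sum[OF l] linear_cmul[OF l])
        then show "frechet_derivative f (at (g x)) (frechet_derivative g (at x) v) =
          (\<Sum>b\<in>Basis. (frechet_derivative g (at x) v \<bullet> b) *\<^sub>R frechet_derivative f (at (g x)) b)" .
      qed
      then show ?thesis
        using has_derivative_compose[OF Ck_on_has_derivative[OF Suc.prems(2) x] fT[OF x]] by simp
    qed
  next
    fix v
    show "Ck_on k S (\<lambda>x. \<Sum>b\<in>Basis. (frechet_derivative g (at x) v \<bullet> b) *\<^sub>R frechet_derivative f (at (g x)) b)"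
      by (intro Ck_on_sum Ck_on_scaleR assms Ck_on_linear_comp[OF assms(1) bounded_linear_inner_left] Suc.IH
          Ck_on_derivative[OF Suc.prems(1)] Ck_on_derivative[OF Suc.prems(2)] Ck_on_Suc_imp[OF Suc.prems(2)] Suc.prems(3))
  qed
qed

text \<open>The derivative is the derivative of \<open>f\<close> multiplied by two copies of the
  reciprocal, so regularity k of the reciprocal yields regularity k + 1.\<close>

lemma Ck_on_inverse:
  fixes f :: "'a::real_normed_vector \<Rightarrow> real"
  assumes "open S" "\<And>x. x \<in> S \<Longrightarrow> f x \<noteq> 0"
  shows "Ck_on k S f \<Longrightarrow> Ck_on k S (\<lambda>x. inverse (f x))"
proof (induction k)
  case 0
  then show ?case using assms by (auto intro!: continuous_intros)
next
  case (Suc k)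
  note inv = Suc.IH[OF Ck_on_Suc_imp[OF Suc.prems]]
  show ?case
  proof (rule Ck_on_SucI[OF assms(1)])
    fix x assume "x \<in> S"
    then show "((\<lambda>x. inverse (f x)) has_derivative
        (\<lambda>v. (- 1) * (inverse (f x) * frechet_derivative f (at x) v * inverse (f x)))) (at x)"
      using Deriv.has_derivative_inverse[OF assms(2) Ck_on_has_derivative[OF Suc.prems]] by simp
  qed (intro Ck_on_mult Ck_on_const assms(1) inv Ck_on_derivative[OF Suc.prems])
qed

lemma Ck_on_vec_nth: "open S \<Longrightarrow> Ck_on k S f \<Longrightarrow> Ck_on k S (\<lambda>x. f x $ i)"
  by (rule Ck_on_linear_comp[OF _ bounded_linear_vec_nth])

lemma Ck_on_vec_lambda:
  fixes f :: "'n::finite \<Rightarrow> 'a::real_normed_vector \<Rightarrow> real"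
  assumes "open S" "\<And>i. Ck_on k S (f i)"
  shows "Ck_on k S (\<lambda>x. \<chi> i. f i x)"
proof -
  have "(\<lambda>x. \<chi> i. f i x) = (\<lambda>x. \<Sum>i\<in>UNIV. f i x *\<^sub>R axis i 1)"
    by (simp add: vec_eq_iff fun_eq_iff axis_def if_distrib cong: if_cong)
  then show ?thesis
    using assms by (auto intro!: Ck_on_sum Ck_on_scaleR Ck_on_const)
qed

lemma Ck_on_det:
  fixes A :: "'a::real_normed_vector \<Rightarrow> 'n::finite \<Rightarrow> 'n \<Rightarrow> real"
  assumes "open S" "\<And>i j. Ck_on k S (\<lambda>x. A x i j)"
  shows "Ck_on k S (\<lambda>x. det (\<chi> i j. A x i j))"
  unfolding det_def vec_lambda_beta
  by (intro Ck_on_sum Ck_on_mult Ck_on_prod Ck_on_const assms)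

lemma matrix_inv_right:
  fixes A :: "real^'n^'n"
  assumes "invertible A"
  shows "A ** matrix_inv A = mat 1"
  using assms someI_ex[of "\<lambda>B. A ** B = mat 1 \<and> B ** A = mat 1"] unfolding invertible_def matrix_inv_def
  by blast

text \<open>Cramer's rule: with column \<open>i\<close> replaced by the basis vector
  \<open>axis j 1\<close>, the determinant divided by that of \<open>A x\<close> is the entry (i, j)
  of the inverse, and determinants are polynomial in the entries.\<close>

lemma Ck_on_matrix_inv:
  fixes A :: "'a::real_normed_vector \<Rightarrow> real^'n::finite^'n"
  assumes S: "open S" and inv: "\<And>x. x \<in> S \<Longrightarrow> invertible (A x)" and A: "Ck_on k S A"
  shows "Ck_on k S (\<lambda>x. matrix_inv (A x) $ i $ j)"
proof -
  let ?B = "\<lambda>x. \<chi> a b. if b = i then axis j 1 $ a else A x $ a $ b"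
  have comp: "Ck_on k S (\<lambda>x. A x $ a $ b)" for a b
    by (intro Ck_on_vec_nth S A)
  have det: "det (A x) \<noteq> 0" if "x \<in> S" for x
    using inv[OF that] invertible_det_nz by blast
  have eq: "det (?B x) * inverse (det (\<chi> a b. A x $ a $ b)) = matrix_inv (A x) $ i $ j" if "x \<in> S" for x
  proof -
    have e: "A x *v (matrix_inv (A x) *v axis j 1) = axis j 1"
      by (simp add: matrix_vector_mul_assoc matrix_inv_right inv that)
    have "det (?B x) = (matrix_inv (A x) *v axis j 1) $ i * det (A x)"
      using cramer_lemma[of i "A x" "matrix_inv (A x) *v axis j 1"] unfolding e .
    also have "(matrix_inv (A x) *v axis j 1) $ i = matrix_inv (A x) $ i $ j"
      by (simp add: matrix_vector_mult_basis column_def)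
    finally show ?thesis using det[OF that] by simp
  qed
  have "Ck_on k S (\<lambda>x. det (?B x) * inverse (det (\<chi> a b. A x $ a $ b)))"
  proof (intro Ck_on_mult Ck_on_inverse Ck_on_det S comp)
    show "Ck_on k S (\<lambda>x. if b = i then axis j 1 $ a else A x $ a $ b)" for a b
      by (cases "b = i") (auto intro: comp Ck_on_const S)
  qed (use det in simp)
  then show ?thesis
    by (rule Ck_on_cong[OF S, rotated]) (rule eq)
qed


section \<open>Symmetry of second derivatives\<close>

text \<open>Two applications of the mean value theorem, first along \<open>u\<close> to the
  increment \<phi> and then along \<open>v\<close> to the derivative \<psi>, turn the quotient into
  a second derivative at a point of the small parallelogram; continuity of the second derivative
  does the rest.\<close>

lemma second_difference_quotient:
  fixes f :: "'a::euclidean_space \<Rightarrow> real"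
  assumes S: "open S" "x \<in> S" and f: "Ck_on 2 S f" and e: "e > 0"
  shows "\<exists>d>0. \<forall>h. 0 < h \<and> h < d \<longrightarrow>
    \<bar>(f (x + h *\<^sub>R u + h *\<^sub>R v) - f (x + h *\<^sub>R u) - f (x + h *\<^sub>R v) + f x) / h\<^sup>2
      - frechet_derivative (\<lambda>y. frechet_derivative f (at y) u) (at x) v\<bar> < e"
proof -
  let ?D = "\<lambda>y. frechet_derivative f (at y) u"
  let ?D2 = "\<lambda>y. frechet_derivative ?D (at y) v"
  have f1: "Ck_on (Suc 1) S f" and f2: "Ck_on (Suc 0) S ?D" and f3: "Ck_on 0 S ?D2"
    using f by (auto simp: numeral_2_eq_2)
  have fd: "(f has_derivative frechet_derivative f (at y)) (at y)" if "y \<in> S" for y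
    by (rule Ck_on_has_derivative[OF f1 that])
  have Dd: "(?D has_derivative frechet_derivative ?D (at y)) (at y)" if "y \<in> S" for y
    by (rule Ck_on_has_derivative[OF f2 that])
  have "isCont ?D2 x" using f3 S by (auto simp: continuous_on_eq_continuous_at)
  then obtain r1 where r1: "r1 > 0" "\<And>y. norm (y - x) < r1 \<Longrightarrow> \<bar>?D2 y - ?D2 x\<bar> < e"
    using e unfolding continuous_at_eps_delta by (auto simp: dist_norm)
  obtain r2 where r2: "r2 > 0" "ball x r2 \<subseteq> S" using S openE by blast
  define r where "r = min r1 r2"
  \<comment> \<open>Makes the parallelogram with sides h * u and h * v fit into the ball of radius
    \<open>r\<close>; the added 1 avoids division by zero.\<close>
  define d where "d = r / (norm u + norm v + 1)"
  have pos: "norm u + norm v + 1 > 0" by (simp add: add_nonneg_pos)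
  have "d > 0" using r1 r2 pos by (simp add: d_def r_def)
  moreover have "\<bar>(f (x + h *\<^sub>R u + h *\<^sub>R v) - f (x + h *\<^sub>R u) - f (x + h *\<^sub>R v) + f x) / h\<^sup>2 - ?D2 x\<bar> < e"
    if h: "0 < h" "h < d" for h
  proof -
    have near: "norm (s *\<^sub>R u + t *\<^sub>R v) < r" if "0 \<le> s" "s \<le> h" "0 \<le> t" "t \<le> h" for s t
    proof -
      have "norm (s *\<^sub>R u + t *\<^sub>R v) \<le> s * norm u + t * norm v"
        using that by (intro order_trans[OF norm_triangle_ineq]) simp
      also have "\<dots> \<le> h * norm u + h * norm v"
        using that by (intro add_mono mult_right_mono) auto
      also have "\<dots> \<le> h * (norm u + norm v + 1)" using h by (simp add: algebra_simps)
      also have "\<dots> < r" using h pos by (simp add: d_def pos_less_divide_eq)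
      finally show ?thesis .
    qed
    have inS: "x + s *\<^sub>R u + t *\<^sub>R v \<in> S" if "0 \<le> s" "s \<le> h" "0 \<le> t" "t \<le> h" for s t
    proof -
      have "x + s *\<^sub>R u + t *\<^sub>R v \<in> ball x r2"
        using near[OF that] unfolding mem_ball dist_commute[of x] by (simp add: r_def dist_norm add.assoc)
      then show ?thesis using r2 by blast
    qed
    define \<phi> where "\<phi> s = f (x + s *\<^sub>R u + h *\<^sub>R v) - f (x + s *\<^sub>R u)" for s
    have d\<phi>: "(\<phi> has_real_derivative (?D (x + s *\<^sub>R u + h *\<^sub>R v) - ?D (x + s *\<^sub>R u))) (at s)" if s: "0 \<le> s" "s \<le> h" for s
    proof -
      have A: "((\<lambda>s. f (x + s *\<^sub>R u + w)) has_real_derivative ?D (x + s *\<^sub>R u + w)) (at s)"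
        if "x + s *\<^sub>R u + w \<in> S" for w
      proof -
        have "((\<lambda>s. x + s *\<^sub>R u + w) has_derivative (\<lambda>t. t *\<^sub>R u)) (at s)"
          by (auto intro!: derivative_eq_intros)
        from has_derivative_compose[OF this fd[OF that]]
        have "((\<lambda>s. f (x + s *\<^sub>R u + w)) has_derivative (\<lambda>t. frechet_derivative f (at (x + s *\<^sub>R u + w)) (t *\<^sub>R u))) (at s)" .
        then show ?thesis
          using linear_cmul[OF has_derivative_linear[OF fd[OF that]]]
          by (simp add: has_field_derivative_def mult.commute[of "frechet_derivative f _ u"] mult_commute_abs)
      qed
      show ?thesis unfolding \<phi>_def
        using A[of "h *\<^sub>R v"] A[of 0] inS[OF s, of h] inS[OF s, of 0] h
        by (intro DERIV_diff) auto
    qed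
    obtain s where s: "0 < s" "s < h"
      "\<phi> h - \<phi> 0 = (h - 0) * (?D (x + s *\<^sub>R u + h *\<^sub>R v) - ?D (x + s *\<^sub>R u))"
      using MVT2[OF h(1) d\<phi>] by blast
    define \<psi> where "\<psi> t = ?D (x + s *\<^sub>R u + t *\<^sub>R v)" for t
    have d\<psi>: "(\<psi> has_real_derivative ?D2 (x + s *\<^sub>R u + t *\<^sub>R v)) (at t)" if t: "0 \<le> t" "t \<le> h" for t
    proof -
      have inS': "x + s *\<^sub>R u + t *\<^sub>R v \<in> S" using inS[of s t] s t by simp
      have "((\<lambda>t. x + s *\<^sub>R u + t *\<^sub>R v) has_derivative (\<lambda>t. t *\<^sub>R v)) (at t)"
        by (auto intro!: derivative_eq_intros)
      from has_derivative_compose[OF this Dd[OF inS']]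
      show ?thesis unfolding \<psi>_def
        using linear_cmul[OF has_derivative_linear[OF Dd[OF inS']]]
        by (simp add: has_field_derivative_def mult_commute_abs)
    qed
    obtain t where t: "0 < t" "t < h" "\<psi> h - \<psi> 0 = (h - 0) * ?D2 (x + s *\<^sub>R u + t *\<^sub>R v)"
      using MVT2[OF h(1) d\<psi>] by blast
    have "f (x + h *\<^sub>R u + h *\<^sub>R v) - f (x + h *\<^sub>R u) - f (x + h *\<^sub>R v) + f x = \<phi> h - \<phi> 0"
      by (simp add: \<phi>_def)
    also have "\<dots> = h\<^sup>2 * ?D2 (x + s *\<^sub>R u + t *\<^sub>R v)"
      using s(3) t(3) by (simp add: \<psi>_def power2_eq_square)
    finally have "(f (x + h *\<^sub>R u + h *\<^sub>R v) - f (x + h *\<^sub>R u) - f (x + h *\<^sub>R v) + f x) / h\<^sup>2 = ?D2 (x + s *\<^sub>R u + t *\<^sub>R v)"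
      using h by simp
    moreover have "norm (x + s *\<^sub>R u + t *\<^sub>R v - x) < r1"
      using near[of s t] s t by (simp add: r_def add.assoc)
    ultimately show ?thesis using r1(2) by simp
  qed
  ultimately show ?thesis by blast
qed

text \<open>The numerator of the second difference quotient is symmetric in \<open>u\<close> and
  \<open>v\<close>, so both second derivatives are limits of the same quotients.\<close>

lemma second_derivative_symmetric_real:
  fixes f :: "'a::euclidean_space \<Rightarrow> real"
  assumes S: "open S" "x \<in> S" and f: "Ck_on 2 S f"
  shows "frechet_derivative (\<lambda>y. frechet_derivative f (at y) u) (at x) v =
    frechet_derivative (\<lambda>y. frechet_derivative f (at y) v) (at x) u" (is "?a = ?b")
proof (rule ccontr)
  assume "?a \<noteq> ?b"
  then have e: "\<bar>?a - ?b\<bar> / 2 > 0" by simp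
  obtain d1 where d1: "d1 > 0" "\<And>h. 0 < h \<Longrightarrow> h < d1 \<Longrightarrow>
    \<bar>(f (x + h *\<^sub>R u + h *\<^sub>R v) - f (x + h *\<^sub>R u) - f (x + h *\<^sub>R v) + f x) / h\<^sup>2 - ?a\<bar> < \<bar>?a - ?b\<bar> / 2"
    using second_difference_quotient[OF S f e] by blast
  obtain d2 where d2: "d2 > 0" "\<And>h. 0 < h \<Longrightarrow> h < d2 \<Longrightarrow>
    \<bar>(f (x + h *\<^sub>R v + h *\<^sub>R u) - f (x + h *\<^sub>R v) - f (x + h *\<^sub>R u) + f x) / h\<^sup>2 - ?b\<bar> < \<bar>?a - ?b\<bar> / 2"
    using second_difference_quotient[OF S f e] by blast
  define h where "h = min d1 d2 / 2"
  have h: "0 < h" "h < d1" "h < d2" using d1(1) d2(1) by (auto simp: h_def)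
  have eq: "f (x + h *\<^sub>R v + h *\<^sub>R u) - f (x + h *\<^sub>R v) - f (x + h *\<^sub>R u) + f x =
    f (x + h *\<^sub>R u + h *\<^sub>R v) - f (x + h *\<^sub>R u) - f (x + h *\<^sub>R v) + f x"
    by (simp add: add_ac)
  have "\<bar>X - a\<bar> < \<bar>a - b\<bar> / 2 \<Longrightarrow> \<bar>X - b\<bar> < \<bar>a - b\<bar> / 2 \<Longrightarrow> False" for X a b :: real
    using abs_triangle_ineq[of "a - X" "X - b"] by (simp add: abs_minus_commute)
  then show False using d1(2)[OF h(1,2)] d2(2)[OF h(1,3)] unfolding eq by blast
qed

lemma second_derivative_symmetric:
  fixes f :: "'a::euclidean_space \<Rightarrow> 'b::euclidean_space"
  assumes S: "open S" "x \<in> S" and f: "Ck_on 2 S f"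
  shows "frechet_derivative (\<lambda>y. frechet_derivative f (at y) u) (at x) v =
    frechet_derivative (\<lambda>y. frechet_derivative f (at y) v) (at x) u"
proof (rule euclidean_eqI)
  fix b :: 'b assume "b \<in> Basis"
  have f1: "Ck_on (Suc (Suc 0)) S f" using f by (simp add: numeral_2_eq_2)
  have 1: "frechet_derivative (\<lambda>y. f y \<bullet> b) (at y) w = frechet_derivative f (at y) w \<bullet> b" if "y \<in> S" for y w
    using frechet_derivative_at[OF has_derivative_inner_left[OF Ck_on_has_derivative[OF f1 that], of b]] by metis
  have 2: "frechet_derivative (\<lambda>y. frechet_derivative (\<lambda>y. f y \<bullet> b) (at y) u) (at x) v =
      frechet_derivative (\<lambda>y. frechet_derivative f (at y) u) (at x) v \<bullet> b" for u v
  proof -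
    have "((\<lambda>y. frechet_derivative f (at y) u \<bullet> b) has_derivative
        (\<lambda>v. frechet_derivative (\<lambda>y. frechet_derivative f (at y) u) (at x) v \<bullet> b)) (at x)"
      by (intro has_derivative_inner_left Ck_on_has_derivative[OF Ck_on_derivative[OF f1] S(2)])
    then have "((\<lambda>y. frechet_derivative (\<lambda>y. f y \<bullet> b) (at y) u) has_derivative
        (\<lambda>v. frechet_derivative (\<lambda>y. frechet_derivative f (at y) u) (at x) v \<bullet> b)) (at x)"
      by (rule has_derivative_transform_within_open[OF _ S]) (simp add: 1)
    then show ?thesis using frechet_derivative_at by metis
  qed
  have "Ck_on 2 S (\<lambda>y. f y \<bullet> b)"
    by (rule Ck_on_linear_comp[OF S(1) bounded_linear_inner_left f])
  from second_derivative_symmetric_real[OF S this, of u v]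
  show "frechet_derivative (\<lambda>y. frechet_derivative f (at y) u) (at x) v \<bullet> b =
    frechet_derivative (\<lambda>y. frechet_derivative f (at y) v) (at x) u \<bullet> b"
    unfolding 2 .
qed

section \<open>Fixed points in spaces of continuous functions\<close>

text \<open>A continuous function on a closed interval is represented by the bounded continuous function
  that is constant outside the interval.\<close>

lemma Banach_fix_continuous:
  fixes \<Phi> :: "(real \<Rightarrow> 'a::banach) \<Rightarrow> real \<Rightarrow> 'a"
  assumes ab: "a \<le> b" and r: "0 \<le> r" and c: "0 \<le> c" "c < 1"
    and cont: "\<And>v. continuous_on {a..b} v \<Longrightarrow> (\<forall>t\<in>{a..b}. norm (v t - w) \<le> r) \<Longrightarrow> continuous_on {a..b} (\<Phi> v)"
    and self: "\<And>v t. continuous_on {a..b} v \<Longrightarrow> (\<forall>t\<in>{a..b}. norm (v t - w) \<le> r) \<Longrightarrow> t \<in> {a..b} \<Longrightarrow> norm (\<Phi> v t - w) \<le> r"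
    and contr: "\<And>u v d t. continuous_on {a..b} u \<Longrightarrow> (\<forall>t\<in>{a..b}. norm (u t - w) \<le> r) \<Longrightarrow>
      continuous_on {a..b} v \<Longrightarrow> (\<forall>t\<in>{a..b}. norm (v t - w) \<le> r) \<Longrightarrow>
      (\<forall>t\<in>{a..b}. norm (u t - v t) \<le> d) \<Longrightarrow> t \<in> {a..b} \<Longrightarrow> norm (\<Phi> u t - \<Phi> v t) \<le> c * d"
  obtains v where "continuous_on {a..b} v" "\<And>t. t \<in> {a..b} \<Longrightarrow> norm (v t - w) \<le> r"
    "\<And>t. t \<in> {a..b} \<Longrightarrow> v t = \<Phi> v t"
proof -
  define S where "S = PiC {a..b} (\<lambda>_. cball w r)"
  define q where "q t = max a (min b t)" for t :: real
  have q: "q t \<in> {a..b}" "t \<in> {a..b} \<Longrightarrow> q t = t" for t using ab by (auto simp: q_def)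
  have qc: "continuous_on UNIV q" unfolding q_def by (intro continuous_intros)
  define T where "T v = Bcontfun (\<lambda>t. \<Phi> (apply_bcontfun v) (q t))" for v
  have inS: "v \<in> S \<longleftrightarrow> (\<forall>t\<in>{a..b}. norm (apply_bcontfun v t - w) \<le> r)" for v
    by (auto simp: S_def mem_PiC_iff Pi_iff dist_norm norm_minus_commute)
  have T: "apply_bcontfun (T v) t = \<Phi> (apply_bcontfun v) (q t)" if "v \<in> S" for v t
  proof -
    have v: "continuous_on {a..b} (apply_bcontfun v)" "\<forall>t\<in>{a..b}. norm (apply_bcontfun v t - w) \<le> r"
      using that inS by auto
    have "continuous_on UNIV (\<lambda>t. \<Phi> (apply_bcontfun v) (q t))"
      by (rule continuous_on_compose2[OF cont[OF v] qc]) (use q(1) in blast)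
    moreover have "norm (\<Phi> (apply_bcontfun v) (q t)) \<le> r + norm w" for t
      using self[OF v q(1)[of t]] norm_triangle_sub[of "\<Phi> (apply_bcontfun v) (q t)" w] by linarith
    ultimately have "(\<lambda>t. \<Phi> (apply_bcontfun v) (q t)) \<in> bcontfun" by (rule bcontfun_normI)
    then show ?thesis by (simp add: T_def Bcontfun_inverse)
  qed
  have "\<exists>!v\<in>S. T v = v"
  proof (rule Banach_fix[OF _ _ c])
    show "complete S" unfolding S_def by (intro closed_PiC complete_eq_closed[THEN iffD2]) auto
    have "const_bcontfun w \<in> S" using r by (simp add: inS)
    then show "S \<noteq> {}" by blast
    show "T ` S \<subseteq> S"
    proof
      fix u assume "u \<in> T ` S"
      then obtain v where v: "v \<in> S" "u = T v" by blast
      have "norm (\<Phi> (apply_bcontfun v) (q t) - w) \<le> r" for t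
        using v(1) q(1) unfolding inS by (intro self) auto
      then show "u \<in> S" unfolding inS v(2) T[OF v(1)] by blast
    qed
    show "dist (T u) (T v) \<le> c * dist u v" if "u \<in> S" "v \<in> S" for u v
    proof (rule dist_bound)
      fix t
      have "\<forall>t\<in>{a..b}. norm (apply_bcontfun u t - apply_bcontfun v t) \<le> dist u v"
        using dist_bounded[of u _ v] by (simp add: dist_norm)
      then show "dist (apply_bcontfun (T u) t) (apply_bcontfun (T v) t) \<le> c * dist u v"
        using that q(1)[of t] unfolding T[OF that(1)] T[OF that(2)] dist_norm[of "\<Phi> _ _"]
        by (intro contr) (auto simp: inS)
    qed
  qed
  then obtain v where v: "v \<in> S" "T v = v" by blast
  have "apply_bcontfun v t = \<Phi> (apply_bcontfun v) t" if "t \<in> {a..b}" for t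
    using T[OF v(1), of t] unfolding v(2) q(2)[OF that] .
  then show thesis
    using v(1)[unfolded inS] by (intro that[of "apply_bcontfun v"]) (blast | simp only: continuous_on_apply_bcontfun)+
qed

section \<open>Ordinary differential equations\<close>

lemma integral_has_vector_derivative_interior:
  fixes f :: "real \<Rightarrow> 'a::banach"
  assumes "continuous_on {a..b} f" "a < t" "t < b"
  shows "((\<lambda>u. integral {a..u} f) has_vector_derivative f t) (at t)"
  using integral_has_vector_derivative[OF assms(1), of t] assms at_within_Icc_at[of a t b] by simp

lemma integral_continuous_indefinite:
  fixes f :: "real \<Rightarrow> 'a::banach"
  assumes "continuous_on {a..b} f"
  shows "continuous_on {a..b} (\<lambda>u. integral {a..u} f)"
  using indefinite_integral_continuous_1[OF integrable_continuous_real[OF assms]] .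

lemma integral_diff_bound:
  fixes f h :: "real \<Rightarrow> 'a::banach"
  assumes "a \<le> b" "continuous_on {a..b} f" "continuous_on {a..b} h"
    "\<And>t. t \<in> {a..b} \<Longrightarrow> norm (f t - h t) \<le> B"
  shows "norm (integral {a..b} f - integral {a..b} h) \<le> B * (b - a)"
proof -
  have "integral {a..b} f - integral {a..b} h = integral {a..b} (\<lambda>t. f t - h t)"
    using assms by (intro integral_diff[symmetric] integrable_continuous_real)
  then show ?thesis
    using integral_bound[of a b "\<lambda>t. f t - h t" B] assms by (simp add: continuous_on_diff)
qed

text \<open>The boundary value problem is solved by a contraction for the velocity \<open>v\<close>: the correction
  \<open>H - integral {0..1} H\<close> has mean zero over \<open>{0..1}\<close>, which forces \<open>x 1 = q\<close>.\<close>

lemma quadratic_ode_boundary_value: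
  fixes \<Gamma> :: "'a::euclidean_space \<Rightarrow> 'a \<Rightarrow> 'a \<Rightarrow> 'a"
  assumes R: "R > 0" and K: "K \<ge> 1"
    and bil: "\<And>x. x \<in> cball x0 R \<Longrightarrow> bilinear (\<Gamma> x)"
    and bound: "\<And>x u v. x \<in> cball x0 R \<Longrightarrow> norm (\<Gamma> x u v) \<le> K * norm u * norm v"
    and lip: "\<And>x y u v. x \<in> cball x0 R \<Longrightarrow> y \<in> cball x0 R \<Longrightarrow>
      norm (\<Gamma> x u v - \<Gamma> y u v) \<le> K * norm (x - y) * norm u * norm v"
    and cont: "\<And>S x u v. continuous_on S x \<Longrightarrow> continuous_on S u \<Longrightarrow> continuous_on S v \<Longrightarrow>
      x ` S \<subseteq> cball x0 R \<Longrightarrow> continuous_on S (\<lambda>t::real. \<Gamma> (x t) (u t) (v t))"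
    and p: "norm (p - x0) < min (R / 17) (1 / (480 * K))"
    and q: "norm (q - x0) < min (R / 17) (1 / (480 * K))"
  obtains x v where "\<And>t. t \<in> {-1..2} \<Longrightarrow> x t \<in> cball x0 R"
    "\<And>t. t \<in> {-1..2} \<Longrightarrow> norm (v t) \<le> 2 * norm (q - p)"
    "\<And>t. -1 < t \<Longrightarrow> t < 2 \<Longrightarrow> (x has_vector_derivative v t) (at t)"
    "\<And>t. -1 < t \<Longrightarrow> t < 2 \<Longrightarrow> (v has_vector_derivative - \<Gamma> (x t) (v t) (v t)) (at t)"
    "x 0 = p" "x 1 = q"
proof -
  \<comment> \<open>With \<open>e\<close> the distance of the end points, e < 2 * \<rho>. The curve
    stays within 8 * e of \<open>p\<close>, hence within 17 * \<rho> \<le> R of \<open>x0\<close>.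
    The bound 480 * K * \<rho> \<le> 1 gives 240 * K * e \<le> 1, which makes the contraction factor
    120 * K * e at most 1/2.\<close>
  define \<rho> where "\<rho> = min (R / 17) (1 / (480 * K))"
  define w where "w = q - p"
  define e where "e = norm w"
  have \<rho>: "\<rho> > 0" "17 * \<rho> \<le> R" "480 * K * \<rho> \<le> 1"
  proof -
    show "\<rho> > 0" "17 * \<rho> \<le> R" using R K by (auto simp: \<rho>_def)
    have "\<rho> \<le> 1 / (480 * K)" by (simp add: \<rho>_def)
    then show "480 * K * \<rho> \<le> 1" using K by (simp add: field_simps)
  qed
  have e: "0 \<le> e" "e < 2 * \<rho>"
    using p q norm_triangle_ineq4[of "q - x0" "p - x0"] by (auto simp: e_def w_def \<rho>_def[symmetric])
  have Ke: "240 * K * e \<le> 1"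
  proof -
    have "240 * K * e \<le> 240 * K * (2 * \<rho>)" using e K by (intro mult_left_mono) auto
    then show ?thesis using \<rho>(3) by simp
  qed
  have e1: "e \<le> 1"
  proof -
    have "240 * e \<le> 240 * K * e" using e K by (intro mult_right_mono) auto
    then show ?thesis using Ke e by linarith
  qed
  \<comment> \<open>Velocities within \<open>e\<close> of the straight-line velocity
    \<open>w\<close>, whose norm is \<open>e\<close>; hence their norms are at most 2 * e.\<close>
  define good where "good v \<longleftrightarrow> continuous_on {-1..2} v \<and> (\<forall>t\<in>{-1..2}. norm (v t - w) \<le> e)" for v :: "real \<Rightarrow> 'a"
  \<comment> \<open>Integrals start at the left end -1; subtracting the integral up to 0 enforces
    the initial condition at time 0.\<close>
  define X where "X v t = p + (integral {-1..t} v - integral {-1..0} v)" for v :: "real \<Rightarrow> 'a" and t :: real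
  define F where "F v t = - \<Gamma> (X v t) (v t) (v t)" for v :: "real \<Rightarrow> 'a" and t :: real
  define H where "H v t = integral {-1..t} (F v)" for v :: "real \<Rightarrow> 'a" and t :: real
  define \<Phi> where "\<Phi> v t = w + (H v t - integral {0..1} (H v))" for v :: "real \<Rightarrow> 'a" and t :: real
  have vb: "norm (v t) \<le> 2 * e" if "good v" "t \<in> {-1..2}" for v t
  proof -
    have "norm (v t - w) \<le> e" using that unfolding good_def by blast
    then show ?thesis using norm_triangle_sub[of "v t" w] unfolding e_def by linarith
  qed
  have csub: "continuous_on {a..b} v" if "good v" "-1 \<le> a" "b \<le> 2" for v a b
    using that continuous_on_subset unfolding good_def by fastforce
  have Xc: "continuous_on {-1..2} (X v)" if "good v" for v
    unfolding X_def using that[unfolded good_def] by (intro continuous_intros integral_continuous_indefinite) auto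
  \<comment> \<open>At most 6 * e from an interval of length at most 3, and 2 * e from the
    normalizing interval {-1..0}.\<close>
  have X0: "norm (X v t - p) \<le> 8 * e" if v: "good v" and t: "t \<in> {-1..2}" for v t
  proof -
    have "norm (integral {-1..t} v) \<le> 2 * e * (t - (-1))"
      using t by (intro integral_bound csub v vb) auto
    also have "\<dots> \<le> 2 * e * 3" using t e by (intro mult_left_mono) auto
    finally have 1: "norm (integral {-1..t} v) \<le> 6 * e" by simp
    have "norm (integral {-1..0} v) \<le> 2 * e * (0 - (-1))"
      by (intro integral_bound csub v vb) auto
    then show ?thesis
      using 1 norm_triangle_ineq4[of "integral {-1..t} v" "integral {-1..0} v"] by (simp add: X_def)
  qed
  have Xin: "X v t \<in> cball x0 R" if v: "good v" and t: "t \<in> {-1..2}" for v t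
  proof -
    have "norm (X v t - x0) \<le> norm (X v t - p) + norm (p - x0)"
      using norm_triangle_ineq[of "X v t - p" "p - x0"] by simp
    also have "\<dots> \<le> 17 * \<rho>" using X0[OF v t] e p by (simp add: \<rho>_def[symmetric])
    finally show ?thesis using \<rho> by (simp add: dist_norm norm_minus_commute)
  qed
  have Fc: "continuous_on {-1..2} (F v)" if "good v" for v
    unfolding F_def using that Xin Xc by (intro continuous_on_minus cont) (auto simp: good_def)
  have Fb: "norm (F v t) \<le> 4 * K * e * e" if v: "good v" and t: "t \<in> {-1..2}" for v t
  proof -
    have "norm (F v t) \<le> K * norm (v t) * norm (v t)"
      using bound[OF Xin[OF v t]] by (simp add: F_def)
    also have "\<dots> \<le> K * (2 * e) * (2 * e)"
      using vb[OF v t] K e by (intro mult_mono mult_nonneg_nonneg) auto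
    finally show ?thesis by simp
  qed
  have Hc: "continuous_on {-1..2} (H v)" if "good v" for v
    unfolding H_def by (intro integral_continuous_indefinite Fc that)
  have Hb: "norm (H v t) \<le> 12 * K * e * e" if v: "good v" and t: "t \<in> {-1..2}" for v t
  proof -
    have "norm (H v t) \<le> 4 * K * e * e * (t - (-1))"
      unfolding H_def using t by (intro integral_bound continuous_on_subset[OF Fc[OF v]] Fb[OF v]) auto
    also have "\<dots> \<le> 4 * K * e * e * 3" using t e K by (intro mult_left_mono) auto
    finally show ?thesis by simp
  qed
  have H01: "continuous_on {0..1} (H v)" if "good v" for v
    by (rule continuous_on_subset[OF Hc[OF that]]) auto
  \<comment> \<open>Positions differ by at most 4 * d and velocities have norm at most 2 * e. The
    change of base point costs 16 * K * e * e * d, the change of velocities 4 * K * e * d by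
    bilinearity; e \<le> 1 merges the two into the factor 20.\<close>
  have Fd: "norm (F u t - F v t) \<le> 20 * K * e * d"
    if u: "good u" and v: "good v" and d: "\<forall>t\<in>{-1..2}. norm (u t - v t) \<le> d" and t: "t \<in> {-1..2}" for u v d t
  proof -
    have d0: "0 \<le> d" using d t norm_ge_zero order_trans by blast
    have "norm (integral {-1..t} u - integral {-1..t} v) \<le> d * (t - (-1))"
      using t d by (intro integral_diff_bound csub u v) auto
    also have "\<dots> \<le> d * 3" using t d0 by (intro mult_left_mono) auto
    finally have 1: "norm (integral {-1..t} u - integral {-1..t} v) \<le> 3 * d" by simp
    have 2: "norm (integral {-1..0} u - integral {-1..0} v) \<le> d * (0 - (-1))"
      using d by (intro integral_diff_bound csub u v) auto
    have "X u t - X v t = (integral {-1..t} u - integral {-1..t} v) - (integral {-1..0} u - integral {-1..0} v)"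
      by (simp add: X_def)
    then have Xd: "norm (X u t - X v t) \<le> 4 * d"
      using 1 2 norm_triangle_ineq4[of "integral {-1..t} u - integral {-1..t} v" "integral {-1..0} u - integral {-1..0} v"]
      by simp
    let ?G = "\<Gamma> (X v t)"
    have b: "bilinear ?G" by (rule bil[OF Xin[OF v t]])
    have "?G (u t) (u t) - ?G (v t) (v t) = ?G (u t - v t) (u t) + ?G (v t) (u t - v t)"
      by (simp add: bilinear_lsub[OF b] bilinear_rsub[OF b])
    then have eq: "F v t - F u t = (\<Gamma> (X u t) (u t) (u t) - ?G (u t) (u t)) + (?G (u t - v t) (u t) + ?G (v t) (u t - v t))"
      by (simp add: F_def algebra_simps)
    have "norm (F v t - F u t) \<le> norm (\<Gamma> (X u t) (u t) (u t) - ?G (u t) (u t)) + (norm (?G (u t - v t) (u t)) + norm (?G (v t) (u t - v t)))"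
      unfolding eq by (rule order_trans[OF norm_triangle_ineq add_left_mono[OF norm_triangle_ineq]])
    also have "\<dots> \<le> K * (4 * d) * (2 * e) * (2 * e) + (K * d * (2 * e) + K * (2 * e) * d)"
    proof (intro add_mono)
      show "norm (\<Gamma> (X u t) (u t) (u t) - ?G (u t) (u t)) \<le> K * (4 * d) * (2 * e) * (2 * e)"
        using Xd vb[OF u t] K e d0
        by (intro order_trans[OF lip[OF Xin[OF u t] Xin[OF v t]]] mult_mono mult_nonneg_nonneg) auto
      show "norm (?G (u t - v t) (u t)) \<le> K * d * (2 * e)"
        using d t vb[OF u t] K e d0
        by (intro order_trans[OF bound[OF Xin[OF v t]]] mult_mono mult_nonneg_nonneg) auto
      show "norm (?G (v t) (u t - v t)) \<le> K * (2 * e) * d"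
        using d t vb[OF v t] K e d0
        by (intro order_trans[OF bound[OF Xin[OF v t]]] mult_mono mult_nonneg_nonneg) auto
    qed
    also have "\<dots> = K * d * e * (16 * e + 4)" by (simp add: algebra_simps)
    also have "\<dots> \<le> K * d * e * 20" using e e1 K d0 by (intro mult_left_mono) auto
    finally show ?thesis by (simp add: norm_minus_commute algebra_simps)
  qed
  have Hd: "norm (H u t - H v t) \<le> 60 * K * e * d"
    if u: "good u" and v: "good v" and d: "\<forall>t\<in>{-1..2}. norm (u t - v t) \<le> d" and t: "t \<in> {-1..2}" for u v d t
  proof -
    have d0: "0 \<le> d" using d t norm_ge_zero order_trans by blast
    have "norm (H u t - H v t) \<le> 20 * K * e * d * (t - (-1))"
      unfolding H_def using t
      by (intro integral_diff_bound continuous_on_subset[OF Fc[OF v]] continuous_on_subset[OF Fc[OF u]] Fd[OF u v d]) auto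
    also have "\<dots> \<le> 20 * K * e * d * 3" using t e K d0 by (intro mult_left_mono) auto
    finally show ?thesis by simp
  qed
  obtain v where v: "continuous_on {-1..2} v" "\<And>t. t \<in> {-1..2} \<Longrightarrow> norm (v t - w) \<le> e"
    and fix_v: "\<And>t. t \<in> {-1..2} \<Longrightarrow> v t = \<Phi> v t"
  proof (rule Banach_fix_continuous[of "-1" 2 e "1/2" w \<Phi>])
    fix v :: "real \<Rightarrow> 'a" assume "continuous_on {-1..2} v" "\<forall>t\<in>{-1..2}. norm (v t - w) \<le> e"
    then have v: "good v" by (simp add: good_def)
    show "continuous_on {-1..2} (\<Phi> v)"
      unfolding \<Phi>_def by (intro continuous_intros Hc v)
    show "norm (\<Phi> v t - w) \<le> e" if t: "t \<in> {-1..2}" for t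
    proof -
      have "norm (integral {0..1} (H v)) \<le> 12 * K * e * e * (1 - 0)"
        by (intro integral_bound H01 v Hb) auto
      then have "norm (\<Phi> v t - w) \<le> 24 * K * e * e"
        using Hb[OF v t] norm_triangle_ineq4[of "H v t" "integral {0..1} (H v)"] by (simp add: \<Phi>_def)
      also have "\<dots> \<le> 1 * e"
        using Ke e K by (intro mult_right_mono) (auto simp: mult.assoc)
      finally show ?thesis by simp
    qed
  next
    fix u v :: "real \<Rightarrow> 'a" and d t :: real
    assume "continuous_on {-1..2} u" "\<forall>t\<in>{-1..2}. norm (u t - w) \<le> e"
      "continuous_on {-1..2} v" "\<forall>t\<in>{-1..2}. norm (v t - w) \<le> e"
      and d: "\<forall>t\<in>{-1..2}. norm (u t - v t) \<le> d" and t: "t \<in> {-1..2}"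
    then have u: "good u" and v: "good v" by (auto simp: good_def)
    have d0: "0 \<le> d" using d t norm_ge_zero order_trans by blast
    have "norm (integral {0..1} (H u) - integral {0..1} (H v)) \<le> 60 * K * e * d * (1 - 0)"
      by (intro integral_diff_bound H01 u v Hd d) auto
    moreover have "\<Phi> u t - \<Phi> v t = (H u t - H v t) - (integral {0..1} (H u) - integral {0..1} (H v))"
      by (simp add: \<Phi>_def)
    ultimately have "norm (\<Phi> u t - \<Phi> v t) \<le> 120 * K * e * d"
      using Hd[OF u v d t] norm_triangle_ineq4[of "H u t - H v t" "integral {0..1} (H u) - integral {0..1} (H v)"] by simp
    also have "\<dots> \<le> (1/2) * d"
      using Ke d0 by (intro mult_right_mono) auto
    finally show "norm (\<Phi> u t - \<Phi> v t) \<le> 1 / 2 * d" .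
  qed (use e in auto)
  have gv: "good v" using v by (simp add: good_def)
  show thesis
  proof (rule that[of "X v" v])
    show "X v t \<in> cball x0 R" if "t \<in> {-1..2}" for t by (rule Xin[OF gv that])
    show "norm (v t) \<le> 2 * norm (q - p)" if "t \<in> {-1..2}" for t
      using vb[OF gv that] by (simp add: e_def w_def)
    show "(X v has_vector_derivative v t) (at t)" if "-1 < t" "t < 2" for t
      unfolding X_def using integral_has_vector_derivative_interior[OF v(1) that]
      by (auto intro!: derivative_eq_intros)
    show "(v has_vector_derivative - \<Gamma> (X v t) (v t) (v t)) (at t)" if t: "-1 < t" "t < 2" for t
    proof -
      have "(\<Phi> v has_vector_derivative F v t) (at t)"
        unfolding \<Phi>_def H_def using integral_has_vector_derivative_interior[OF Fc[OF gv] t]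
        by (auto intro!: derivative_eq_intros)
      then have "(v has_vector_derivative F v t) (at t)"
        by (rule has_vector_derivative_transform_within_open[of _ _ _ "{-1<..<2}"]) (use t fix_v in auto)
      then show ?thesis by (simp add: F_def)
    qed
    show "X v 0 = p" by (simp add: X_def)
    have "integral {-1..0} v + integral {0..1} v = integral {-1..1} v"
      by (intro Henstock_Kurzweil_Integration.integral_combine integrable_continuous_real csub gv) auto
    moreover have "integral {0..1} v = w"
    proof -
      let ?C = "integral {0..1} (H v)"
      have "((\<lambda>t. w + (H v t - ?C)) has_integral (w + (?C - ?C))) {0..1}"
        using has_integral_const_real[of w 0 1] has_integral_const_real[of ?C 0 1]
        by (intro has_integral_add has_integral_diff integrable_integral integrable_continuous_real[OF H01[OF gv]]) auto
      then have "integral {0..1} (\<lambda>t. w + (H v t - ?C)) = w" by (simp add: integral_unique)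
      moreover have "integral {0..1} v = integral {0..1} (\<lambda>t. w + (H v t - ?C))"
        by (intro integral_cong) (use fix_v in \<open>auto simp: \<Phi>_def\<close>)
      ultimately show ?thesis by simp
    qed
    ultimately have "integral {-1..1} v - integral {-1..0} v = w" by (metis add_diff_cancel_left')
    then show "X v 1 = q" by (simp add: X_def w_def)
  qed
qed

text \<open>The coefficient is so small that the Picard operator contracts on the whole unit
  interval at once. The ball of radius norm ini about \<open>ini\<close> is invariant; there
  solutions have norm at most 2 * norm ini, whence the factor 2 * \<beta>.\<close>

lemma linear_ode_exists:
  fixes B :: "real \<Rightarrow> 'a::euclidean_space \<Rightarrow> 'a"
  assumes \<beta>: "0 \<le> \<beta>" "\<beta> \<le> 1/2"
    and lin: "\<And>t. t \<in> {0..1} \<Longrightarrow> linear (B t)"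
    and bound: "\<And>t z. t \<in> {0..1} \<Longrightarrow> norm (B t z) \<le> \<beta> * norm z"
    and cont: "\<And>u. continuous_on {0..1} u \<Longrightarrow> continuous_on {0..1} (\<lambda>t. B t (u t))"
  obtains u where "u 0 = ini" "\<And>t. t \<in> {0..1} \<Longrightarrow> (u has_vector_derivative B t (u t)) (at t within {0..1})"
    "norm (u 1 - ini) \<le> 2 * \<beta> * norm ini"
proof -
  define \<Phi> where "\<Phi> u t = ini + integral {0..t} (\<lambda>s. B s (u s))" for u :: "real \<Rightarrow> 'a" and t :: real
  have csub: "continuous_on {0..t} (\<lambda>s. B s (u s))" if "continuous_on {0..1} u" "t \<in> {0..1}" for u t
    by (rule continuous_on_subset[OF cont[OF that(1)]]) (use that in auto)
  have est: "norm (\<Phi> u t - ini) \<le> 2 * \<beta> * norm ini"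
    if u: "continuous_on {0..1} u" "\<forall>t\<in>{0..1}. norm (u t - ini) \<le> norm ini" and t: "t \<in> {0..1}" for u t
  proof -
    have "norm (B s (u s)) \<le> \<beta> * (2 * norm ini)" if "s \<in> {0..t}" for s
    proof -
      have "norm (u s) \<le> 2 * norm ini"
      proof -
        have "norm (u s - ini) \<le> norm ini" using u(2) that t by simp
        then show ?thesis using norm_triangle_sub[of "u s" ini] by linarith
      qed
      then show ?thesis
        using that t \<beta> by (intro order_trans[OF bound] mult_left_mono) auto
    qed
    then have "norm (integral {0..t} (\<lambda>s. B s (u s))) \<le> \<beta> * (2 * norm ini) * (t - 0)"
      using t by (intro integral_bound csub u t) auto
    also have "\<dots> \<le> \<beta> * (2 * norm ini) * 1"
      using t \<beta> by (intro mult_left_mono) auto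
    finally show ?thesis by (simp add: \<Phi>_def)
  qed
  obtain u where u: "continuous_on {0..1} u" "\<And>t. t \<in> {0..1} \<Longrightarrow> norm (u t - ini) \<le> norm ini"
    and fix_u: "\<And>t. t \<in> {0..1} \<Longrightarrow> u t = \<Phi> u t"
  proof (rule Banach_fix_continuous[of 0 1 "norm ini" "1/2" ini \<Phi>])
    fix u :: "real \<Rightarrow> 'a" assume u: "continuous_on {0..1} u" "\<forall>t\<in>{0..1}. norm (u t - ini) \<le> norm ini"
    show "continuous_on {0..1} (\<Phi> u)"
      unfolding \<Phi>_def by (intro continuous_intros integral_continuous_indefinite cont u)
    show "norm (\<Phi> u t - ini) \<le> norm ini" if "t \<in> {0..1}" for t
      using est[OF u that] mult_right_mono[of "2 * \<beta>" 1 "norm ini"] \<beta> by simp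
  next
    fix u v :: "real \<Rightarrow> 'a" and d t :: real
    assume u: "continuous_on {0..1} u" "\<forall>t\<in>{0..1}. norm (u t - ini) \<le> norm ini"
      and v: "continuous_on {0..1} v" "\<forall>t\<in>{0..1}. norm (v t - ini) \<le> norm ini"
      and d: "\<forall>t\<in>{0..1}. norm (u t - v t) \<le> d" and t: "t \<in> {0..1}"
    have d0: "0 \<le> d" using d t norm_ge_zero order_trans by blast
    have "norm (B s (u s) - B s (v s)) \<le> 1/2 * d" if "s \<in> {0..t}" for s
    proof -
      have s: "s \<in> {0..1}" using that t by auto
      have "norm (B s (u s) - B s (v s)) \<le> \<beta> * norm (u s - v s)"
        using bound[OF s, of "u s - v s"] by (simp add: linear_diff[OF lin[OF s]])
      also have "\<dots> \<le> 1/2 * d" using \<beta> d s by (intro mult_mono) auto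
      finally show ?thesis .
    qed
    then have "norm (integral {0..t} (\<lambda>s. B s (u s)) - integral {0..t} (\<lambda>s. B s (v s))) \<le> 1/2 * d * (t - 0)"
      using t by (intro integral_diff_bound csub u v t) auto
    also have "\<dots> \<le> 1/2 * d * 1" using t d0 by (intro mult_left_mono) auto
    finally show "norm (\<Phi> u t - \<Phi> v t) \<le> 1/2 * d" by (simp add: \<Phi>_def)
  qed auto
  show thesis
  proof (rule that[of u])
    show "u 0 = ini" using fix_u[of 0] by (simp add: \<Phi>_def)
    show "norm (u 1 - ini) \<le> 2 * \<beta> * norm ini"
      using est[OF u(1), of 1] u(2) fix_u[of 1] by simp
    show "(u has_vector_derivative B t (u t)) (at t within {0..1})" if t: "t \<in> {0..1}" for t
    proof -
      have "(\<Phi> u has_vector_derivative B t (u t)) (at t within {0..1})"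
        unfolding \<Phi>_def using integral_has_vector_derivative[OF cont[OF u(1)] t]
        by (auto intro!: derivative_eq_intros)
      then show ?thesis
        by (rule has_vector_derivative_transform[where f = "\<Phi> u", rotated 2]) (rule t, erule fix_u)
    qed
  qed
qed

text \<open>At a time \<open>s\<close> where the norm of \<open>z\<close> is maximal, integrating
  the equation from 0 gives norm (z s) \<le> 1/2 * norm (z s), so the maximum is 0.\<close>

lemma linear_ode_unique_zero:
  fixes B :: "real \<Rightarrow> 'a::euclidean_space \<Rightarrow> 'a"
  assumes bound: "\<And>t z. t \<in> {0..1} \<Longrightarrow> norm (B t z) \<le> 1/2 * norm z"
    and z0: "z 0 = 0" and z: "\<And>t. t \<in> {0..1} \<Longrightarrow> (z has_vector_derivative B t (z t)) (at t within {0..1})"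
    and t: "t \<in> {0..1}"
  shows "z t = 0"
proof -
  have zc: "continuous_on {0..1} z"
    unfolding continuous_on_eq_continuous_within using has_vector_derivative_continuous[OF z] by blast
  obtain s where s: "s \<in> {0..1}" "\<And>t. t \<in> {0..1} \<Longrightarrow> norm (z t) \<le> norm (z s)"
    using continuous_attains_sup[of "{0..1}" "\<lambda>t. norm (z t)"] continuous_on_norm[OF zc] by auto
  have "((\<lambda>t. B t (z t)) has_integral (z s - z 0)) {0..s}"
    using s(1) by (intro fundamental_theorem_of_calculus) (auto intro: has_vector_derivative_within_subset[OF z])
  then have "norm (z s - z 0) \<le> 1/2 * norm (z s) * measure lborel {0..s}"
  proof (rule has_integral_bound_real[where S = "{}", rotated 2])
    fix t assume "t \<in> {0..s} - {}"
    then have t: "t \<in> {0..1}" using s(1) by auto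
    show "norm (B t (z t)) \<le> 1/2 * norm (z s)"
      using bound[OF t, of "z t"] s(2)[OF t] by linarith
  qed auto
  then have "norm (z s) \<le> 1/2 * norm (z s) * s" using s(1) z0 by simp
  also have "\<dots> \<le> 1/2 * norm (z s) * 1" using s(1) by (intro mult_left_mono) auto
  finally have "norm (z s) = 0" by simp
  then show ?thesis using s(2)[OF t] by simp
qed

section \<open>The metric and the Christoffel symbols in charts\<close>

lemma sum_swap3:
  "(\<Sum>k\<in>K. \<Sum>i\<in>I. \<Sum>j\<in>J. f k i j) = (\<Sum>i\<in>I. \<Sum>j\<in>J. \<Sum>k\<in>K. f k i j)"
  by (rule trans[OF sum.swap]) (intro sum.cong refl sum.swap)

locale riemannian_manifold =
  fixes A :: "('m::topological_space, real^'n::finite) chart set" and g :: "('m, 'n) metric"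
  assumes A: "smooth_structure A" and g: "riemannian_metric A g"
begin

abbreviation overlap :: "('m, real^'n) chart \<Rightarrow> ('m, real^'n) chart \<Rightarrow> (real^'n) set" where
  "overlap c d \<equiv> snd c ` (fst c \<inter> fst d)"

abbreviation Dtr :: "('m, real^'n) chart \<Rightarrow> ('m, real^'n) chart \<Rightarrow> real^'n \<Rightarrow> real^'n \<Rightarrow> real^'n" where
  "Dtr c d x u \<equiv> frechet_derivative (transition c d) (at x) u"

abbreviation D2tr :: "('m, real^'n) chart \<Rightarrow> ('m, real^'n) chart \<Rightarrow> real^'n \<Rightarrow> real^'n \<Rightarrow> real^'n \<Rightarrow> real^'n" where
  "D2tr c d x u w \<equiv> frechet_derivative (\<lambda>y. Dtr c d y u) (at x) w"

abbreviation gram :: "('m, real^'n) chart \<Rightarrow> real^'n \<Rightarrow> real^'n^'n" where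
  "gram c \<equiv> metric_matrix A g c"

abbreviation Dgram :: "('m, real^'n) chart \<Rightarrow> real^'n \<Rightarrow> real^'n \<Rightarrow> real^'n^'n" where
  "Dgram c x w \<equiv> frechet_derivative (gram c) (at x) w"

text \<open>The Christoffel symbols as a vector-valued bilinear form. The geodesic equation is then
  x'' = - Chr c x x' x', and changes of chart can be treated without indices.\<close>

definition Chr :: "('m, real^'n) chart \<Rightarrow> real^'n \<Rightarrow> real^'n \<Rightarrow> real^'n \<Rightarrow> real^'n" where
  "Chr c x u v = (\<chi> k. \<Sum>i\<in>UNIV. \<Sum>j\<in>UNIV. christoffel A g c x k i j * u $ i * v $ j)"

lemmas inv_left = chart_inv_left[OF A]

lemma open_chart: "c \<in> A \<Longrightarrow> open (fst c)" "c \<in> A \<Longrightarrow> open (chart_image c)"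
  using A unfolding smooth_structure_def by blast+

lemma inv_mem: "x \<in> chart_image c \<Longrightarrow> chart_inv c x \<in> fst c"
  by (simp add: chart_image_def chart_inv_def inv_into_into)

lemma inv_right: "x \<in> chart_image c \<Longrightarrow> snd c (chart_inv c x) = x"
  by (simp add: chart_image_def chart_inv_def f_inv_into_f)

lemma chart_continuous: "c \<in> A \<Longrightarrow> continuous_on (fst c) (snd c)"
  "c \<in> A \<Longrightarrow> continuous_on (chart_image c) (chart_inv c)"
  using A unfolding smooth_structure_def homeomorphism_def by blast+

lemma open_overlap: "c \<in> A \<Longrightarrow> d \<in> A \<Longrightarrow> open (overlap c d)"
  using A unfolding smooth_structure_def compatible_def by blast

lemma mem_overlap: "c \<in> A \<Longrightarrow> x \<in> overlap c d \<longleftrightarrow> x \<in> chart_image c \<and> chart_inv c x \<in> fst d"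
proof
  assume c: "c \<in> A" and "x \<in> overlap c d"
  then obtain p where "p \<in> fst c" "p \<in> fst d" "x = snd c p" by auto
  then show "x \<in> chart_image c \<and> chart_inv c x \<in> fst d"
    using inv_left[OF c] by (simp add: chart_image_def)
next
  assume "x \<in> chart_image c \<and> chart_inv c x \<in> fst d"
  then show "x \<in> overlap c d"
    using inv_mem[of x c] inv_right[of x c] by (metis IntI imageI)
qed

lemma transition_Ck: "c \<in> A \<Longrightarrow> d \<in> A \<Longrightarrow> Ck_on k (overlap c d) (transition c d)"
  using A unfolding smooth_structure_def compatible_def smooth_on_def by blast

lemma transition_has_derivative:
  "c \<in> A \<Longrightarrow> d \<in> A \<Longrightarrow> x \<in> overlap c d \<Longrightarrow> (transition c d has_derivative Dtr c d x) (at x)"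
  using Ck_on_has_derivative[OF transition_Ck] .

lemma linear_Dtr: "c \<in> A \<Longrightarrow> d \<in> A \<Longrightarrow> x \<in> overlap c d \<Longrightarrow> linear (Dtr c d x)"
  using transition_has_derivative has_derivative_linear by blast

lemma transition_mem: "c \<in> A \<Longrightarrow> d \<in> A \<Longrightarrow> x \<in> overlap c d \<Longrightarrow> transition c d x \<in> overlap d c"
  by (auto simp: transition_def inv_left)

lemma tangent_of_change:
  assumes "c \<in> A" "d \<in> A" "p \<in> fst c" "p \<in> fst d"
  shows "tangent_of A c p u = tangent_of A d p (Dtr c d (snd c p) u)"
proof
  fix e
  show "tangent_of A c p u e = tangent_of A d p (Dtr c d (snd c p) u) e"
  proof (cases "e \<in> A \<and> p \<in> fst e")
    case True
    then show ?thesis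
      using frechet_transition_comp[OF A assms(1,2) _ assms(3,4), of e u] by (simp only: tangent_of_def simp_thms if_True)
  next
    case False
    then show ?thesis by (simp only: tangent_of_def if_False)
  qed
qed

lemma tangent_of_coord:
  assumes "c \<in> A" "p \<in> fst c" "v \<in> tangent_space A p"
  shows "tangent_of A c p (v c) = v"
proof
  fix d
  have "v d = Dtr c d (snd c p) (v c)" if "d \<in> A" "p \<in> fst d"
    using assms that unfolding tangent_space_def by blast
  moreover have "v d = 0" if "\<not> (d \<in> A \<and> p \<in> fst d)"
    using assms that unfolding tangent_space_def by blast
  ultimately show "tangent_of A c p (v c) d = v d" by (simp add: tangent_of_def)
qed

lemma Dtr_inverse:
  assumes "c \<in> A" "d \<in> A" "x \<in> overlap c d"
  shows "Dtr c d x (Dtr d c (transition c d x) w) = w"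
proof -
  obtain p where p: "p \<in> fst c" "p \<in> fst d" "x = snd c p" using assms(3) by auto
  have "transition c d x = snd d p" using p assms inv_left by (simp add: transition_def)
  then have "Dtr c d x (Dtr d c (transition c d x) w) = Dtr d d (snd d p) w"
    using frechet_transition_comp[OF A assms(2,1,2) p(2,1,2), of w] p(3) by simp
  also have "\<dots> = w"
    using tangent_of_same[OF A assms(2) p(2), of w] assms(2) p(2) by (simp add: tangent_of_def)
  finally show ?thesis .
qed

section \<open>Koszul formula and change of chart for the connection\<close>

lemma metric_in_chart:
  assumes c: "c \<in> A" and p: "p \<in> fst c"
  shows "g p (tangent_of A c p u) (tangent_of A c p v) = u \<bullet> (gram c (snd c p) *v v)"
proof -
  let ?t = "tangent_of A c p"
  have t: "?t w \<in> tangent_space A p" for w by (rule tangent_of_in_tangent_space[OF A c p])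
  have add: "g p (?t (v + w)) (?t z) = g p (?t v) (?t z) + g p (?t w) (?t z)" for v w z
    unfolding tangent_of_add[OF A c p] using g t unfolding riemannian_metric_def by blast
  have sc: "g p (?t (r *\<^sub>R w)) (?t z) = r * g p (?t w) (?t z)" for r w z
    unfolding tangent_of_scale[OF A c p] using g t unfolding riemannian_metric_def by blast
  have sy: "g p (?t w) (?t z) = g p (?t z) (?t w)" for w z
    using g t unfolding riemannian_metric_def by blast
  have lin: "linear (\<lambda>w. g p (?t w) (?t z))" for z
    by (rule linearI) (simp_all add: add sc)
  have ex: "g p (?t u) (?t z) = (\<Sum>i\<in>UNIV. u $ i * g p (?t (axis i 1)) (?t z))" for u z
  proof -
    have "g p (?t u) (?t z) = g p (?t (\<Sum>i\<in>UNIV. u $ i *\<^sub>R axis i 1)) (?t z)"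
      using basis_expansion[of u] by (simp add: scalar_mult_eq_scaleR)
    also have "\<dots> = (\<Sum>i\<in>UNIV. u $ i * g p (?t (axis i 1)) (?t z))"
      by (simp add: linear_sum[OF lin] sc)
    finally show ?thesis .
  qed
  have "g p (?t u) (?t v) = (\<Sum>i\<in>UNIV. u $ i * (\<Sum>j\<in>UNIV. v $ j * g p (?t (axis j 1)) (?t (axis i 1))))"
    by (subst ex, subst sy, subst ex) simp
  also have "\<dots> = u \<bullet> (gram c (snd c p) *v v)"
    unfolding inner_vec_def matrix_vector_mult_def metric_matrix_def inv_left[OF c p]
    by (simp add: sy mult.commute)
  finally show ?thesis .
qed

lemma gram_pos: "c \<in> A \<Longrightarrow> x \<in> chart_image c \<Longrightarrow> u \<noteq> 0 \<Longrightarrow> u \<bullet> (gram c x *v u) > 0"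
  using metric_matrix_pos[OF A g] by blast

lemma gram_symmetric: "c \<in> A \<Longrightarrow> x \<in> chart_image c \<Longrightarrow> u \<bullet> (gram c x *v v) = v \<bullet> (gram c x *v u)"
proof -
  assume c: "c \<in> A" and x: "x \<in> chart_image c"
  have "transpose (gram c x) = gram c x"
    using metric_matrix_sym[OF A g c x x] by (simp add: transpose_def vec_eq_iff)
  then show ?thesis by (metis dot_lmul_matrix inner_commute transpose_matrix_vector)
qed

lemma gram_Ck: "c \<in> A \<Longrightarrow> Ck_on k (chart_image c) (gram c)"
  using g unfolding riemannian_metric_def smooth_on_def by blast

lemma gram_has_derivative:
  "c \<in> A \<Longrightarrow> x \<in> chart_image c \<Longrightarrow> (gram c has_derivative Dgram c x) (at x)"
  using Ck_on_has_derivative[OF gram_Ck] .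

lemma metric_partial_Dgram:
  assumes "c \<in> A" "x \<in> chart_image c"
  shows "metric_partial A g c x i j l = Dgram c x (axis i 1) $ j $ l"
proof -
  have "((\<lambda>y. gram c y $ j $ l) has_derivative (\<lambda>w. Dgram c x w $ j $ l)) (at x)"
    by (intro bounded_linear.has_derivative[OF bounded_linear_vec_nth] gram_has_derivative assms)
  then show ?thesis unfolding metric_partial_def using frechet_derivative_at by metis
qed

lemma Dgram_expand:
  assumes "c \<in> A" "x \<in> chart_image c"
  shows "a \<bullet> (Dgram c x w *v b) = (\<Sum>i\<in>UNIV. \<Sum>j\<in>UNIV. \<Sum>l\<in>UNIV. w $ i * (a $ j * (b $ l * metric_partial A g c x i j l)))"
proof -
  have lin: "linear (Dgram c x)" using gram_has_derivative[OF assms] has_derivative_linear by blast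
  have "Dgram c x w = Dgram c x (\<Sum>i\<in>UNIV. w $ i *\<^sub>R axis i 1)"
    using basis_expansion[of w] by (simp add: scalar_mult_eq_scaleR)
  also have "\<dots> = (\<Sum>i\<in>UNIV. w $ i *\<^sub>R Dgram c x (axis i 1))"
    by (simp add: linear_sum[OF lin] linear_cmul[OF lin])
  finally have e: "Dgram c x w $ j $ l = (\<Sum>i\<in>UNIV. w $ i * metric_partial A g c x i j l)" for j l
    by (simp add: metric_partial_Dgram[OF assms])
  have "a \<bullet> (Dgram c x w *v b) = (\<Sum>j\<in>UNIV. \<Sum>l\<in>UNIV. \<Sum>i\<in>UNIV. w $ i * (a $ j * (b $ l * metric_partial A g c x i j l)))"
    unfolding inner_vec_def matrix_vector_mult_def e
    by (simp add: sum_distrib_left sum_distrib_right mult_ac)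
  also have "\<dots> = (\<Sum>j\<in>UNIV. \<Sum>i\<in>UNIV. \<Sum>l\<in>UNIV. w $ i * (a $ j * (b $ l * metric_partial A g c x i j l)))"
    by (intro sum.cong refl sum.swap)
  also have "\<dots> = (\<Sum>i\<in>UNIV. \<Sum>j\<in>UNIV. \<Sum>l\<in>UNIV. w $ i * (a $ j * (b $ l * metric_partial A g c x i j l)))"
    by (rule sum.swap)
  finally show ?thesis .
qed

text \<open>This is \<open>christoffel_lower\<close> contracted with three vectors. It determines
  \<open>Chr\<close> through the nondegenerate form \<open>gram c x\<close>, in terms of derivatives
  of the metric only, which can be compared between charts.\<close>

lemma Koszul:
  assumes "c \<in> A" "x \<in> chart_image c"
  shows "w \<bullet> (gram c x *v Chr c x u v) =
    (1/2) * (v \<bullet> (Dgram c x u *v w) + u \<bullet> (Dgram c x v *v w) - u \<bullet> (Dgram c x w *v v))"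
proof -
  let ?P = "metric_partial A g c x"
  have "w \<bullet> (gram c x *v Chr c x u v) =
     (\<Sum>l\<in>UNIV. \<Sum>k\<in>UNIV. \<Sum>i\<in>UNIV. \<Sum>j\<in>UNIV. (w $ l * u $ i * v $ j) * (gram c x $ l $ k * christoffel A g c x k i j))"
    unfolding inner_vec_def matrix_vector_mult_def Chr_def
    by (simp add: sum_distrib_left mult_ac)
  also have "\<dots> = (\<Sum>l\<in>UNIV. \<Sum>i\<in>UNIV. \<Sum>j\<in>UNIV. \<Sum>k\<in>UNIV. (w $ l * u $ i * v $ j) * (gram c x $ l $ k * christoffel A g c x k i j))"
    by (intro sum.cong refl sum_swap3)
  also have "\<dots> = (\<Sum>l\<in>UNIV. \<Sum>i\<in>UNIV. \<Sum>j\<in>UNIV. (w $ l * u $ i * v $ j) * ((1/2) * (?P i j l + ?P j i l - ?P l i j)))"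
    unfolding sum_distrib_left[symmetric] christoffel_lower[OF A g assms] ..
  also have "\<dots> = (1/2) * ((\<Sum>l\<in>UNIV. \<Sum>i\<in>UNIV. \<Sum>j\<in>UNIV. u $ i * (v $ j * (w $ l * ?P i j l))) +
      (\<Sum>l\<in>UNIV. \<Sum>i\<in>UNIV. \<Sum>j\<in>UNIV. v $ j * (u $ i * (w $ l * ?P j i l))) -
      (\<Sum>l\<in>UNIV. \<Sum>i\<in>UNIV. \<Sum>j\<in>UNIV. w $ l * (u $ i * (v $ j * ?P l i j))))"
    by (simp add: sum_distrib_left sum.distrib sum_subtractf algebra_simps)
  also have "(\<Sum>l\<in>UNIV. \<Sum>i\<in>UNIV. \<Sum>j\<in>UNIV. u $ i * (v $ j * (w $ l * ?P i j l))) = v \<bullet> (Dgram c x u *v w)"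
    unfolding Dgram_expand[OF assms]
    by (rule sum_swap3)
  also have "(\<Sum>l\<in>UNIV. \<Sum>i\<in>UNIV. \<Sum>j\<in>UNIV. v $ j * (u $ i * (w $ l * ?P j i l))) = u \<bullet> (Dgram c x v *v w)"
  proof -
    have "(\<Sum>l\<in>UNIV. \<Sum>i\<in>UNIV. \<Sum>j\<in>UNIV. v $ j * (u $ i * (w $ l * ?P j i l))) =
        (\<Sum>l\<in>UNIV. \<Sum>j\<in>UNIV. \<Sum>i\<in>UNIV. v $ j * (u $ i * (w $ l * ?P j i l)))"
      by (intro sum.cong refl sum.swap)
    also have "\<dots> = (\<Sum>j\<in>UNIV. \<Sum>l\<in>UNIV. \<Sum>i\<in>UNIV. v $ j * (u $ i * (w $ l * ?P j i l)))"
      by (rule sum.swap)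
    also have "\<dots> = (\<Sum>j\<in>UNIV. \<Sum>i\<in>UNIV. \<Sum>l\<in>UNIV. v $ j * (u $ i * (w $ l * ?P j i l)))"
      by (intro sum.cong refl sum.swap)
    finally show ?thesis unfolding Dgram_expand[OF assms] .
  qed
  also have "(\<Sum>l\<in>UNIV. \<Sum>i\<in>UNIV. \<Sum>j\<in>UNIV. w $ l * (u $ i * (v $ j * ?P l i j))) = u \<bullet> (Dgram c x w *v v)"
    unfolding Dgram_expand[OF assms] ..
  finally show ?thesis .
qed

lemma gram_change:
  assumes "c \<in> A" "d \<in> A" "x \<in> overlap c d"
  shows "u \<bullet> (gram c x *v v) = Dtr c d x u \<bullet> (gram d (transition c d x) *v Dtr c d x v)"
proof -
  obtain p where p: "p \<in> fst c" "p \<in> fst d" "x = snd c p" using assms(3) by auto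
  have "transition c d x = snd d p" using p assms inv_left by (simp add: transition_def)
  then show ?thesis
    using metric_in_chart[OF assms(1) p(1), of u v] tangent_of_change[OF assms(1,2) p(1,2)]
      metric_in_chart[OF assms(2) p(2)] p(3) by simp
qed

lemma bounded_bilinear_mult_vec: "bounded_bilinear (\<lambda>(M :: real^'n^'n) (v :: real^'n). M *v v)"
  unfolding bilinear_conv_bounded_bilinear[symmetric] bilinear_def
  by (auto intro!: linearI simp: matrix_vector_mult_add_rdistrib matrix_vector_right_distrib
      scaleR_matrix_vector_assoc matrix_vector_mult_scaleR)

lemma Dtr_has_derivative:
  assumes "c \<in> A" "d \<in> A" "x \<in> overlap c d"
  shows "((\<lambda>y. Dtr c d y u) has_derivative D2tr c d x u) (at x)"
  by (rule Ck_on_has_derivative[OF Ck_on_derivative[OF transition_Ck] assms(3)]) (rule assms)+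

lemma D2tr_symmetric:
  assumes "c \<in> A" "d \<in> A" "x \<in> overlap c d"
  shows "D2tr c d x u v = D2tr c d x v u"
  by (rule second_derivative_symmetric[OF open_overlap assms(3) transition_Ck]) (rule assms)+

text \<open>The product rule applied to \<open>gram_change\<close>. The two terms with
  \<open>D2tr\<close> are the source of the non-tensorial term in the law for
  \<open>Chr\<close>.\<close>

lemma Dgram_change:
  assumes "c \<in> A" "d \<in> A" and x: "x \<in> overlap c d"
  shows "u \<bullet> (Dgram c x w *v v) =
    Dtr c d x u \<bullet> (Dgram d (transition c d x) (Dtr c d x w) *v Dtr c d x v) +
    D2tr c d x u w \<bullet> (gram d (transition c d x) *v Dtr c d x v) +
    Dtr c d x u \<bullet> (gram d (transition c d x) *v D2tr c d x v w)"
proof -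
  let ?y = "transition c d x"
  have xc: "x \<in> chart_image c" using x assms mem_overlap by blast
  have yd: "?y \<in> chart_image d" using transition_mem[OF assms] assms mem_overlap by blast
  have L: "((\<lambda>y. u \<bullet> (gram c y *v v)) has_derivative (\<lambda>w. u \<bullet> (Dgram c x w *v v))) (at x)"
    by (intro has_derivative_inner_right bounded_linear.has_derivative[OF bounded_bilinear.bounded_linear_left[OF bounded_bilinear_mult_vec]]
        gram_has_derivative assms xc)
  have G: "((\<lambda>y. gram d (transition c d y)) has_derivative (\<lambda>w. Dgram d ?y (Dtr c d x w))) (at x)"
    by (rule has_derivative_compose[OF transition_has_derivative[OF assms] gram_has_derivative[OF assms(2) yd]])
  have "((\<lambda>y. Dtr c d y u \<bullet> (gram d (transition c d y) *v Dtr c d y v)) has_derivative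
     (\<lambda>w. Dtr c d x u \<bullet> (gram d ?y *v D2tr c d x v w + Dgram d ?y (Dtr c d x w) *v Dtr c d x v) +
       D2tr c d x u w \<bullet> (gram d ?y *v Dtr c d x v))) (at x)"
    by (intro has_derivative_inner bounded_bilinear.FDERIV[OF bounded_bilinear_mult_vec] G Dtr_has_derivative assms)
  then have "((\<lambda>y. u \<bullet> (gram c y *v v)) has_derivative
     (\<lambda>w. Dtr c d x u \<bullet> (gram d ?y *v D2tr c d x v w + Dgram d ?y (Dtr c d x w) *v Dtr c d x v) +
       D2tr c d x u w \<bullet> (gram d ?y *v Dtr c d x v))) (at x)"
    by (rule has_derivative_transform_within_open[OF _ open_overlap[OF assms(1,2)] x]) (rule gram_change[OF assms(1,2), symmetric])
  from has_derivative_unique[OF L this]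
  have "u \<bullet> (Dgram c x w *v v) = Dtr c d x u \<bullet> (gram d ?y *v D2tr c d x v w + Dgram d ?y (Dtr c d x w) *v Dtr c d x v) +
       D2tr c d x u w \<bullet> (gram d ?y *v Dtr c d x v)" by metis
  then show ?thesis by (simp add: inner_add_right)
qed

text \<open>Both sides have the same Koszul expansion: the terms with second derivatives of the
  transition map cancel except for the one on the right.\<close>

lemma Chr_change:
  assumes "c \<in> A" "d \<in> A" and x: "x \<in> overlap c d"
  shows "Dtr c d x (Chr c x u v) = Chr d (transition c d x) (Dtr c d x u) (Dtr c d x v) + D2tr c d x u v"
proof -
  let ?y = "transition c d x" and ?D = "Dtr c d x" and ?D2 = "D2tr c d x"
  let ?G = "gram d ?y"
  have xc: "x \<in> chart_image c" using x assms mem_overlap by blast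
  have yd: "?y \<in> chart_image d" using transition_mem[OF assms] assms mem_overlap by blast
  have sy: "a \<bullet> (?G *v b) = b \<bullet> (?G *v a)" for a b by (rule gram_symmetric[OF assms(2) yd])
  have s2: "?D2 a b = ?D2 b a" for a b by (rule D2tr_symmetric[OF assms])
  \<comment> \<open>The difference of the two sides. It is orthogonal to every \<open>?D w\<close>
    for the metric in \<open>d\<close>, and \<open>?D\<close> is onto by \<open>Dtr_inverse\<close>,
    so it is orthogonal to itself.\<close>
  let ?z = "?D (Chr c x u v) - (Chr d ?y (?D u) (?D v) + ?D2 u v)"
  have key: "?D w \<bullet> (?G *v ?z) = 0" for w
  proof -
    have 1: "?D w \<bullet> (?G *v ?D (Chr c x u v)) =
        (1/2) * (v \<bullet> (Dgram c x u *v w) + u \<bullet> (Dgram c x v *v w) - u \<bullet> (Dgram c x w *v v))"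
      unfolding gram_change[OF assms, symmetric] by (rule Koszul[OF assms(1) xc])
    have 2: "?D w \<bullet> (?G *v Chr d ?y (?D u) (?D v)) =
        (1/2) * (?D v \<bullet> (Dgram d ?y (?D u) *v ?D w) + ?D u \<bullet> (Dgram d ?y (?D v) *v ?D w) - ?D u \<bullet> (Dgram d ?y (?D w) *v ?D v))"
      by (rule Koszul[OF assms(2) yd])
    have 3: "?D2 v u \<bullet> (?G *v ?D w) = ?D w \<bullet> (?G *v ?D2 u v)" "?D2 u v \<bullet> (?G *v ?D w) = ?D w \<bullet> (?G *v ?D2 u v)"
      "?D v \<bullet> (?G *v ?D2 w u) = ?D2 u w \<bullet> (?G *v ?D v)" "?D u \<bullet> (?G *v ?D2 w v) = ?D u \<bullet> (?G *v ?D2 v w)"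
      using sy s2 by metis+
    show ?thesis
      unfolding matrix_vector_mult_diff_distrib matrix_vector_right_distrib inner_diff_right inner_add_right 1 2
        Dgram_change[OF assms] 3 by simp
  qed
  have "?z \<bullet> (?G *v ?z) = 0"
    using key[of "Dtr d c ?y ?z"] Dtr_inverse[OF assms] by simp
  then show ?thesis
    using gram_pos[OF assms(2) yd, of ?z] by fastforce
qed

end

section \<open>Parallel fields and bounds in a chart\<close>

lemma has_vector_derivative_transform_eventually:
  assumes "(f has_vector_derivative f') (at x within S)" "\<forall>\<^sub>F s in at x within S. f s = g s"
    "f x = g x" "x \<in> S"
  shows "(g has_vector_derivative f') (at x within S)"
proof -
  obtain d where "d > 0" "\<And>s. s \<in> S \<Longrightarrow> s \<noteq> x \<Longrightarrow> dist s x < d \<Longrightarrow> f s = g s"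
    using assms(2) unfolding eventually_at by blast
  then show ?thesis
    using assms(3,4) by (intro has_vector_derivative_transform_within[OF assms(1)]) auto
qed

lemma linear_Basis_expansion:
  fixes f :: "'a::euclidean_space \<Rightarrow> 'b::real_vector"
  assumes "linear f"
  shows "f w = (\<Sum>b\<in>Basis. (w \<bullet> b) *\<^sub>R f b)"
proof -
  have "f w = f (\<Sum>b\<in>Basis. (w \<bullet> b) *\<^sub>R b)" by (simp add: euclidean_representation)
  then show ?thesis by (simp add: linear_sum[OF assms] linear_cmul[OF assms])
qed

lemma norm_trilinear_le:
  fixes u v :: "real^'n"
  shows "norm (\<chi> k. \<Sum>i\<in>UNIV. \<Sum>j\<in>UNIV. a k i j * u $ i * v $ j :: real^'n) \<le>
    (\<Sum>k\<in>UNIV. \<Sum>i\<in>UNIV. \<Sum>j\<in>UNIV. \<bar>a k i j\<bar>) * norm u * norm v"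
proof -
  have "norm (\<chi> k. \<Sum>i\<in>UNIV. \<Sum>j\<in>UNIV. a k i j * u $ i * v $ j :: real^'n) \<le>
    (\<Sum>k\<in>UNIV. \<bar>\<Sum>i\<in>UNIV. \<Sum>j\<in>UNIV. a k i j * u $ i * v $ j\<bar>)"
    by (rule order_trans[OF norm_le_l1_cart]) simp
  also have "\<dots> \<le> (\<Sum>k\<in>UNIV. \<Sum>i\<in>UNIV. \<Sum>j\<in>UNIV. \<bar>a k i j\<bar> * norm u * norm v)"
  proof (intro sum_mono)
    fix k
    have "\<bar>\<Sum>i\<in>UNIV. \<Sum>j\<in>UNIV. a k i j * u $ i * v $ j\<bar> \<le> (\<Sum>i\<in>UNIV. \<Sum>j\<in>UNIV. \<bar>a k i j * u $ i * v $ j\<bar>)"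
      by (intro order_trans[OF sum_abs] sum_mono sum_abs)
    also have "\<dots> \<le> (\<Sum>i\<in>UNIV. \<Sum>j\<in>UNIV. \<bar>a k i j\<bar> * norm u * norm v)"
      unfolding abs_mult
      by (intro sum_mono mult_mono mult_nonneg_nonneg) (auto simp: component_le_norm_cart)
    finally show "\<bar>\<Sum>i\<in>UNIV. \<Sum>j\<in>UNIV. a k i j * u $ i * v $ j\<bar> \<le> (\<Sum>i\<in>UNIV. \<Sum>j\<in>UNIV. \<bar>a k i j\<bar> * norm u * norm v)" .
  qed
  finally show ?thesis by (simp add: sum_distrib_right)
qed

text \<open>\<open>Ck_on\<close> gives continuity of the derivative direction by direction; the
  operator norm is bounded by the sum of the norms over the basis directions, which is continuous on
  the compact ball.\<close>

lemma Ck_on_imp_lipschitz_cball: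
  fixes f :: "'a::euclidean_space \<Rightarrow> 'b::real_normed_vector"
  assumes "Ck_on (Suc 0) S f" "cball x0 R \<subseteq> S"
  obtains B where "0 \<le> B" "\<And>x y. x \<in> cball x0 R \<Longrightarrow> y \<in> cball x0 R \<Longrightarrow> norm (f x - f y) \<le> B * norm (x - y)"
proof -
  let ?h = "\<lambda>x. \<Sum>b\<in>Basis. norm (frechet_derivative f (at x) b)"
  have "continuous_on (cball x0 R) ?h"
    using assms Ck_on_derivative[OF assms(1)] by (intro continuous_intros) (auto intro: continuous_on_subset)
  then have "bounded (?h ` cball x0 R)" by (intro compact_imp_bounded compact_continuous_image) auto
  then obtain B where B: "B > 0" "\<And>x. x \<in> cball x0 R \<Longrightarrow> norm (?h x) \<le> B"
    unfolding bounded_pos by auto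
  have "norm (f x - f y) \<le> B * norm (x - y)" if "x \<in> cball x0 R" "y \<in> cball x0 R" for x y
  proof (rule differentiable_bound[OF convex_cball _ _ that])
    fix z assume z: "z \<in> cball x0 R"
    have d: "(f has_derivative frechet_derivative f (at z)) (at z)"
      using Ck_on_has_derivative[OF assms(1)] z assms(2) by blast
    then show "(f has_derivative frechet_derivative f (at z)) (at z within cball x0 R)"
      by (rule has_derivative_at_withinI)
    have "onorm (frechet_derivative f (at z)) \<le> ?h z"
      by (rule onorm_componentwise[OF has_derivative_bounded_linear[OF d]])
    then show "onorm (frechet_derivative f (at z)) \<le> B" using B(2)[OF z] by simp
  qed
  then show thesis using that[of B] B(1) by auto
qed

context riemannian_manifold
begin

text \<open>Continuity at \<open>t\<close> is used for the coordinates in \<open>c\<close> only;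
  since the overlap is open in these coordinates, the curve stays in the domain of \<open>d\<close>
  as well.\<close>

lemma curve_eventually_in:
  assumes c: "c \<in> A" and d: "d \<in> A" and p: "\<gamma> t \<in> fst c" "\<gamma> t \<in> fst d"
    and ev: "\<forall>\<^sub>F s in at t within S. \<gamma> s \<in> fst c"
    and x': "((\<lambda>s. snd c (\<gamma> s)) has_vector_derivative x') (at t within S)"
  shows "\<forall>\<^sub>F s in at t within S. \<gamma> s \<in> fst c \<and> \<gamma> s \<in> fst d"
proof -
  have "((\<lambda>s. snd c (\<gamma> s)) \<longlongrightarrow> snd c (\<gamma> t)) (at t within S)"
    using has_vector_derivative_continuous[OF x'] by (simp add: continuous_within)
  then have "\<forall>\<^sub>F s in at t within S. snd c (\<gamma> s) \<in> overlap c d"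
    by (rule topological_tendstoD[OF _ open_overlap[OF c d]]) (use p in auto)
  with ev show ?thesis
  proof eventually_elim
    case (elim s)
    then have "chart_inv c (snd c (\<gamma> s)) \<in> fst d" using mem_overlap[OF c] by blast
    then show ?case using elim inv_left[OF c] by simp
  qed
qed

lemma curve_chart_derivative:
  assumes c: "c \<in> A" and d: "d \<in> A" and p: "\<gamma> t \<in> fst c" "\<gamma> t \<in> fst d" and t: "t \<in> S"
    and ev: "\<forall>\<^sub>F s in at t within S. \<gamma> s \<in> fst c"
    and x': "((\<lambda>s. snd c (\<gamma> s)) has_vector_derivative x') (at t within S)"
  shows "((\<lambda>s. snd d (\<gamma> s)) has_vector_derivative Dtr c d (snd c (\<gamma> t)) x') (at t within S)"
proof (rule has_vector_derivative_transform_eventually)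
  have x: "snd c (\<gamma> t) \<in> overlap c d" using p by blast
  show "((\<lambda>s. transition c d (snd c (\<gamma> s))) has_vector_derivative Dtr c d (snd c (\<gamma> t)) x') (at t within S)"
    using has_derivative_compose[OF x'[unfolded has_vector_derivative_def] transition_has_derivative[OF c d x]]
    by (simp add: has_vector_derivative_def linear_cmul[OF linear_Dtr[OF c d x]])
  show "\<forall>\<^sub>F s in at t within S. transition c d (snd c (\<gamma> s)) = snd d (\<gamma> s)"
    using ev by eventually_elim (simp add: transition_def inv_left[OF c])
qed (use p t inv_left[OF c] in \<open>auto simp: transition_def\<close>)

text \<open>Nontriviality of \<open>at t within S\<close> makes the possibly one-sided derivative
  unique, so \<open>vector_derivative\<close> returns the chain-rule value in every chart.\<close>

lemma velocity_in_chart: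
  assumes c: "c \<in> A" and p: "\<gamma> t \<in> fst c" and t: "t \<in> S" and nb: "at t within S \<noteq> bot"
    and ev: "\<forall>\<^sub>F s in at t within S. \<gamma> s \<in> fst c"
    and x': "((\<lambda>s. snd c (\<gamma> s)) has_vector_derivative x') (at t within S)"
  shows "velocity A S \<gamma> t = tangent_of A c (\<gamma> t) x'"
proof
  fix d
  show "velocity A S \<gamma> t d = tangent_of A c (\<gamma> t) x' d"
  proof (cases "d \<in> A \<and> \<gamma> t \<in> fst d")
    case True
    then have "vector_derivative (\<lambda>s. snd d (\<gamma> s)) (at t within S) = Dtr c d (snd c (\<gamma> t)) x'"
      by (intro vector_derivative_within[OF nb] curve_chart_derivative[OF c _ p _ t ev x']) auto
    with True show ?thesis unfolding velocity_def tangent_of_def by (simp only: simp_thms if_True o_def)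
  next
    case False
    then show ?thesis unfolding velocity_def tangent_of_def by (simp only: if_False)
  qed
qed

text \<open>In another chart \<open>d\<close> the field has coordinates \<open>Dtr c d\<close>
  applied to \<open>u\<close>, where the linear map itself varies along the curve. The product rule
  thus produces an extra term with \<open>D2tr\<close>, which \<open>Chr_change\<close>
  cancels.\<close>

lemma covariant_derivative_zero:
  assumes c: "c \<in> A" and p: "\<gamma> t \<in> fst c" and t: "t \<in> S" and nb: "at t within S \<noteq> bot"
    and ev: "\<forall>\<^sub>F s in at t within S. \<gamma> s \<in> fst c"
    and x': "((\<lambda>s. snd c (\<gamma> s)) has_vector_derivative x') (at t within S)"
    and V: "\<And>s. s \<in> S \<Longrightarrow> V s = tangent_of A c (\<gamma> s) (u s)"
    and u': "(u has_vector_derivative - Chr c (snd c (\<gamma> t)) x' (u t)) (at t within S)"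
  shows "\<And>d. d \<in> A \<Longrightarrow> \<gamma> t \<in> fst d \<Longrightarrow> (\<lambda>s. V s d) differentiable (at t within S)"
    and "covariant_derivative A g S \<gamma> V t = (\<lambda>d. 0)"
proof -
  let ?x = "snd c (\<gamma> t)" and ?u' = "- Chr c (snd c (\<gamma> t)) x' (u t)"
  have dV: "((\<lambda>s. V s d) has_vector_derivative Dtr c d ?x ?u' + D2tr c d ?x x' (u t)) (at t within S)"
    if d: "d \<in> A" "\<gamma> t \<in> fst d" for d
  proof (rule has_vector_derivative_transform_eventually)
    have x: "?x \<in> overlap c d" using p d by blast
    have D: "((\<lambda>s. Dtr c d (snd c (\<gamma> s)) b) has_vector_derivative D2tr c d ?x b x') (at t within S)" for b
      using has_derivative_compose[OF x'[unfolded has_vector_derivative_def] Dtr_has_derivative[OF c d(1) x, of b]]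
        linear_cmul[OF has_derivative_linear[OF Dtr_has_derivative[OF c d(1) x, of b]]]
      by (simp add: has_vector_derivative_def)
    have ub: "((\<lambda>s. u s \<bullet> b) has_real_derivative ?u' \<bullet> b) (at t within S)" for b
      using bounded_linear.has_vector_derivative[OF bounded_linear_inner_left u', of b]
      by (simp only: has_real_derivative_iff_has_vector_derivative)
    \<comment> \<open>Expansion in the basis makes the application of a moving linear map to a
      moving vector a sum of products, to which the product rule applies.\<close>
    have "((\<lambda>s. \<Sum>b\<in>Basis. (u s \<bullet> b) *\<^sub>R Dtr c d (snd c (\<gamma> s)) b) has_vector_derivative
        (\<Sum>b\<in>Basis. (u t \<bullet> b) *\<^sub>R D2tr c d ?x b x' + (?u' \<bullet> b) *\<^sub>R Dtr c d ?x b)) (at t within S)"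
      by (intro has_vector_derivative_sum has_vector_derivative_scaleR ub D)
    moreover have "(\<Sum>b\<in>Basis. (u t \<bullet> b) *\<^sub>R D2tr c d ?x b x' + (?u' \<bullet> b) *\<^sub>R Dtr c d ?x b) =
        Dtr c d ?x ?u' + D2tr c d ?x x' (u t)"
      unfolding sum.distrib D2tr_symmetric[OF c d(1) x, of _ x']
      using linear_Basis_expansion[OF linear_Dtr[OF c d(1) x], of ?u']
        linear_Basis_expansion[OF has_derivative_linear[OF Dtr_has_derivative[OF c d(1) x, of x']], of "u t"]
      by simp
    ultimately show "((\<lambda>s. \<Sum>b\<in>Basis. (u s \<bullet> b) *\<^sub>R Dtr c d (snd c (\<gamma> s)) b) has_vector_derivative
        Dtr c d ?x ?u' + D2tr c d ?x x' (u t)) (at t within S)" by simp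
    have eq: "(\<Sum>b\<in>Basis. (u s \<bullet> b) *\<^sub>R Dtr c d (snd c (\<gamma> s)) b) = V s d"
      if "s \<in> S" "\<gamma> s \<in> fst c" "\<gamma> s \<in> fst d" for s
    proof -
      have "snd c (\<gamma> s) \<in> overlap c d" using that by blast
      then show ?thesis
        using linear_Basis_expansion[OF linear_Dtr[OF c d(1)], of "snd c (\<gamma> s)" "u s"] V[OF that(1)] that d
        by (simp add: tangent_of_def)
    qed
    have "\<forall>\<^sub>F s in at t within S. s \<in> S" by (simp add: eventually_at_filter)
    with curve_eventually_in[OF c d(1) p d(2) ev x']
    show "\<forall>\<^sub>F s in at t within S. (\<Sum>b\<in>Basis. (u s \<bullet> b) *\<^sub>R Dtr c d (snd c (\<gamma> s)) b) = V s d"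
      by eventually_elim (rule eq, auto)
    show "(\<Sum>b\<in>Basis. (u t \<bullet> b) *\<^sub>R Dtr c d (snd c (\<gamma> t)) b) = V t d" by (rule eq[OF t p d(2)])
  qed (rule t)
  show "(\<lambda>s. V s d) differentiable (at t within S)" if "d \<in> A" "\<gamma> t \<in> fst d" for d
    using dV[OF that] by (auto simp: differentiable_def has_vector_derivative_def)
  show "covariant_derivative A g S \<gamma> V t = (\<lambda>d. 0)"
  proof
    fix d
    show "covariant_derivative A g S \<gamma> V t d = 0"
    proof (cases "d \<in> A \<and> \<gamma> t \<in> fst d")
      case True
      then have d: "d \<in> A" "\<gamma> t \<in> fst d" by auto
      have x: "?x \<in> overlap c d" using p d by blast
      have "velocity A S \<gamma> t d = Dtr c d ?x x'"
        using velocity_in_chart[OF c p t nb ev x'] d by (simp add: tangent_of_def)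
      moreover have "V t d = Dtr c d ?x (u t)"
        using V[OF t] d by (simp add: tangent_of_def)
      moreover have "snd d (\<gamma> t) = transition c d ?x"
        by (simp add: transition_def inv_left[OF c p])
      ultimately have "covariant_derivative A g S \<gamma> V t d =
          Dtr c d ?x ?u' + D2tr c d ?x x' (u t) + Chr d (transition c d ?x) (Dtr c d ?x x') (Dtr c d ?x (u t))"
        using d vector_derivative_within[OF nb dV[OF d]] by (simp add: covariant_derivative_def Chr_def)
      also have "\<dots> = Dtr c d ?x ?u' + Dtr c d ?x (Chr c ?x x' (u t))"
        unfolding Chr_change[OF c d(1) x] by (simp add: algebra_simps)
      also have "\<dots> = 0"
        by (simp add: linear_neg[OF linear_Dtr[OF c d(1) x]])
      finally show ?thesis .
    next
      case False
      then show ?thesis unfolding covariant_derivative_def by (simp only: if_False)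
    qed
  qed
qed

lemma parallel_alongI:
  assumes c: "c \<in> A" and nb: "\<And>t. t \<in> S \<Longrightarrow> at t within S \<noteq> bot"
    and in_c: "\<And>t. t \<in> S \<Longrightarrow> \<gamma> t \<in> fst c"
    and x': "\<And>t. t \<in> S \<Longrightarrow> ((\<lambda>s. snd c (\<gamma> s)) has_vector_derivative x' t) (at t within S)"
    and V: "\<And>s. s \<in> S \<Longrightarrow> V s = tangent_of A c (\<gamma> s) (u s)"
    and u': "\<And>t. t \<in> S \<Longrightarrow> (u has_vector_derivative - Chr c (snd c (\<gamma> t)) (x' t) (u t)) (at t within S)"
  shows "parallel_along A g S \<gamma> V"
proof -
  have ev: "\<forall>\<^sub>F s in at t within S. \<gamma> s \<in> fst c" for t
    using in_c by (auto simp: eventually_at_filter)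
  show ?thesis
    unfolding parallel_along_def
    using covariant_derivative_zero[OF c in_c _ nb ev x' V u'] tangent_of_in_tangent_space[OF A c in_c] V by simp
qed

text \<open>The converse direction, from parallel fields to the coordinate equation; it is what
  uniqueness of parallel transport rests on.\<close>

lemma parallel_along_coord:
  assumes c: "c \<in> A" and p: "\<gamma> t \<in> fst c" and t: "t \<in> S"
    and V: "parallel_along A g S \<gamma> V" and vel: "velocity A S \<gamma> t c = x'"
  shows "((\<lambda>s. V s c) has_vector_derivative - Chr c (snd c (\<gamma> t)) x' (V t c)) (at t within S)"
proof -
  have "covariant_derivative A g S \<gamma> V t c = 0" and d: "(\<lambda>s. V s c) differentiable (at t within S)"
    using V t c p unfolding parallel_along_def by auto
  then have "vector_derivative (\<lambda>s. V s c) (at t within S) = - Chr c (snd c (\<gamma> t)) x' (V t c)"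
    using c p by (simp add: covariant_derivative_def vel Chr_def eq_neg_iff_add_eq_0)
  then show ?thesis using d vector_derivative_works by metis
qed

lemma christoffel_Ck:
  assumes c: "c \<in> A"
  shows "Ck_on k (chart_image c) (\<lambda>x. christoffel A g c x a i j)"
proof -
  note o = open_chart(2)[OF c]
  have P: "Ck_on k (chart_image c) (\<lambda>x. metric_partial A g c x i j l)" for i j l
  proof (rule Ck_on_cong[OF o])
    show "Ck_on k (chart_image c) (\<lambda>x. Dgram c x (axis i 1) $ j $ l)"
      by (intro Ck_on_vec_nth o Ck_on_derivative[OF gram_Ck[OF c]])
  qed (simp add: metric_partial_Dgram[OF c])
  show ?thesis unfolding christoffel_def
    by (intro Ck_on_mult Ck_on_sum Ck_on_const Ck_on_diff Ck_on_add P o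
        Ck_on_matrix_inv gram_Ck[OF c] metric_matrix_invertible[OF A g c])
qed

lemma bilinear_Chr: "bilinear (Chr c x)"
  unfolding bilinear_def Chr_def
  by (auto intro!: linearI simp: vec_eq_iff sum.distrib[symmetric] sum_distrib_left algebra_simps)

lemma Chr_continuous:
  assumes "c \<in> A" "continuous_on S x" "continuous_on S u" "continuous_on S v" "x ` S \<subseteq> chart_image c"
  shows "continuous_on S (\<lambda>t. Chr c (x t) (u t) (v t))"
  unfolding Chr_def
  by (intro continuous_intros continuous_on_compose2[OF Ck_on_continuous[OF christoffel_Ck] assms(2)] assms)

lemma Chr_Ck:
  fixes S :: "'b::euclidean_space set"
  assumes "c \<in> A" "open S" "Ck_on k S x" "Ck_on k S u" "Ck_on k S v" "x ` S \<subseteq> chart_image c"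
  shows "Ck_on k S (\<lambda>t. Chr c (x t) (u t) (v t))"
  unfolding Chr_def
  by (intro Ck_on_vec_lambda Ck_on_sum Ck_on_mult Ck_on_vec_nth
      Ck_on_compose[OF assms(2) open_chart(2)[OF assms(1)] christoffel_Ck[OF assms(1)]] assms)

text \<open>Compactness of a closed ball bounds the Christoffel symbols and their Lipschitz
  constants; compactness of the ball times the unit sphere, with homogeneity, makes the Riemannian
  and the Euclidean norm comparable. One constant serves all these estimates.\<close>

lemma chart_bounds:
  assumes c: "c \<in> A" and x0: "x0 \<in> chart_image c"
  obtains R K where "R > 0" "K \<ge> 1" "cball x0 R \<subseteq> chart_image c"
    "\<And>x u v. x \<in> cball x0 R \<Longrightarrow> norm (Chr c x u v) \<le> K * norm u * norm v"
    "\<And>x y u v. x \<in> cball x0 R \<Longrightarrow> y \<in> cball x0 R \<Longrightarrow>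
      norm (Chr c x u v - Chr c y u v) \<le> K * norm (x - y) * norm u * norm v"
    "\<And>x u. x \<in> cball x0 R \<Longrightarrow> sqrt (u \<bullet> (gram c x *v u)) \<le> K * norm u"
    "\<And>x u. x \<in> cball x0 R \<Longrightarrow> norm u \<le> K * sqrt (u \<bullet> (gram c x *v u))"
proof -
  obtain R where R: "R > 0" "cball x0 R \<subseteq> chart_image c"
    using open_chart(2)[OF c] x0 open_contains_cball by blast
  let ?C = "cball x0 R"
  let ?ch = "\<lambda>k i j x. christoffel A g c x k i j"
  have chc: "continuous_on ?C (?ch k i j)" for k i j
    using Ck_on_continuous[OF christoffel_Ck[OF c]] R(2) continuous_on_subset by blast
  let ?h = "\<lambda>x. \<Sum>k\<in>UNIV. \<Sum>i\<in>UNIV. \<Sum>j\<in>UNIV. \<bar>?ch k i j x\<bar>"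
  have "bounded (?h ` ?C)"
    by (intro compact_imp_bounded compact_continuous_image continuous_intros chc) auto
  then obtain K1 where K1: "K1 > 0" "\<And>x. x \<in> ?C \<Longrightarrow> norm (?h x) \<le> K1" unfolding bounded_pos by auto
  have b1: "norm (Chr c x u v) \<le> K1 * norm u * norm v" if "x \<in> ?C" for x u v
  proof -
    have "norm (Chr c x u v) \<le> ?h x * norm u * norm v"
      unfolding Chr_def by (rule norm_trilinear_le)
    also have "\<dots> \<le> K1 * norm u * norm v"
      using K1(2)[OF that] by (intro mult_right_mono) auto
    finally show ?thesis .
  qed
  have "\<exists>B\<ge>0. \<forall>x\<in>?C. \<forall>y\<in>?C. \<bar>?ch k i j x - ?ch k i j y\<bar> \<le> B * norm (x - y)" for k i j
    using Ck_on_imp_lipschitz_cball[OF christoffel_Ck[OF c] R(2)] unfolding real_norm_def by metis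
  then obtain B where B: "\<And>k i j. B k i j \<ge> 0"
    "\<And>k i j x y. x \<in> ?C \<Longrightarrow> y \<in> ?C \<Longrightarrow> \<bar>?ch k i j x - ?ch k i j y\<bar> \<le> B k i j * norm (x - y)"
    by metis
  define K2 where "K2 = (\<Sum>k\<in>UNIV. \<Sum>i\<in>UNIV. \<Sum>j\<in>UNIV. B k i j)"
  have K2: "0 \<le> K2" unfolding K2_def by (intro sum_nonneg B)
  have b2: "norm (Chr c x u v - Chr c y u v) \<le> K2 * norm (x - y) * norm u * norm v" if "x \<in> ?C" "y \<in> ?C" for x y u v
  proof -
    have "Chr c x u v - Chr c y u v = (\<chi> k. \<Sum>i\<in>UNIV. \<Sum>j\<in>UNIV. (?ch k i j x - ?ch k i j y) * u $ i * v $ j)"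
      by (simp add: Chr_def vec_eq_iff sum_subtractf[symmetric] left_diff_distrib)
    also have "norm \<dots> \<le> (\<Sum>k\<in>UNIV. \<Sum>i\<in>UNIV. \<Sum>j\<in>UNIV. \<bar>?ch k i j x - ?ch k i j y\<bar>) * norm u * norm v"
      by (rule norm_trilinear_le)
    also have "\<dots> \<le> (\<Sum>k\<in>UNIV. \<Sum>i\<in>UNIV. \<Sum>j\<in>UNIV. B k i j * norm (x - y)) * norm u * norm v"
      by (intro mult_right_mono sum_mono B that) auto
    finally show ?thesis by (simp add: K2_def sum_distrib_right)
  qed
  let ?q = "\<lambda>z :: (real^'n) \<times> (real^'n). snd z \<bullet> (gram c (fst z) *v snd z)"
  let ?S = "?C \<times> sphere (0 :: real^'n) 1"
  have cS: "compact ?S" by (intro compact_Times) auto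
  have gc: "continuous_on ?S (\<lambda>z. gram c (fst z))"
    using R(2) by (intro continuous_on_compose2[OF Ck_on_continuous[OF gram_Ck[OF c]]] continuous_intros) auto
  have qc: "continuous_on ?S ?q"
    by (intro continuous_intros bounded_bilinear.continuous_on[OF bounded_bilinear_mult_vec] gc)
  have pos: "?q z > 0" if "z \<in> ?S" for z
  proof -
    have "snd z \<noteq> 0" using that by auto
    then show ?thesis using that R(2) gram_pos[OF c] by auto
  qed
  have "axis undefined 1 \<in> sphere (0 :: real^'n) 1" by simp
  then have ne: "?S \<noteq> {}" using R(1) by auto
  obtain z0 where z0: "z0 \<in> ?S" "\<And>z. z \<in> ?S \<Longrightarrow> ?q z0 \<le> ?q z"
    using continuous_attains_inf[OF cS ne qc] by blast
  obtain z1 where z1: "z1 \<in> ?S" "\<And>z. z \<in> ?S \<Longrightarrow> ?q z \<le> ?q z1"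
    using continuous_attains_sup[OF cS ne qc] by blast
  define m where "m = sqrt (?q z0)" define M where "M = sqrt (?q z1)"
  have m: "m > 0" using pos[OF z0(1)] by (simp add: m_def)
  have sq: "sqrt (u \<bullet> (gram c x *v u)) \<le> M * norm u" "m * norm u \<le> sqrt (u \<bullet> (gram c x *v u))" if x: "x \<in> ?C" for x u
  proof -
    have "sqrt (u \<bullet> (gram c x *v u)) \<le> M * norm u \<and> m * norm u \<le> sqrt (u \<bullet> (gram c x *v u))"
    proof (cases "u = 0")
      case False
      define w where "w = u /\<^sub>R norm u"
      have u: "u = norm u *\<^sub>R w" using False by (simp add: w_def)
      have wS: "(x, w) \<in> ?S" using x False by (simp add: w_def)
      have "u \<bullet> (gram c x *v u) = (norm u)\<^sup>2 * ?q (x, w)"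
        by (subst (1 2) u) (simp add: matrix_vector_mult_scaleR power2_eq_square)
      then have "sqrt (u \<bullet> (gram c x *v u)) = norm u * sqrt (?q (x, w))"
        by (simp add: real_sqrt_mult)
      then show ?thesis
        using z0(2)[OF wS] z1(2)[OF wS] by (auto simp: m_def M_def mult.commute intro!: mult_left_mono)
    qed simp
    then show "sqrt (u \<bullet> (gram c x *v u)) \<le> M * norm u" "m * norm u \<le> sqrt (u \<bullet> (gram c x *v u))" by auto
  qed
  define K where "K = max (max 1 K1) (max K2 (max M (1 / m)))"
  have K: "1 \<le> K" "K1 \<le> K" "K2 \<le> K" "M \<le> K" "1 / m \<le> K" by (auto simp: K_def)
  show thesis
  proof (rule that[OF R(1) K(1) R(2)])
    fix x y u v assume x: "x \<in> ?C"
    show "norm (Chr c x u v) \<le> K * norm u * norm v"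
      by (intro order_trans[OF b1[OF x]] mult_right_mono K) auto
    show "norm (Chr c x u v - Chr c y u v) \<le> K * norm (x - y) * norm u * norm v" if "y \<in> ?C"
      by (intro order_trans[OF b2[OF x that]] mult_right_mono K) auto
    show "sqrt (u \<bullet> (gram c x *v u)) \<le> K * norm u"
      by (intro order_trans[OF sq(1)[OF x]] mult_right_mono K) auto
    have "norm u \<le> (1 / m) * sqrt (u \<bullet> (gram c x *v u))"
      using sq(2)[OF x, of u] m by (simp add: field_simps)
    also have "\<dots> \<le> K * sqrt (u \<bullet> (gram c x *v u))"
    proof (rule mult_right_mono[OF K(5)])
      show "0 \<le> sqrt (u \<bullet> (gram c x *v u))"
        using order_trans[OF _ sq(2)[OF x, of u], of 0] m by simp
    qed
    finally show "norm u \<le> K * sqrt (u \<bullet> (gram c x *v u))" .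
  qed
qed

end

section \<open>Geodesics between nearby points\<close>

lemma smooth_curve_subset: "smooth_curve A S \<gamma> \<Longrightarrow> T \<subseteq> S \<Longrightarrow> smooth_curve A T \<gamma>"
  unfolding smooth_curve_def by blast

context riemannian_manifold
begin

lemma chart_at: obtains c where "c \<in> A" "p \<in> fst c"
  using A unfolding smooth_structure_def by blast

lemma metric_nonneg:
  assumes "v \<in> tangent_space A p"
  shows "0 \<le> g p v v"
proof -
  obtain c where c: "c \<in> A" "p \<in> fst c" by (rule chart_at)
  have "g p v v = v c \<bullet> (gram c (snd c p) *v v c)"
    using metric_in_chart[OF c, of "v c" "v c"] tangent_of_coord[OF c assms] by simp
  moreover have "snd c p \<in> chart_image c" using c by (simp add: chart_image_def)
  ultimately show ?thesis using gram_pos[OF c(1), of "snd c p" "v c"] by (cases "v c = 0") auto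
qed

text \<open>Supplies the lower bound needed to use the infimum in \<open>riem_dist\<close>. At break
  points the velocity may fail to be a tangent vector, where \<open>g\<close> is arbitrary and
  \<open>sqrt\<close> of a negative number is negative, so the sign is known only off a finite
  set.\<close>

lemma curve_length_nonneg:
  assumes "piecewise_smooth_curve A a b \<gamma>"
  shows "0 \<le> curve_length A g a b \<gamma>"
proof -
  let ?f = "\<lambda>t. tnorm g (\<gamma> t) (velocity A {a..b} \<gamma> t)"
  obtain T where ab: "a < b" and T: "finite T"
    "\<And>u v. a \<le> u \<Longrightarrow> u < v \<Longrightarrow> v \<le> b \<Longrightarrow> {u<..<v} \<inter> T = {} \<Longrightarrow> smooth_curve A {u..v} \<gamma>"
    using assms unfolding piecewise_smooth_curve_def by blast
  have nn: "0 \<le> ?f t" if t: "t \<in> {a<..<b} - T" for t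
  proof -
    have "open ({a<..<b} - T)" using T(1) by (intro open_Diff finite_imp_closed) auto
    then obtain e where e: "e > 0" "cball t e \<subseteq> {a<..<b} - T"
      using t open_contains_cball by blast
    have "{t - e..t + e} = cball t e" by (auto simp: dist_real_def)
    then have sub: "{t - e..t + e} \<subseteq> {a<..<b} - T" using e(2) by simp
    have "t - e \<in> {a<..<b}" "t + e \<in> {a<..<b}"
      using subsetD[OF sub, of "t - e"] subsetD[OF sub, of "t + e"] e(1) by auto
    moreover have "{t - e<..<t + e} \<inter> T = {}"
    proof -
      have "{t - e<..<t + e} \<subseteq> {t - e..t + e}" by auto
      then show ?thesis using sub by blast
    qed
    ultimately have "smooth_curve A {t - e..t + e} \<gamma>"
      using e(1) by (intro T(2)) auto
    then obtain J \<sigma> where J: "open J" "{t - e..t + e} \<subseteq> J" "continuous_on J \<sigma>"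
      and \<sigma>: "\<And>s. s \<in> {t - e..t + e} \<Longrightarrow> \<sigma> s = \<gamma> s"
      and sm: "\<And>c. c \<in> A \<Longrightarrow> smooth_on {s\<in>J. \<sigma> s \<in> fst c} (snd c \<circ> \<sigma>)"
      unfolding smooth_curve_def by blast
    obtain c where c: "c \<in> A" "\<gamma> t \<in> fst c" by (rule chart_at)
    have tJ: "t \<in> J" "\<sigma> t = \<gamma> t" using J(2) \<sigma> e(1) by auto
    have tab: "t \<in> {a..b}" using t by auto
    have near: "\<forall>\<^sub>F s in at t within {a..b}. \<sigma> s = \<gamma> s"
      unfolding eventually_at
    proof (intro exI[of _ e] conjI ballI impI e(1))
      fix s assume "s \<noteq> t \<and> dist s t < e"
      then show "\<sigma> s = \<gamma> s" by (intro \<sigma>) (auto simp: dist_real_def abs_less_iff)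
    qed
    have "open (J \<inter> \<sigma> -` fst c)"
      by (rule continuous_open_preimage[OF J(3,1) open_chart(1)[OF c(1)]])
    then have "\<forall>\<^sub>F s in at t within {a..b}. s \<in> J \<inter> \<sigma> -` fst c"
      unfolding eventually_at_topological using tJ c(2) by blast
    with near have ev: "\<forall>\<^sub>F s in at t within {a..b}. \<gamma> s \<in> fst c"
      by eventually_elim auto
    have "(snd c \<circ> \<sigma>) differentiable (at t)"
      by (rule smooth_on_differentiable[OF sm[OF c(1)]]) (use tJ c in auto)
    then have "((snd c \<circ> \<sigma>) has_vector_derivative vector_derivative (snd c \<circ> \<sigma>) (at t)) (at t within {a..b})"
      using vector_derivative_works has_vector_derivative_at_within by blast
    then have d: "((\<lambda>s. snd c (\<gamma> s)) has_vector_derivative vector_derivative (snd c \<circ> \<sigma>) (at t)) (at t within {a..b})"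
    proof (rule has_vector_derivative_transform_eventually[OF _ _ _ tab])
      show "\<forall>\<^sub>F s in at t within {a..b}. (snd c \<circ> \<sigma>) s = snd c (\<gamma> s)"
        using near by eventually_elim simp
    qed (simp add: tJ)
    have nb: "at t within {a..b} \<noteq> bot"
      using islimpt_Icc[OF ab, of t] tab by (simp add: trivial_limit_within)
    have "velocity A {a..b} \<gamma> t \<in> tangent_space A (\<gamma> t)"
      unfolding velocity_in_chart[of c \<gamma> t "{a..b}", OF c tab nb ev d] by (rule tangent_of_in_tangent_space[OF A c])
    then show ?thesis using metric_nonneg by (simp add: tnorm_def)
  qed
  define f' where "f' t = (if t \<in> {a<..<b} - T then ?f t else 0)" for t
  have "integral {a..b} ?f = integral {a..b} f'"
  proof (rule integral_spike)
    show "negligible (T \<union> {a, b})" using T(1) by (intro negligible_finite) auto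
  qed (auto simp: f'_def)
  moreover have "0 \<le> integral {a..b} f'"
  \<comment> \<open>The integral of a non-integrable function is 0 by convention, so integrability
    of the speed need not be established.\<close>
  proof (cases "f' integrable_on {a..b}")
    case True
    then show ?thesis by (rule Henstock_Kurzweil_Integration.integral_nonneg) (use nn in \<open>auto simp: f'_def\<close>)
  qed (simp add: not_integrable_integral)
  ultimately show ?thesis by (simp add: curve_length_def)
qed

lemma riem_dist_le:
  assumes "piecewise_smooth_curve A a b \<gamma>"
  shows "riem_dist A g (\<gamma> a) (\<gamma> b) \<le> curve_length A g a b \<gamma>"
  unfolding riem_dist_def
proof (rule cInf_lower)
  show "bdd_below {curve_length A g a' b' \<gamma>' | a' b' \<gamma>'. piecewise_smooth_curve A a' b' \<gamma>' \<and> \<gamma>' a' = \<gamma> a \<and> \<gamma>' b' = \<gamma> b}"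
    by (rule bdd_belowI[of _ 0]) (auto intro: curve_length_nonneg)
qed (use assms in blast)

text \<open>Bootstrapping: if position and velocity are of class k, so are the right-hand sides of
  the first-order system, hence position and velocity are of class k + 1.\<close>

lemma geodesic_equation_Ck:
  assumes c: "c \<in> A" and J: "open J" and img: "x ` J \<subseteq> chart_image c"
    and x: "\<And>t. t \<in> J \<Longrightarrow> (x has_vector_derivative v t) (at t)"
    and v: "\<And>t. t \<in> J \<Longrightarrow> (v has_vector_derivative - Chr c (x t) (v t) (v t)) (at t)"
  shows "Ck_on k J x" "Ck_on k J v"
proof -
  have "Ck_on k J x \<and> Ck_on k J v"
  proof (induction k)
    case 0
    have "isCont x t" "isCont v t" if "t \<in> J" for t
      using has_vector_derivative_continuous x[OF that] v[OF that] by blast+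
    then show ?case by (auto intro: continuous_at_imp_continuous_on)
  next
    case (Suc k)
    then have xk: "Ck_on k J x" and vk: "Ck_on k J v" by auto
    have "Ck_on (Suc k) J x"
      by (rule Ck_on_SucI[OF J x[unfolded has_vector_derivative_def]])
        (assumption, intro Ck_on_scaleR Ck_on_const J vk)
    moreover have "Ck_on (Suc k) J v"
    proof (rule Ck_on_SucI[OF J v[unfolded has_vector_derivative_def]])
      fix h :: real
      have "Ck_on k J (\<lambda>t. (- h) *\<^sub>R Chr c (x t) (v t) (v t))"
        by (intro Ck_on_scaleR Ck_on_const J Chr_Ck[OF c J xk vk vk img])
      then show "Ck_on k J (\<lambda>t. h *\<^sub>R - Chr c (x t) (v t) (v t))" by simp
    qed
    ultimately show ?case by simp
  qed
  then show "Ck_on k J x" "Ck_on k J v" by auto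
qed

lemma smooth_curve_chart_inv:
  assumes c: "c \<in> A" and J: "open J" and img: "x ` J \<subseteq> chart_image c" and x: "\<And>k. Ck_on k J x"
  shows "smooth_curve A J (\<lambda>t. chart_inv c (x t))"
proof -
  have cont: "continuous_on J (\<lambda>t. chart_inv c (x t))"
    by (rule continuous_on_compose2[OF chart_continuous(2)[OF c] Ck_on_continuous[OF x] img])
  have "smooth_on {t\<in>J. chart_inv c (x t) \<in> fst d} (snd d \<circ> (\<lambda>t. chart_inv c (x t)))" if d: "d \<in> A" for d
    unfolding smooth_on_def
  proof
    fix k
    let ?S = "{t\<in>J. chart_inv c (x t) \<in> fst d}"
    have "open (J \<inter> (\<lambda>t. chart_inv c (x t)) -` fst d)"
      by (rule continuous_open_preimage[OF cont J open_chart(1)[OF d]])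
    moreover have "J \<inter> (\<lambda>t. chart_inv c (x t)) -` fst d = ?S" by auto
    ultimately have S: "open ?S" by simp
    have "Ck_on k ?S (\<lambda>t. transition c d (x t))"
      using img mem_overlap[OF c]
      by (intro Ck_on_compose[OF S open_overlap[OF c d] transition_Ck[OF c d]] Ck_on_subset[OF x]) auto
    then show "Ck_on k ?S (snd d \<circ> (\<lambda>t. chart_inv c (x t)))"
      by (simp add: transition_def o_def)
  qed
  then show ?thesis using J cont unfolding smooth_curve_def by blast
qed

text \<open>The geodesic solves the boundary value problem in coordinates with speed at most twice
  the coordinate distance of its end points. Parallel transport along it is therefore a linear
  equation with coefficient of that order, which yields a displacement proportional to distance and
  to the vector.\<close>

lemma chart_geodesic:
  assumes c: "c \<in> A" and x0: "x0 \<in> chart_image c"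
  obtains \<rho> C where "\<rho> > 0" "C \<ge> 1" "ball x0 \<rho> \<subseteq> chart_image c"
    "\<And>z u. z \<in> ball x0 \<rho> \<Longrightarrow> norm u \<le> C * tnorm g (chart_inv c z) (tangent_of A c (chart_inv c z) u)"
    "\<And>y z. y \<in> ball x0 \<rho> \<Longrightarrow> z \<in> ball x0 \<rho> \<Longrightarrow> \<exists>\<gamma>. geodesic_segment A g 0 1 \<gamma> \<and> piecewise_smooth_curve A 0 1 \<gamma> \<and>
      \<gamma> 0 = chart_inv c y \<and> \<gamma> 1 = chart_inv c z \<and> curve_length A g 0 1 \<gamma> \<le> C * norm (z - y) \<and>
      (\<forall>\<xi>\<in>tangent_space A (chart_inv c y). \<exists>u. parallel_transport A g 0 1 \<gamma> \<xi> = tangent_of A c (chart_inv c z) u \<and>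
        norm (u - \<xi> c) \<le> C * norm (z - y) * norm (\<xi> c))"
proof -
  obtain R K where R: "R > 0" "K \<ge> 1" "cball x0 R \<subseteq> chart_image c"
    and b: "\<And>x u v. x \<in> cball x0 R \<Longrightarrow> norm (Chr c x u v) \<le> K * norm u * norm v"
    and lip: "\<And>x y u v. x \<in> cball x0 R \<Longrightarrow> y \<in> cball x0 R \<Longrightarrow>
      norm (Chr c x u v - Chr c y u v) \<le> K * norm (x - y) * norm u * norm v"
    and up: "\<And>x u. x \<in> cball x0 R \<Longrightarrow> sqrt (u \<bullet> (gram c x *v u)) \<le> K * norm u"
    and lo: "\<And>x u. x \<in> cball x0 R \<Longrightarrow> norm u \<le> K * sqrt (u \<bullet> (gram c x *v u))"
    by (rule chart_bounds[OF c x0]) blast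
  define \<rho> where "\<rho> = min (R / 17) (1 / (480 * K))"
  have \<rho>: "\<rho> > 0" "\<rho> \<le> R" "480 * K * \<rho> \<le> 1"
  proof -
    show "\<rho> > 0" "\<rho> \<le> R" using R by (auto simp: \<rho>_def)
    have "\<rho> \<le> 1 / (480 * K)" by (simp add: \<rho>_def)
    then show "480 * K * \<rho> \<le> 1" using R(2) by (simp add: field_simps)
  qed
  have tn: "tnorm g (chart_inv c x) (tangent_of A c (chart_inv c x) u) = sqrt (u \<bullet> (gram c x *v u))"
    if "x \<in> chart_image c" for x u
    by (simp add: tnorm_def metric_in_chart[OF c inv_mem[OF that]] inv_right[OF that])
  have geo: "\<exists>\<gamma>. geodesic_segment A g 0 1 \<gamma> \<and> piecewise_smooth_curve A 0 1 \<gamma> \<and>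
      \<gamma> 0 = chart_inv c y \<and> \<gamma> 1 = chart_inv c z \<and> curve_length A g 0 1 \<gamma> \<le> 4 * K * norm (z - y) * K \<and>
      (\<forall>\<xi>\<in>tangent_space A (chart_inv c y). \<exists>u. parallel_transport A g 0 1 \<gamma> \<xi> = tangent_of A c (chart_inv c z) u \<and>
        norm (u - \<xi> c) \<le> 4 * K * norm (z - y) * norm (\<xi> c))"
    if y: "y \<in> ball x0 \<rho>" and z: "z \<in> ball x0 \<rho>" for y z
  proof -
    have yz: "norm (y - x0) < \<rho>" "norm (z - x0) < \<rho>"
      using y z by (auto simp: dist_norm norm_minus_commute)
    obtain x v where xin: "\<And>t. t \<in> {-1..2} \<Longrightarrow> x t \<in> cball x0 R"
      and vb: "\<And>t. t \<in> {-1..2} \<Longrightarrow> norm (v t) \<le> 2 * norm (z - y)"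
      and xd: "\<And>t. -1 < t \<Longrightarrow> t < 2 \<Longrightarrow> (x has_vector_derivative v t) (at t)"
      and vd: "\<And>t. -1 < t \<Longrightarrow> t < 2 \<Longrightarrow> (v has_vector_derivative - Chr c (x t) (v t) (v t)) (at t)"
      and x01: "x 0 = y" "x 1 = z"
    proof (rule quadratic_ode_boundary_value[OF R(1,2), of x0 "Chr c" y z])
      show "continuous_on S (\<lambda>t. Chr c (x t) (u t) (v t))"
        if "continuous_on S x" "continuous_on S u" "continuous_on S v" "x ` S \<subseteq> cball x0 R"
        for S and x u v :: "real \<Rightarrow> real^'n"
        using that R(3) by (intro Chr_continuous[OF c]) auto
    qed (use bilinear_Chr b lip yz in \<open>auto simp: \<rho>_def\<close>)
    define \<gamma> where "\<gamma> t = chart_inv c (x t)" for t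
    let ?J = "{-1<..<2::real}"
    have J: "open ?J" "{0..1} \<subseteq> ?J" by auto
    have xc: "x t \<in> chart_image c" if "t \<in> ?J" for t using xin[of t] that R(3) by auto
    have img: "x ` ?J \<subseteq> chart_image c" using xc by blast
    have \<gamma>c: "\<gamma> t \<in> fst c" "snd c (\<gamma> t) = x t" if "t \<in> ?J" for t
      using inv_mem[OF xc[OF that]] inv_right[OF xc[OF that]] by (auto simp: \<gamma>_def)
    have smooth: "smooth_curve A ?J \<gamma>"
      unfolding \<gamma>_def using geodesic_equation_Ck(1)[OF c J(1) img, of v] xd vd
      by (intro smooth_curve_chart_inv[OF c J(1) img]) auto
    have nbS: "at t within S \<noteq> bot" if "S = ?J \<or> S = {0..1}" "t \<in> S" for S and t :: real
      using that islimpt_Icc[of 0 1 t] by (auto simp: at_within_open trivial_limit_within)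
    have cd: "((\<lambda>s. snd c (\<gamma> s)) has_vector_derivative v t) (at t within S)" if "S \<subseteq> ?J" "t \<in> S" for S t
    proof (rule has_vector_derivative_transform[OF that(2)])
      show "snd c (\<gamma> s) = x s" if "s \<in> S" for s using \<gamma>c \<open>S \<subseteq> ?J\<close> that by blast
      show "(x has_vector_derivative v t) (at t within S)"
      proof -
        have "t \<in> ?J" using that by blast
        then show ?thesis using xd[of t] by (auto intro: has_vector_derivative_at_within)
      qed
    qed
    have vel: "velocity A S \<gamma> t = tangent_of A c (\<gamma> t) (v t)" if S: "S = ?J \<or> S = {0..1}" "t \<in> S" for S t
    proof (rule velocity_in_chart[OF c _ S(2) nbS[OF S]])
      have SJ: "S \<subseteq> ?J" using S J(2) by auto
      show "\<gamma> t \<in> fst c" using \<gamma>c SJ S(2) by blast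
      have "\<forall>s\<in>S. \<gamma> s \<in> fst c" using \<gamma>c(1) SJ by blast
      then show "\<forall>\<^sub>F s in at t within S. \<gamma> s \<in> fst c"
        by (simp add: eventually_at_filter)
      show "((\<lambda>s. snd c (\<gamma> s)) has_vector_derivative v t) (at t within S)" by (rule cd[OF SJ S(2)])
    qed
    have "parallel_along A g ?J \<gamma> (velocity A ?J \<gamma>)"
    proof (rule parallel_alongI[OF c, where x' = v and u = v])
      fix t assume t: "t \<in> ?J"
      show "at t within ?J \<noteq> bot" using nbS[of ?J t] t by blast
      show "\<gamma> t \<in> fst c" by (rule \<gamma>c[OF t])
      show "((\<lambda>s. snd c (\<gamma> s)) has_vector_derivative v t) (at t within ?J)" by (rule cd[OF order_refl t])
      show "velocity A ?J \<gamma> t = tangent_of A c (\<gamma> t) (v t)" using vel t by blast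
      show "(v has_vector_derivative - Chr c (snd c (\<gamma> t)) (v t) (v t)) (at t within ?J)"
        unfolding \<gamma>c(2)[OF t] using vd[of t] t by (auto intro: has_vector_derivative_at_within)
    qed
    then have seg: "geodesic_segment A g 0 1 \<gamma>"
      unfolding geodesic_segment_def geodesic_on_def using smooth J
      by (intro conjI exI[of _ ?J] exI[of _ \<gamma>]) auto
    have "continuous_on ?J \<gamma>"
      unfolding \<gamma>_def using geodesic_equation_Ck(1)[OF c J(1) img, of v 0] xd vd
      by (intro continuous_on_compose2[OF chart_continuous(2)[OF c] _ img]) auto
    then have "continuous_on {0..1} \<gamma>" using J(2) continuous_on_subset by blast
    moreover have "smooth_curve A {a..b} \<gamma>" if "0 \<le> a" "b \<le> 1" for a b
      by (rule smooth_curve_subset[OF smooth]) (use that in auto)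
    ultimately have pw: "piecewise_smooth_curve A 0 1 \<gamma>"
      unfolding piecewise_smooth_curve_def by (intro conjI exI[of _ "{}"]) auto
    let ?I = "{0..1::real}"
    have IJ: "t \<in> ?J" "t \<in> {-1..2}" if "t \<in> ?I" for t using that by auto
    have len: "curve_length A g 0 1 \<gamma> \<le> 4 * K * norm (z - y) * K"
    proof -
      have sp: "tnorm g (\<gamma> t) (velocity A ?I \<gamma> t) \<le> K * (2 * norm (z - y))" if "t \<in> ?I" for t
      proof -
        have "tnorm g (\<gamma> t) (velocity A ?I \<gamma> t) = sqrt (v t \<bullet> (gram c (x t) *v v t))"
          using vel[of ?I t] that tn[OF xc[OF IJ(1)[OF that]]] by (simp add: \<gamma>_def)
        also have "\<dots> \<le> K * norm (v t)" by (rule up[OF xin[OF IJ(2)[OF that]]])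
        also have "\<dots> \<le> K * (2 * norm (z - y))"
          using vb[OF IJ(2)[OF that]] R(2) by (intro mult_left_mono) auto
        finally show ?thesis .
      qed
      have "curve_length A g 0 1 \<gamma> \<le> K * (2 * norm (z - y))"
      \<comment> \<open>If the speed were not integrable, its integral would be 0 by convention and
        the bound would hold trivially.\<close>
      proof (cases "(\<lambda>t. tnorm g (\<gamma> t) (velocity A ?I \<gamma> t)) integrable_on ?I")
        case True
        then have "curve_length A g 0 1 \<gamma> \<le> integral ?I (\<lambda>t. K * (2 * norm (z - y)))"
          unfolding curve_length_def by (intro integral_le sp) auto
        then show ?thesis by simp
      next
        case False
        then show ?thesis using R(2) by (simp add: curve_length_def not_integrable_integral)
      qed
      also have "\<dots> \<le> K * (2 * norm (z - y)) * (2 * K)"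
        using R(2) mult_left_mono[of 1 "2 * K" "K * (2 * norm (z - y))"] by simp
      finally show ?thesis by (simp add: mult_ac)
    qed
    have par: "\<exists>u. parallel_transport A g 0 1 \<gamma> \<xi> = tangent_of A c (chart_inv c z) u \<and>
        norm (u - \<xi> c) \<le> 4 * K * norm (z - y) * norm (\<xi> c)" if \<xi>: "\<xi> \<in> tangent_space A (chart_inv c y)" for \<xi>
    proof -
      define B where "B t w = - Chr c (x t) (v t) w" for t w
      \<comment> \<open>The bound on the Christoffel form times the bound on the speed. Both points
        lie in a ball of radius \<rho>, so the choice of \<rho> keeps it below 1/2.\<close>
      define \<beta> where "\<beta> = K * (2 * norm (z - y))"
      have \<beta>: "0 \<le> \<beta>" "\<beta> \<le> 1/2"
      proof -
        show "0 \<le> \<beta>" using R(2) by (simp add: \<beta>_def)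
        have "norm (z - y) \<le> 2 * \<rho>" using yz norm_triangle_ineq4[of "z - x0" "y - x0"] by simp
        then have "\<beta> \<le> K * (2 * (2 * \<rho>))"
          unfolding \<beta>_def using R(2) by (intro mult_left_mono) auto
        then show "\<beta> \<le> 1/2" using \<rho>(3) by simp
      qed
      have Blin: "linear (B t)" for t
      proof -
        have "linear (Chr c (x t) (v t))" using bilinear_Chr unfolding bilinear_def by blast
        then show ?thesis unfolding B_def by (rule linear_compose_neg)
      qed
      have Bb: "norm (B t w) \<le> \<beta> * norm w" if "t \<in> ?I" for t w
      proof -
        have "norm (B t w) \<le> K * norm (v t) * norm w"
          using b[OF xin[OF IJ(2)[OF that]]] by (simp add: B_def)
        also have "\<dots> \<le> \<beta> * norm w"
          unfolding \<beta>_def using vb[OF IJ(2)[OF that]] R(2) by (intro mult_right_mono mult_left_mono) auto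
        finally show ?thesis .
      qed
      have Bc: "continuous_on ?I (\<lambda>t. B t (u t))" if "continuous_on ?I u" for u
      proof -
        have "continuous_on ?I x" "continuous_on ?I v"
          using geodesic_equation_Ck[OF c J(1) img, of v 0] xd vd by (auto intro: continuous_on_subset[OF _ J(2)])
        then show ?thesis
          unfolding B_def using that xc IJ by (intro continuous_intros Chr_continuous[OF c]) auto
      qed
      have "\<exists>u. u 0 = \<xi> c \<and> (\<forall>t\<in>?I. (u has_vector_derivative B t (u t)) (at t within ?I)) \<and>
          norm (u 1 - \<xi> c) \<le> 2 * \<beta> * norm (\<xi> c)"
        by (rule linear_ode_exists[OF \<beta> Blin Bb Bc, where ini = "\<xi> c"]) (assumption | blast)+
      then obtain u where u0: "u 0 = \<xi> c"
        and ud: "\<And>t. t \<in> ?I \<Longrightarrow> (u has_vector_derivative B t (u t)) (at t within ?I)"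
        and ub: "norm (u 1 - \<xi> c) \<le> 2 * \<beta> * norm (\<xi> c)"
        by blast
      define V where "V t = tangent_of A c (\<gamma> t) (u t)" for t
      have V: "parallel_along A g ?I \<gamma> V"
      proof (rule parallel_alongI[OF c, where x' = v and u = u])
        fix t assume t: "t \<in> ?I"
        show "at t within ?I \<noteq> bot" using nbS[of ?I t] t by blast
        show "\<gamma> t \<in> fst c" by (rule \<gamma>c[OF IJ(1)[OF t]])
        show "((\<lambda>s. snd c (\<gamma> s)) has_vector_derivative v t) (at t within ?I)" by (rule cd[OF J(2) t])
        show "V t = tangent_of A c (\<gamma> t) (u t)" by (simp add: V_def)
        show "(u has_vector_derivative - Chr c (snd c (\<gamma> t)) (v t) (u t)) (at t within ?I)"
          unfolding \<gamma>c(2)[OF IJ(1)[OF t]] using ud[OF t] by (simp add: B_def)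
      qed
      have \<gamma>01: "\<gamma> 0 = chart_inv c y" "\<gamma> 1 = chart_inv c z" by (auto simp: \<gamma>_def x01)
      have V0: "V 0 = \<xi>"
        using tangent_of_coord[OF c \<gamma>c(1)[OF IJ(1)], of 0 \<xi>] \<xi> by (simp add: V_def u0 \<gamma>01)
      \<comment> \<open>The definite description in \<open>parallel_transport\<close> requires all
        parallel fields with the same initial value to end at the same vector. In \<open>c\<close>
        their differences solve a homogeneous linear equation with zero initial value.\<close>
      have uniq: "W 1 = V 1" if W: "parallel_along A g ?I \<gamma> W" "W 0 = \<xi>" for W
      proof -
        have Wd: "((\<lambda>s. W s c) has_vector_derivative B t (W t c)) (at t within ?I)" if t: "t \<in> ?I" for t
        proof -
          have "velocity A ?I \<gamma> t c = v t"
            using vel[of ?I t] t tangent_of_same[OF A c \<gamma>c(1)[OF IJ(1)[OF t]]] by simp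
          from parallel_along_coord[OF c \<gamma>c(1)[OF IJ(1)[OF t]] t W(1) this]
          show ?thesis by (simp add: B_def \<gamma>c(2)[OF IJ(1)[OF t]])
        qed
        have "W 1 c - u 1 = 0"
        proof (rule linear_ode_unique_zero[where B = B and z = "\<lambda>t. W t c - u t"])
          show "norm (B t w) \<le> 1/2 * norm w" if "t \<in> ?I" for t w
            by (rule order_trans[OF Bb[OF that]]) (intro mult_right_mono \<beta>, simp)
          show "W 0 c - u 0 = 0" by (simp add: W u0)
          show "((\<lambda>t. W t c - u t) has_vector_derivative B t (W t c - u t)) (at t within ?I)" if "t \<in> ?I" for t
            unfolding linear_diff[OF Blin] by (intro has_vector_derivative_diff Wd ud that)
        qed simp
        moreover have "W 1 \<in> tangent_space A (\<gamma> 1)" using W(1) by (auto simp: parallel_along_def)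
        ultimately show ?thesis
          using tangent_of_coord[OF c \<gamma>c(1)[OF IJ(1)], of 1 "W 1"] by (simp add: V_def)
      qed
      have "parallel_transport A g 0 1 \<gamma> \<xi> = V 1"
        unfolding parallel_transport_def
      proof (rule the_equality)
        show "\<exists>V'. parallel_along A g ?I \<gamma> V' \<and> V' 0 = \<xi> \<and> V' 1 = V 1" using V V0 by blast
        show "w = V 1" if "\<exists>V'. parallel_along A g ?I \<gamma> V' \<and> V' 0 = \<xi> \<and> V' 1 = w" for w
          using that uniq by blast
      qed
      then show ?thesis using ub by (intro exI[of _ "u 1"]) (simp add: V_def \<gamma>01 \<beta>_def mult_ac)
    qed
    show ?thesis
      using seg pw len par by (intro exI[of _ \<gamma>]) (simp add: \<gamma>_def x01)
  qed
  \<comment> \<open>Dominates the factor K of the norm comparison, the factor 4 * K of the transport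
    estimate and the factor of the length bound, which was weakened by 2 * K \<ge> 1 to have the
    same form.\<close>
  define C where "C = 4 * K * K"
  have KK: "1 \<le> K * K" using mult_mono[of 1 K 1 K] R(2) by simp
  have K1: "K \<le> K * K" using mult_right_mono[of 1 K K] R(2) by simp
  have C: "C \<ge> 1" "K \<le> C" "4 * K \<le> C" using KK K1 R(2) unfolding C_def by (linarith | simp)+
  show thesis
  proof (rule that[OF \<rho>(1) C(1)])
    show sub: "ball x0 \<rho> \<subseteq> chart_image c" using R(3) \<rho>(2) by (auto simp: subset_eq)
    show "norm u \<le> C * tnorm g (chart_inv c z) (tangent_of A c (chart_inv c z) u)" if z: "z \<in> ball x0 \<rho>" for z u
    proof -
      have zR: "z \<in> cball x0 R" "z \<in> chart_image c" using z \<rho>(2) sub by auto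
      have "0 \<le> g (chart_inv c z) (tangent_of A c (chart_inv c z) u) (tangent_of A c (chart_inv c z) u)"
        by (rule metric_nonneg[OF tangent_of_in_tangent_space[OF A c inv_mem[OF zR(2)]]])
      then have nn: "0 \<le> tnorm g (chart_inv c z) (tangent_of A c (chart_inv c z) u)" by (simp add: tnorm_def)
      have "norm u \<le> K * tnorm g (chart_inv c z) (tangent_of A c (chart_inv c z) u)"
        unfolding tn[OF zR(2)] by (rule lo[OF zR(1)])
      also have "\<dots> \<le> C * tnorm g (chart_inv c z) (tangent_of A c (chart_inv c z) u)"
        by (rule mult_right_mono[OF C(2) nn])
      finally show ?thesis .
    qed
    fix y z assume yz: "y \<in> ball x0 \<rho>" "z \<in> ball x0 \<rho>"
    obtain \<gamma> where \<gamma>: "geodesic_segment A g 0 1 \<gamma>" "piecewise_smooth_curve A 0 1 \<gamma>"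
      "\<gamma> 0 = chart_inv c y" "\<gamma> 1 = chart_inv c z" "curve_length A g 0 1 \<gamma> \<le> 4 * K * norm (z - y) * K"
      and tr: "\<And>\<xi>. \<xi> \<in> tangent_space A (chart_inv c y) \<Longrightarrow>
        \<exists>u. parallel_transport A g 0 1 \<gamma> \<xi> = tangent_of A c (chart_inv c z) u \<and>
          norm (u - \<xi> c) \<le> 4 * K * norm (z - y) * norm (\<xi> c)"
      using geo[OF yz] by blast
    have "curve_length A g 0 1 \<gamma> \<le> C * norm (z - y)" using \<gamma>(5) by (simp add: C_def mult_ac)
    moreover have "\<exists>u. parallel_transport A g 0 1 \<gamma> \<xi> = tangent_of A c (chart_inv c z) u \<and>
          norm (u - \<xi> c) \<le> C * norm (z - y) * norm (\<xi> c)" if "\<xi> \<in> tangent_space A (chart_inv c y)" for \<xi>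
    proof -
      have "4 * K * norm (z - y) * norm (\<xi> c) \<le> C * norm (z - y) * norm (\<xi> c)"
        using C(3) by (intro mult_right_mono) auto
      then show ?thesis using tr[OF that] order_trans by blast
    qed
    ultimately show "\<exists>\<gamma>. geodesic_segment A g 0 1 \<gamma> \<and> piecewise_smooth_curve A 0 1 \<gamma> \<and>
      \<gamma> 0 = chart_inv c y \<and> \<gamma> 1 = chart_inv c z \<and> curve_length A g 0 1 \<gamma> \<le> C * norm (z - y) \<and>
      (\<forall>\<xi>\<in>tangent_space A (chart_inv c y). \<exists>u. parallel_transport A g 0 1 \<gamma> \<xi> = tangent_of A c (chart_inv c z) u \<and>
        norm (u - \<xi> c) \<le> C * norm (z - y) * norm (\<xi> c))"
      using \<gamma>(1-4) by (intro exI[of _ \<gamma>]) simp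
  qed
qed

end

section \<open>Almost everywhere differentiability\<close>

context riemannian_manifold
begin

text \<open>The coordinate estimate has a constant that involves the size of \<open>X\<close> at one
  of the two points. With that point at the centre it bounds \<open>X\<close> on the ball; with this
  bound inserted it becomes a uniform Lipschitz estimate.\<close>

lemma lipschitz_in_chart:
  assumes c: "c \<in> A" and x0: "x0 \<in> chart_image c"
    and X: "vector_field A X" and lipX: "locally_lipschitz_vector_field A g X"
  shows "\<exists>r>0. \<exists>L. ball x0 r \<subseteq> chart_image c \<and> L-lipschitz_on (ball x0 r) (\<lambda>x. X (chart_inv c x) c)"
proof -
  let ?\<xi> = "\<lambda>x. X (chart_inv c x) c"
  obtain \<rho> C where \<rho>: "\<rho> > 0" and C: "C \<ge> 1" and sub: "ball x0 \<rho> \<subseteq> chart_image c"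
    and norm_le: "\<And>z u. z \<in> ball x0 \<rho> \<Longrightarrow> norm u \<le> C * tnorm g (chart_inv c z) (tangent_of A c (chart_inv c z) u)"
    and geo: "\<And>y z. y \<in> ball x0 \<rho> \<Longrightarrow> z \<in> ball x0 \<rho> \<Longrightarrow> \<exists>\<gamma>. geodesic_segment A g 0 1 \<gamma> \<and> piecewise_smooth_curve A 0 1 \<gamma> \<and>
      \<gamma> 0 = chart_inv c y \<and> \<gamma> 1 = chart_inv c z \<and> curve_length A g 0 1 \<gamma> \<le> C * norm (z - y) \<and>
      (\<forall>\<xi>\<in>tangent_space A (chart_inv c y). \<exists>u. parallel_transport A g 0 1 \<gamma> \<xi> = tangent_of A c (chart_inv c z) u \<and>
        norm (u - \<xi> c) \<le> C * norm (z - y) * norm (\<xi> c))"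
    by (rule chart_geodesic[OF c x0]) (rule that)
  obtain \<delta> where \<delta>: "\<delta> > 0" and lip\<delta>: "lipschitz_vector_field_on A g (riem_ball A g (chart_inv c x0) \<delta>) X"
    using lipX unfolding locally_lipschitz_vector_field_def by blast
  obtain L where L: "L > 0" and lipL: "\<forall>p\<in>riem_ball A g (chart_inv c x0) \<delta>. \<forall>q\<in>riem_ball A g (chart_inv c x0) \<delta>.
      \<forall>a b \<gamma>. geodesic_segment A g a b \<gamma> \<and> \<gamma> a = p \<and> \<gamma> b = q \<longrightarrow>
        tnorm g q (\<lambda>c. parallel_transport A g a b \<gamma> (X p) c - X q c) \<le> L * curve_length A g a b \<gamma>"
    using lip\<delta> unfolding lipschitz_vector_field_on_def by (elim exE conjE)
  have lip: "tnorm g q (\<lambda>c. parallel_transport A g a b \<gamma> (X p) c - X q c) \<le> L * curve_length A g a b \<gamma>"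
    if "p \<in> riem_ball A g (chart_inv c x0) \<delta>" "q \<in> riem_ball A g (chart_inv c x0) \<delta>"
      "geodesic_segment A g a b \<gamma>" "\<gamma> a = p" "\<gamma> b = q" for p q a b \<gamma>
    using lipL[rule_format, OF that(1,2), of a b \<gamma>] that(3-5) by blast
  \<comment> \<open>A point at coordinate distance below \<delta> / C is joined to the centre by a
    curve shorter than \<delta>, hence lies in the Riemannian ball where the hypothesis
    holds.\<close>
  define r where "r = min \<rho> (\<delta> / C)"
  have r: "r > 0" "r \<le> \<rho>" using \<rho> \<delta> C by (auto simp: r_def)
  have x0r: "x0 \<in> ball x0 r" using r by simp
  have rb: "chart_inv c z \<in> riem_ball A g (chart_inv c x0) \<delta>" if z: "z \<in> ball x0 r" for z
  proof -
    have "x0 \<in> ball x0 \<rho>" "z \<in> ball x0 \<rho>" using z r by auto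
    then obtain \<gamma> where \<gamma>: "piecewise_smooth_curve A 0 1 \<gamma>" "\<gamma> 0 = chart_inv c x0" "\<gamma> 1 = chart_inv c z"
      "curve_length A g 0 1 \<gamma> \<le> C * norm (z - x0)"
      using geo by blast
    have "riem_dist A g (chart_inv c x0) (chart_inv c z) \<le> C * norm (z - x0)"
      using riem_dist_le[OF \<gamma>(1)] \<gamma> by simp
    also have "\<dots> < C * (\<delta> / C)"
      using z C by (intro mult_strict_left_mono) (auto simp: r_def dist_norm norm_minus_commute)
    also have "\<dots> = \<delta>" using C by simp
    finally show ?thesis by (simp add: riem_ball_def)
  qed
  \<comment> \<open>The transported vector \<open>u\<close> is inserted between the two values: its
    distance from the value at \<open>z\<close> is controlled by the hypothesis on \<open>X\<close>,
    its distance from the value at \<open>y\<close> by the transport estimate.\<close>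
  have est: "norm (?\<xi> y - ?\<xi> z) \<le> (C * norm (?\<xi> y) + C * (L * C)) * norm (z - y)"
    if y: "y \<in> ball x0 r" and z: "z \<in> ball x0 r" for y z
  proof -
    have yz: "y \<in> ball x0 \<rho>" "z \<in> ball x0 \<rho>" using y z r by auto
    let ?p = "chart_inv c y" and ?q = "chart_inv c z"
    have "z \<in> chart_image c" using sub yz(2) by blast
    then have q: "?q \<in> fst c" by (rule inv_mem)
    have XT: "X p \<in> tangent_space A p" for p using X by (simp add: vector_field_def)
    obtain \<gamma> where \<gamma>: "geodesic_segment A g 0 1 \<gamma>" "\<gamma> 0 = ?p" "\<gamma> 1 = ?q"
      "curve_length A g 0 1 \<gamma> \<le> C * norm (z - y)"
      and tr: "\<exists>u. parallel_transport A g 0 1 \<gamma> (X ?p) = tangent_of A c ?q u \<and>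
        norm (u - ?\<xi> y) \<le> C * norm (z - y) * norm (?\<xi> y)"
      using geo[OF yz] XT[of ?p] by blast
    obtain u where u: "parallel_transport A g 0 1 \<gamma> (X ?p) = tangent_of A c ?q u"
      "norm (u - ?\<xi> y) \<le> C * norm (z - y) * norm (?\<xi> y)" using tr by blast
    have "tangent_of A c ?q (u - ?\<xi> z) = (\<lambda>d. tangent_of A c ?q u d - tangent_of A c ?q (?\<xi> z) d)"
      using tangent_of_add[OF A c q, of u "- ?\<xi> z"] tangent_of_scale[OF A c q, of "-1" "?\<xi> z"] by simp
    also have "tangent_of A c ?q (?\<xi> z) = X ?q" by (rule tangent_of_coord[OF c q XT])
    finally have diff: "tangent_of A c ?q (u - ?\<xi> z) = (\<lambda>d. parallel_transport A g 0 1 \<gamma> (X ?p) d - X ?q d)"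
      by (simp add: u(1))
    have "norm (u - ?\<xi> z) \<le> C * tnorm g ?q (tangent_of A c ?q (u - ?\<xi> z))" by (rule norm_le[OF yz(2)])
    also have "\<dots> \<le> C * (L * curve_length A g 0 1 \<gamma>)"
      unfolding diff using C lip[OF rb[OF y] rb[OF z] \<gamma>(1-3)] by (intro mult_left_mono) auto
    also have "\<dots> \<le> C * (L * (C * norm (z - y)))"
      using C L \<gamma>(4) by (intro mult_left_mono) auto
    finally have 1: "norm (u - ?\<xi> z) \<le> C * (L * (C * norm (z - y)))" .
    have "?\<xi> y - ?\<xi> z = (u - ?\<xi> z) - (u - ?\<xi> y)" by simp
    then have "norm (?\<xi> y - ?\<xi> z) \<le> norm (u - ?\<xi> z) + norm (u - ?\<xi> y)" by (metis norm_triangle_ineq4)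
    also have "\<dots> \<le> C * (L * (C * norm (z - y))) + C * norm (z - y) * norm (?\<xi> y)"
      by (intro add_mono 1 u)
    finally show ?thesis by (simp add: algebra_simps)
  qed
  define M where "M = norm (?\<xi> x0) + (C * norm (?\<xi> x0) + C * (L * C)) * r"
  have M: "norm (?\<xi> z) \<le> M" if z: "z \<in> ball x0 r" for z
  proof -
    have "norm (?\<xi> z) \<le> norm (?\<xi> x0) + norm (?\<xi> x0 - ?\<xi> z)"
      using norm_triangle_ineq4[of "?\<xi> x0" "?\<xi> x0 - ?\<xi> z"] by simp
    also have "norm (?\<xi> x0 - ?\<xi> z) \<le> (C * norm (?\<xi> x0) + C * (L * C)) * norm (z - x0)"
      by (rule est[OF x0r z])
    also have "\<dots> \<le> (C * norm (?\<xi> x0) + C * (L * C)) * r"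
      using z C L by (intro mult_left_mono) (auto simp: dist_norm norm_minus_commute)
    finally show ?thesis by (simp add: M_def)
  qed
  have M0: "0 \<le> M" using M[OF x0r] norm_ge_zero order_trans by blast
  have "(C * M + C * (L * C))-lipschitz_on (ball x0 r) ?\<xi>"
  proof (rule lipschitz_onI)
    fix y z assume y: "y \<in> ball x0 r" and z: "z \<in> ball x0 r"
    have "norm (?\<xi> y - ?\<xi> z) \<le> (C * norm (?\<xi> y) + C * (L * C)) * norm (z - y)" by (rule est[OF y z])
    also have "\<dots> \<le> (C * M + C * (L * C)) * norm (z - y)"
      using C M[OF y] by (intro mult_right_mono add_mono mult_left_mono) auto
    finally show "dist (?\<xi> y) (?\<xi> z) \<le> (C * M + C * (L * C)) * dist y z"
      by (simp add: dist_norm norm_minus_commute)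
  qed (use C L M0 in simp)
  moreover have "ball x0 r \<subseteq> chart_image c" using sub r by auto
  ultimately show ?thesis using r(1) by blast
qed

section \<open>Charts of the tangent bundle\<close>

abbreviation tb_chart :: "('m, real^'n) chart \<Rightarrow> ('m \<times> ('m, 'n) tangent, (real^'n) \<times> (real^'n)) chart" where
  "tb_chart c \<equiv> ({(p, v). p \<in> fst c \<and> v \<in> tangent_space A p}, \<lambda>(p, v). (snd c p, v c))"

lemma tb_chart_inj:
  assumes "c \<in> A"
  shows "inj_on (snd (tb_chart c)) (fst (tb_chart c))"
proof (rule inj_onI)
  fix a b assume a: "a \<in> fst (tb_chart c)" and b: "b \<in> fst (tb_chart c)"
    and eq: "snd (tb_chart c) a = snd (tb_chart c) b"
  obtain p v q w where ab: "a = (p, v)" "b = (q, w)" by (cases a, cases b) blast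
  have pq: "p \<in> fst c" "v \<in> tangent_space A p" "q \<in> fst c" "w \<in> tangent_space A q"
    "snd c p = snd c q" "v c = w c" using a b eq by (auto simp: ab)
  have "p = q" using inv_left[OF assms pq(1)] inv_left[OF assms pq(3)] unfolding pq(5) by (rule trans[OF sym])
  moreover have "v = w"
    using tangent_of_coord[OF assms pq(1,2)] tangent_of_coord[OF assms pq(3,4)]
    unfolding pq(6) \<open>p = q\<close> by (rule trans[OF sym])
  ultimately show "a = b" by (simp add: ab)
qed

lemma tb_chart_overlap:
  assumes c: "c \<in> A"
  shows "snd (tb_chart c) ` (fst (tb_chart c) \<inter> fst (tb_chart d)) = overlap c d \<times> UNIV"
proof (intro equalityI subsetI)
  fix z assume "z \<in> overlap c d \<times> (UNIV :: (real^'n) set)"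
  then obtain p u where p: "p \<in> fst c" "p \<in> fst d" and z: "z = (snd c p, u)" by auto
  have m: "(p, tangent_of A c p u) \<in> fst (tb_chart c) \<inter> fst (tb_chart d)"
    using p tangent_of_in_tangent_space[OF A c p(1)] by auto
  have e: "snd (tb_chart c) (p, tangent_of A c p u) = z"
    by (simp add: z tangent_of_same[OF A c p(1)])
  show "z \<in> snd (tb_chart c) ` (fst (tb_chart c) \<inter> fst (tb_chart d))"
    unfolding e[symmetric] by (rule imageI[OF m])
qed auto

lemma tb_chart_transition:
  assumes c: "c \<in> A" and d: "d \<in> A" and x: "x \<in> overlap c d"
  shows "transition (tb_chart c) (tb_chart d) (x, u) = (transition c d x, Dtr c d x u)"
proof -
  obtain p where p: "p \<in> fst c" "p \<in> fst d" "x = snd c p" using x by auto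
  let ?a = "(p, tangent_of A c p u)"
  have a: "?a \<in> fst (tb_chart c)" using p tangent_of_in_tangent_space[OF A c p(1)] by auto
  have "snd (tb_chart c) ?a = (x, u)" by (simp add: p tangent_of_same[OF A c p(1)])
  then have "chart_inv (tb_chart c) (x, u) = ?a"
    unfolding chart_inv_def using inv_into_f_f[OF tb_chart_inj[OF c] a] by simp
  then have "transition (tb_chart c) (tb_chart d) (x, u) = (snd d p, tangent_of A c p u d)"
    by (simp add: transition_def)
  moreover have "tangent_of A c p u d = Dtr c d x u" using d p by (simp add: tangent_of_def)
  moreover have "snd d p = transition c d x" using inv_left[OF c p(1)] p by (simp add: transition_def)
  ultimately show ?thesis by simp
qed

text \<open>The fibre part is linear in the fibre coordinate, so its basis expansion separates the
  two variables into products of smooth functions.\<close>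

lemma tb_chart_transition_smooth:
  assumes c: "c \<in> A" and d: "d \<in> A"
  shows "smooth_on (overlap c d \<times> UNIV) (transition (tb_chart c) (tb_chart d))"
  unfolding smooth_on_def
proof
  fix k
  let ?S = "overlap c d \<times> (UNIV :: (real^'n) set)"
  have S: "open ?S" using open_overlap[OF c d] by (intro open_Times) auto
  have fst_Ck: "Ck_on k ?S fst" and snd_Ck: "Ck_on k ?S snd"
    by (intro Ck_on_bounded_linear S bounded_linear_fst bounded_linear_snd)+
  have im: "fst ` ?S \<subseteq> overlap c d" by auto
  have "Ck_on k ?S (\<lambda>z. (transition c d (fst z), \<Sum>b\<in>Basis. (snd z \<bullet> b) *\<^sub>R Dtr c d (fst z) b))"
    by (intro Ck_on_Pair Ck_on_sum Ck_on_scaleR Ck_on_linear_comp[OF _ bounded_linear_inner_left] S snd_Ck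
        Ck_on_compose[OF S open_overlap[OF c d] transition_Ck[OF c d] fst_Ck im]
        Ck_on_compose[OF S open_overlap[OF c d] Ck_on_derivative[OF transition_Ck[OF c d]] fst_Ck im])
  then show "Ck_on k ?S (transition (tb_chart c) (tb_chart d))"
  proof (rule Ck_on_cong[OF S, rotated])
    fix z assume "z \<in> ?S"
    then obtain x u where z: "z = (x, u)" and x: "x \<in> overlap c d" by auto
    show "(transition c d (fst z), \<Sum>b\<in>Basis. (snd z \<bullet> b) *\<^sub>R Dtr c d (fst z) b) = transition (tb_chart c) (tb_chart d) z"
      unfolding z tb_chart_transition[OF c d x] using linear_Basis_expansion[OF linear_Dtr[OF c d x], of u] by simp
  qed
qed

text \<open>\<open>differentiable_map_at\<close> only admits charts from
  \<open>smooth_charts\<close> of the bundle atlas, so membership there must be verified for the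
  induced charts.\<close>

lemma tb_chart_smooth:
  assumes c: "c \<in> A"
  shows "tb_chart c \<in> smooth_charts (tangent_bundle_atlas A)"
proof -
  have comp: "compatible (tb_chart c) (tb_chart d)" if d: "d \<in> A" for d
  proof -
    have op: "open (overlap c d \<times> (UNIV :: (real^'n) set))" if "c \<in> A" "d \<in> A" for c d
      using open_overlap[OF that] by (intro open_Times) auto
    show ?thesis
      unfolding compatible_def Int_commute[of "fst (tb_chart c)" "fst (tb_chart d)"]
      unfolding tb_chart_overlap[OF d]
      using op[OF c d] op[OF d c] tb_chart_transition_smooth[OF c d] tb_chart_transition_smooth[OF d c]
        tb_chart_overlap[OF c, of d]
      by (simp only: Int_commute[of "fst (tb_chart d)" "fst (tb_chart c)"] simp_thms)
  qed
  have "chart_image (tb_chart c) = chart_image c \<times> UNIV"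
    using tb_chart_overlap[OF c, of c] by (simp add: chart_image_def)
  then have "open (chart_image (tb_chart c))" using open_chart(2)[OF c] by (simp add: open_Times)
  moreover have "fst (tb_chart c) \<subseteq> \<Union> (fst ` tangent_bundle_atlas A)"
    unfolding tangent_bundle_atlas_def using c by blast
  moreover have "\<forall>e\<in>tangent_bundle_atlas A. compatible (tb_chart c) e"
    unfolding tangent_bundle_atlas_def using comp by blast
  ultimately show ?thesis
    unfolding smooth_charts_def using tb_chart_inj[OF c] by blast
qed

lemma chart_smooth:
  assumes c: "c \<in> A"
  shows "c \<in> smooth_charts A"
proof -
  have "inj_on (snd c) (fst c)"
    using inv_left[OF c] by (rule inj_on_inverseI)
  moreover have "\<forall>d\<in>A. compatible c d" "fst c \<subseteq> \<Union> (fst ` A)"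
    using A c unfolding smooth_structure_def by blast+
  ultimately show ?thesis using open_chart(2)[OF c] unfolding smooth_charts_def by blast
qed

text \<open>In the induced charts the section has base component equal to the identity, so only its
  fibre component has to be differentiable.\<close>

lemma vector_field_differentiable_in_chart:
  assumes c: "c \<in> A" and p: "p \<in> fst c" and X: "vector_field A X"
    and d: "(\<lambda>x. X (chart_inv c x) c) differentiable (at (snd c p))"
  shows "vector_field_differentiable_at A X p"
proof -
  have pc: "snd c p \<in> chart_image c" using p by (simp add: chart_image_def)
  obtain D where D: "((\<lambda>x. X (chart_inv c x) c) has_derivative D) (at (snd c p))"
    using d unfolding differentiable_def by blast
  have "((\<lambda>x. (x, X (chart_inv c x) c)) has_derivative (\<lambda>h. (h, D h))) (at (snd c p))"
    by (intro has_derivative_Pair has_derivative_ident D)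
  then have "((snd (tb_chart c) \<circ> (\<lambda>q. (q, X q)) \<circ> chart_inv c) has_derivative (\<lambda>h. (h, D h))) (at (snd c p))"
    by (rule has_derivative_transform_within_open[OF _ open_chart(2)[OF c] pc]) (simp add: inv_right)
  then have "(snd (tb_chart c) \<circ> (\<lambda>q. (q, X q)) \<circ> chart_inv c) differentiable (at (snd c p))"
    unfolding differentiable_def by blast
  moreover have "(\<lambda>q. (q, X q)) ` chart_inv c ` chart_image c \<subseteq> fst (tb_chart c)"
    using X inv_mem[of _ c] by (auto simp: vector_field_def)
  moreover have "(p, X p) \<in> fst (tb_chart c)" using X p by (simp add: vector_field_def)
  ultimately show ?thesis
    unfolding vector_field_differentiable_at_def differentiable_map_at_def
    using chart_smooth[OF c] tb_chart_smooth[OF c] p open_chart(2)[OF c] pc by blast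
qed

end

theorem theorem10:
  fixes A :: "('m::{t2_space, second_countable_topology}, real^'n::finite) chart set"
    and g :: "('m, 'n) metric"
    and X :: "'m \<Rightarrow> ('m, 'n) tangent"
  assumes "smooth_structure A"
    and "riemannian_metric A g"
    and "connected (UNIV :: 'm set)"
    and "riem_complete A g"
    and "vector_field A X"
    and "locally_lipschitz_vector_field A g X"
  shows "measure_zero A (UNIV - {p. vector_field_differentiable_at A X p})"
  unfolding measure_zero_def
proof
  interpret riemannian_manifold A g by unfold_locales (rule assms)+
  fix c assume "c \<in> smooth_charts A"
  \<comment> \<open>By maximality of \<open>A\<close> every smooth chart already belongs to it, so
    the chart in which the null set is measured also serves to represent \<open>X\<close>.\<close>
  then have c: "c \<in> A" using assms(1) unfolding smooth_structure_def by blast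
  let ?\<xi> = "\<lambda>x. X (chart_inv c x) c"
  have "snd c ` ((UNIV - {p. vector_field_differentiable_at A X p}) \<inter> fst c) \<subseteq>
      {x \<in> chart_image c. \<not> ?\<xi> differentiable (at x)}"
    using vector_field_differentiable_in_chart[OF c _ assms(5)] by (auto simp: chart_image_def)
  moreover have "negligible {x \<in> chart_image c. \<not> ?\<xi> differentiable (at x)}"
    using lipschitz_in_chart[OF c _ assms(5,6)] by (intro Rademacher_locally_lipschitz open_chart(2)[OF c])
  ultimately show "snd c ` ((UNIV - {p. vector_field_differentiable_at A X p}) \<inter> fst c) \<in> null_sets lebesgue"
    using negligible_subset negligible_iff_null_sets by blast
qed

end
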